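(* Let $p$ be a prime and $q=p^h$ with $h\in\mathbb{N}$. Let $\mathcal{B}\subseteq\mathbb{Z}_q^n$ be a box with associated polynomials $g_{ij}$ ($j\in[1,n]$, $i\in\mathbb{N}_0$). Let $f_1,\dots,f_s\in\mathbb{Z}_q[x_1,\dots,x_n]$ be nonzero polynomials, let $m_1,\dots,m_s\in\mathbb{N}$, and let $$V:=\{X\in\mathcal{B}: f_k(X)\equiv0\pmod{p^{m_k}}\text{ for all }k\in[1,s]\}.$$ For each $k\in[1,s]$ write the Teichm\"uller expansion $f_k=\sum_{i=0}^\infty p^if_{k,i}$ with $f_{k,i}=\sum_{j=1}^{r_k}a^{(k)}_{ij}X^{u^{(k)}_j}$ ($a^{(k)}_{ij}\in T_q$, $u^{(k)}_j\in\mathbb{N}_0^n$). Let $d_1,\dots,d_s\in\mathbb{N}$. Suppose that for every $k\in[1,s]$, every $i\in[0,m_k-1]$, every $j\in[1,r_k]$, writing $u^{(k)}_j=(\alpha_1,\dots,\alpha_n)$, and every $\beta=(\beta_{tl})\in\mathbb{N}_0^{|u^{(k)}_j|}$ with $i+|\beta|\leq m_k-1$, we have $$\deg\Big(a^{(k)}_{ij}\prod_{l=1}^n\prod_{t=1}^{\alpha_l}g_{\beta_{tl}l}(X)\Big)\leq d_kp^{h\lfloor (i+|\beta|)/h\rfloor}.$$ Then $$\mathrm{ord}_q(|V|)\geq\left\lceil\frac{n-\sum_{k=1}^s\frac{p^{m_k}-1}{p-1}d_k}{\max_{k\in[1,s]}\{p^{m_k-1}d_k\}}\right\rceil^*.$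$
   Context: $\mathbb{N}$ = positive integers, $\mathbb{N}_0=\mathbb{N}\cup\{0\}$, $[a,b]=\{x\in\mathbb{Z}:a\le x\le b\}$, $\lfloor x\rfloor$ is the floor; $X^u=x_1^{d_1}\cdots x_n^{d_n}$ for $u=(d_1,\dots,d_n)$. $\mathbb{Z}_q$ is the ring of integers of the unramified extension of $\mathbb{Q}_p$ of degree $h$ (residue field $\mathbb{F}_q$); $T_q\subset\mathbb{Z}_q$ is the set of Teichm\"uller representatives of $\mathbb{F}_q$ (i.e. $0$ and the $(q-1)$-th roots of unity). A Teichm\"uller polynomial has all coefficients in $T_q$; a polynomial is reduced if its degree in each variable is at most $q-1$. Every $f\in\mathbb{Z}_q[x_1,\dots,x_n]$ has a unique Teichm\"uller expansion $f=\sum_{i\ge0}p^if_i$ with each $f_i$ a Teichm\"uller polynomial. A box is a subset $\mathcal{B}\subseteq\mathbb{Z}_q^n$ with $|\mathcal{B}|=q^n$ whose reduction modulo $p$ is $\mathbb{F}_q^n$. For such $\mathcal{B}$ there are unique reduced Teichm\"uller polynomials $g_{ij}\in\mathbb{Z}_q[x_1,\dots,x_n]$ ($i\in\mathbb{N}$, $j\in[1,n]$) such that every $Y\in\mathcal{B}$ satisfies $Y=\sum_{i\ge0}(g_{i1}(X),\dots,g_{in}(X))p^i$, where $X\in T_q^n$ is the Teichm\"uller lifting of $Y\bmod p$ and by convention $g_{0j}(X)=x_j$; these are the polynomials associated with $\mathcal{B}$. For $\alpha=(\alpha_1,\dots,\alpha_n)\in\mathbb{N}_0^n$ put $|\alpha|=\sum_l\alpha_l$;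 an element $\beta\in\mathbb{N}_0^{|\alpha|}$ is written $\beta=(\beta_{tl})$ with $l\in[1,n]$, $t\in[1,\alpha_l]$, and $|\beta|=\sum_{l,t}\beta_{tl}$. $\deg$ is total degree. $\mathrm{ord}_q$ is the $q$-adic valuation with $\mathrm{ord}_q(q)=1$; $\lceil t\rceil^*$ is the least nonnegative integer $\geq t$. *)

theory Defs
  imports
    "HOL-Analysis.Analysis"
    "HOL-Library.Poly_Mapping"
    "HOL-Library.Extended_Real"
    "HOL-Library.FuncSet"
    "HOL-Computational_Algebra.Computational_Algebra"
begin

subsection \<open>Unramified extensions of the p-adic numbers\<close>

definition padic_abs :: "nat \<Rightarrow> rat \<Rightarrow> real" where
  "padic_abs p r =
     (if r = 0 then 0
      else real p powi (int (multiplicity (int p) (snd (quotient_of r)))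
                      - int (multiplicity (int p) (fst (quotient_of r)))))"

definition ultrametric_abs :: "('a::field \<Rightarrow> real) \<Rightarrow> bool" where
  "ultrametric_abs av \<longleftrightarrow>
     (\<forall>x. av x \<ge> 0) \<and> (\<forall>x. av x = 0 \<longleftrightarrow> x = 0) \<and>
     (\<forall>x y. av (x * y) = av x * av y) \<and> (\<forall>x y. av (x + y) \<le> max (av x) (av y))"

definition dist_av :: "('a::field \<Rightarrow> real) \<Rightarrow> 'a \<Rightarrow> 'a \<Rightarrow> real" where
  "dist_av av x y = av (x - y)"

abbreviation top_av :: "('a::field \<Rightarrow> real) \<Rightarrow> 'a topology" where
  "top_av av \<equiv> Metric_space.mtopology UNIV (dist_av av)"

text \<open>In a complete field whose absolute value extends the p-adic one of the rationals, the
  closure of the rationals is their p-adic completion, that is, the field of p-adic numbers.\<close>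

definition Qp :: "('a::field_char_0 \<Rightarrow> real) \<Rightarrow> 'a set" where
  "Qp av = (top_av av) closure_of (range of_rat)"

definition degree_over_Qp :: "('a::field_char_0 \<Rightarrow> real) \<Rightarrow> nat \<Rightarrow> bool" where
  "degree_over_Qp av h \<longleftrightarrow>
     (\<exists>b :: nat \<Rightarrow> 'a. \<forall>x. \<exists>!c. c \<in> {..<h} \<rightarrow>\<^sub>E Qp av \<and> x = (\<Sum>i<h. c i * b i))"

definition ring_of_integers :: "('a::field \<Rightarrow> real) \<Rightarrow> 'a set" where
  "ring_of_integers av = {x. av x \<le> 1}"

definition residue_field :: "('a::field \<Rightarrow> real) \<Rightarrow> 'a set set" where
  "residue_field av = ring_of_integers av //
     {(x, y). x \<in> ring_of_integers av \<and> y \<in> ring_of_integers av \<and> av (x - y) < 1}"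

text \<open>The type \<open>'a\<close>, with absolute value \<open>av\<close>, is the unramified extension of degree \<open>h\<close> of the
  p-adic numbers: its degree over them equals the degree of its residue field over the
  field with \<open>p\<close> elements. (Separability of the residue extension is automatic.) Its ring of
  integers is the ring $\mathbb{Z}_q$, $q = p^h$.\<close>

definition unramified_extension :: "nat \<Rightarrow> nat \<Rightarrow> ('a::field_char_0 \<Rightarrow> real) \<Rightarrow> bool" where
  "unramified_extension p h av \<longleftrightarrow>
     prime p \<and> h \<ge> 1 \<and>
     ultrametric_abs av \<and>
     (\<forall>r. av (of_rat r) = padic_abs p r) \<and>
     Metric_space.mcomplete UNIV (dist_av av) \<and>
     degree_over_Qp av h \<and>
     card (residue_field av) = p ^ h"

text \<open>Congruence modulo \<open>p ^ m\<close> in the ring of integers.\<close>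

definition cong_rel :: "nat \<Rightarrow> ('a::field \<Rightarrow> real) \<Rightarrow> nat \<Rightarrow> ('a \<times> 'a) set" where
  "cong_rel p av m =
     {(x, y). x \<in> ring_of_integers av \<and> y \<in> ring_of_integers av \<and>
              (\<exists>z \<in> ring_of_integers av. x - y = of_nat p ^ m * z)}"

definition teich :: "nat \<Rightarrow> nat \<Rightarrow> ('a::field \<Rightarrow> real) \<Rightarrow> 'a set" where
  "teich p h av = {x \<in> ring_of_integers av. x = 0 \<or> x ^ (p ^ h - 1) = 1}"

definition teich_lift :: "nat \<Rightarrow> nat \<Rightarrow> ('a::field \<Rightarrow> real) \<Rightarrow> 'a \<Rightarrow> 'a" where
  "teich_lift p h av y = (THE t. t \<in> teich p h av \<and> (t, y) \<in> cong_rel p av 1)"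


subsection \<open>Polynomials\<close>

text \<open>Polynomials in the variables $x_j$, \<open>j :: 'n\<close>: finitely supported maps from exponent
  vectors to coefficients, with the convolution product.\<close>

type_synonym ('n, 'a) mpoly = "('n \<Rightarrow>\<^sub>0 nat) \<Rightarrow>\<^sub>0 'a"

definition monomial_poly :: "'a \<Rightarrow> ('n \<Rightarrow>\<^sub>0 nat) \<Rightarrow> ('n, 'a::zero) mpoly" where
  "monomial_poly a u = Poly_Mapping.single u a"

definition var_poly :: "'n \<Rightarrow> ('n, 'a::zero_neq_one) mpoly" where
  "var_poly j = monomial_poly 1 (Poly_Mapping.single j 1)"

definition mpoly_eval :: "('n::finite, 'a::comm_semiring_1) mpoly \<Rightarrow> ('n \<Rightarrow> 'a) \<Rightarrow> 'a" where
  "mpoly_eval P x =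
     (\<Sum>u \<in> Poly_Mapping.keys P.
        Poly_Mapping.lookup P u * (\<Prod>j\<in>UNIV. x j ^ Poly_Mapping.lookup u j))"

text \<open>The zero polynomial gets total degree 0; for the degree bounds considered here, which are
  all nonnegative, this agrees with the convention $-\infty$.\<close>

definition total_degree :: "('n::finite, 'a::zero) mpoly \<Rightarrow> nat" where
  "total_degree P =
     Max (insert 0 ((\<lambda>u. \<Sum>j\<in>UNIV. Poly_Mapping.lookup u j) ` Poly_Mapping.keys P))"

definition polys_over :: "'a set \<Rightarrow> ('n, 'a::zero) mpoly set" where
  "polys_over S = {P. \<forall>u. Poly_Mapping.lookup P u \<in> S}"

definition reduced :: "nat \<Rightarrow> ('n, 'a::zero) mpoly \<Rightarrow> bool" where
  "reduced q P \<longleftrightarrow> (\<forall>u \<in> Poly_Mapping.keys P. \<forall>j. Poly_Mapping.lookup u j \<le> q - 1)"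

text \<open>$y = \sum_{i \ge 0} p^i c_i$.\<close>

definition p_expansion :: "nat \<Rightarrow> ('a::field_char_0 \<Rightarrow> real) \<Rightarrow> (nat \<Rightarrow> 'a) \<Rightarrow> 'a \<Rightarrow> bool" where
  "p_expansion p av c y \<longleftrightarrow>
     limitin (top_av av) (\<lambda>N. \<Sum>i<N. of_nat p ^ i * c i) y sequentially"

definition teich_expansion ::
    "nat \<Rightarrow> nat \<Rightarrow> ('a::field_char_0 \<Rightarrow> real) \<Rightarrow>
     ('n, 'a) mpoly \<Rightarrow> (nat \<Rightarrow> ('n, 'a) mpoly) \<Rightarrow> bool" where
  "teich_expansion p h av f F \<longleftrightarrow>
     (\<forall>i. F i \<in> polys_over (teich p h av)) \<and>
     (\<forall>u. p_expansion p av (\<lambda>i. Poly_Mapping.lookup (F i) u) (Poly_Mapping.lookup f u))"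


subsection \<open>Boxes\<close>

definition is_box ::
    "nat \<Rightarrow> nat \<Rightarrow> ('a::field_char_0 \<Rightarrow> real) \<Rightarrow> ('n::finite \<Rightarrow> 'a) set \<Rightarrow> bool" where
  "is_box p h av B \<longleftrightarrow>
     B \<subseteq> {Y. \<forall>j. Y j \<in> ring_of_integers av} \<and>
     card B = (p ^ h) ^ CARD('n) \<and>
     (\<lambda>Y j. cong_rel p av 1 `` {Y j}) ` B
       = {y. \<forall>j. y j \<in> ring_of_integers av // cong_rel p av 1}"

definition associated_polys ::
    "nat \<Rightarrow> nat \<Rightarrow> ('a::field_char_0 \<Rightarrow> real) \<Rightarrow> ('n::finite \<Rightarrow> 'a) set \<Rightarrow>
     (nat \<Rightarrow> 'n \<Rightarrow> ('n, 'a) mpoly) \<Rightarrow> bool" where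
  "associated_polys p h av B g \<longleftrightarrow>
     (\<forall>j. g 0 j = var_poly j) \<and>
     (\<forall>i\<ge>1. \<forall>j. g i j \<in> polys_over (teich p h av) \<and> reduced (p ^ h) (g i j)) \<and>
     (\<forall>Y\<in>B. \<forall>j.
        p_expansion p av (\<lambda>i. mpoly_eval (g i j) (\<lambda>l. teich_lift p h av (Y l))) (Y j))"


subsection \<open>The \<open>q\<close>-adic valuation and the starred ceiling\<close>

text \<open>The valuation normalised by $\mathrm{ord}_q(q) = 1$ for $q = p^h$; it takes values in
  $\frac1h\mathbb{Z} \cup \{\infty\}$.\<close>

definition ord_q :: "nat \<Rightarrow> nat \<Rightarrow> nat \<Rightarrow> ereal" where
  "ord_q p h N = (if N = 0 then \<infinity> else ereal (real (multiplicity p N) / real h))"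

definition ceil_star :: "real \<Rightarrow> nat" where
  "ceil_star t = (LEAST k::nat. t \<le> real k)"

end

theory Submission
  imports Defs "HOL-Number_Theory.Cong" "HOL-Algebra.Exponent" "HOL-Library.Function_Algebras"
begin

text \<open>A point \<open>Y\<close> of the box is a function of its Teichmueller residue \<open>X\<close>, and modulo \<open>p ^ m\<close> the value
  \<open>f Y\<close> is a sum of terms \<open>p ^ v * t X\<close> with \<open>t X\<close> a Teichmueller representative and \<open>t ^ (p ^ v)\<close> a
  monomial of degree at most \<open>d * p ^ v\<close>. Since \<open>(\<Sum> z) ^ (p ^ a) - (\<Sum> z ^ p) ^ (p ^ (a - 1))\<close> is \<open>p ^ a\<close>
  times an integral form of degree \<open>p ^ a\<close>, carrying preserves this shape. So \<open>f Y\<close> vanishes modulo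
  \<open>p ^ m\<close> if and only if \<open>m\<close> polynomials of degrees \<open>d * p ^ v\<close>, \<open>v < m\<close>, vanish at \<open>X\<close> modulo \<open>p\<close>, and the
  bound becomes that of the Ax-Katz theorem for these polynomials.

  The Ax-Katz theorem is proved without adjoining \<open>p\<close>-th roots of unity, following Ward: in the group
  ring of the residue field over the ring of integers, a group element \<open>t\<close> is a polynomial in the
  Teichmueller representative \<open>t\<close> whose coefficients are Gauss sums. The Gauss sum of index \<open>j\<close> is a unit
  times the product of those of index \<open>p ^ k\<close> according to the base-\<open>p\<close> digits of \<open>j\<close>, and the \<open>p\<close>-th
  power of that of index \<open>p ^ k\<close> is a multiple of \<open>p\<close> times that of index \<open>p ^ (k + 1)\<close>. This gives
  Stickelberger's lower bound for the coefficients of the indicator function of the zero set.\<close>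

text \<open>The field is given only through its absolute value. The argument needs \<open>p\<close>
  to be a uniformizer, and this is extracted from the equality of the degree with the residue degree
  by counting classes modulo \<open>p\<close>. The degree hypothesis carries
  \<open>p ^ (h * (v div h))\<close> with \<open>v = i + |\<beta>|\<close> because Teichmueller
  representatives satisfy \<open>x ^ q = x\<close>: the \<open>p ^ v\<close>-th power of a monomial
  is its \<open>p ^ (v mod h)\<close>-th power, so the degree grows only to
  \<open>d * p ^ v\<close>. Over \<open>v < m k\<close> these degrees add up to
  \<open>(p ^ m k - 1) / (p - 1) * d k\<close>, and the largest is
  \<open>p ^ (m k - 1) * d k\<close>: the two constants of the bound. In the group ring a single
  Gauss sum has no fractional valuation. Divisibility shows only in products, by trading
  \<open>p\<close> equal factors for one, until at most \<open>h * (p - 1)\<close> factors are left.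
  The resulting loss of \<open>h\<close> for each polynomial is the valuation of the factor
  \<open>1 / q\<close> in the usual character sum formula for the indicator function of a zero
  set.\<close>

locale unram =
  fixes p h :: nat and av :: "'a::field_char_0 \<Rightarrow> real"
  assumes ext: "unramified_extension p h av"
begin

section \<open>The absolute value, and divisibility by powers of \<open>p\<close>\<close>

lemma prime_p: "prime p" and h_pos: "h \<ge> 1"
  and av_nonneg [simp]: "av x \<ge> 0" and av_eq_0_iff [simp]: "av x = 0 \<longleftrightarrow> x = 0"
  and av_mult: "av (x * y) = av x * av y"
  and av_add: "av (x + y) \<le> max (av x) (av y)"
  and av_of_rat: "av (of_rat r) = padic_abs p r"
  using ext unfolding unramified_extension_def ultrametric_abs_def by auto

lemma p_gt_1: "p > 1" and p_pos: "p > 0"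
  using prime_p prime_gt_1_nat prime_gt_0_nat by auto

lemma av_0 [simp]: "av 0 = 0" by simp

lemma av_1 [simp]: "av 1 = 1"
proof -
  have "av 1 * av 1 = av 1 * 1" using av_mult[of 1 1] by simp
  moreover have "av 1 \<noteq> 0" by simp
  ultimately show ?thesis using mult_left_cancel by blast
qed

lemma av_minus [simp]: "av (- x) = av x"
proof -
  have "av (-1) * av (-1) = 1" using av_mult[of "-1" "-1"] by simp
  then have "(av (-1) - 1) * (av (-1) + 1) = 0" by (simp add: algebra_simps)
  moreover have "av (-1) + 1 \<noteq> 0" using av_nonneg[of "-1"] by linarith
  ultimately have "av (-1) = 1" by simp
  then show ?thesis using av_mult[of "-1" x] by simp
qed

lemma av_minus_commute: "av (x - y) = av (y - x)"
  using av_minus[of "x - y"] by simp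

lemma av_diff: "av (x - y) \<le> max (av x) (av y)"
  using av_add[of x "- y"] by simp

lemma av_power: "av (x ^ n) = av x ^ n"
  by (induction n) (auto simp: av_mult)

lemma av_inverse: "av (inverse x) = inverse (av x)"
proof (cases "x = 0")
  case False
  then have "av (inverse x) * av x = 1" using av_mult[of "inverse x" x] by simp
  then show ?thesis using inverse_unique[of "av x" "av (inverse x)"] by (simp add: mult.commute)
qed simp

lemma av_divide: "av (x / y) = av x / av y"
  by (simp add: divide_inverse av_mult av_inverse)

lemma av_eq_of_close:
  assumes "av (x - y) < av x" shows "av y = av x"
proof (rule antisym)
  show "av y \<le> av x" using av_diff[of x "x - y"] assms by simp
  show "av x \<le> av y" using av_add[of "x - y" y] assms by (simp add: max_def split: if_splits)
qed

lemma av_of_int_eq: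
  assumes "z \<noteq> 0" shows "av (of_int z) = (1 / real p) ^ multiplicity (int p) z"
proof -
  have "av (of_int z) = padic_abs p (of_int z)" using av_of_rat[of "of_int z"] by simp
  also have "\<dots> = real p powi (- int (multiplicity (int p) z))"
    using assms by (simp add: padic_abs_def quotient_of_int)
  finally show ?thesis by (simp add: power_int_minus power_one_over inverse_eq_divide)
qed

lemma av_p: "av (of_nat p) = 1 / real p"
  using av_of_int_eq[of "int p"] p_gt_1 prime_p by (simp add: multiplicity_self)

text \<open>Divisibility by \<open>p ^ m\<close> in the ring of integers (see
  \<open>dv_iff_ex\<close>), so \<open>dv 0\<close> is integrality. In terms of the absolute value
  no quotient has to be carried along, and sums and products reduce to the ultrametric inequality
  and multiplicativity.\<close>

definition dv :: "nat \<Rightarrow> 'a \<Rightarrow> bool" where "dv m x \<longleftrightarrow> av x \<le> (1 / real p) ^ m"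

lemma dv_0_iff: "dv 0 x \<longleftrightarrow> av x \<le> 1" by (simp add: dv_def)

lemma dv_zero [simp]: "dv m 0" by (simp add: dv_def)

lemma dv_add: "dv m x \<Longrightarrow> dv m y \<Longrightarrow> dv m (x + y)"
  unfolding dv_def using av_add[of x y] by (simp add: max_def split: if_splits)

lemma dv_uminus [simp]: "dv m (- x) \<longleftrightarrow> dv m x"
  unfolding dv_def by simp

lemma dv_diff: "dv m x \<Longrightarrow> dv m y \<Longrightarrow> dv m (x - y)"
  using dv_add[of m x "- y"] by simp

lemma dv_mult: "dv m x \<Longrightarrow> dv n y \<Longrightarrow> dv (m + n) (x * y)"
  unfolding dv_def av_mult power_add by (intro mult_mono) auto

lemma dv_mult_left: "dv m x \<Longrightarrow> dv 0 y \<Longrightarrow> dv m (y * x)"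
  using dv_mult[of 0 y m x] by simp

lemma dv_mult_right: "dv m x \<Longrightarrow> dv 0 y \<Longrightarrow> dv m (x * y)"
  using dv_mult[of m x 0 y] by simp

lemma dv_antimono: "dv n x \<Longrightarrow> m \<le> n \<Longrightarrow> dv m x"
  unfolding dv_def using p_gt_1 by (elim order_trans) (intro power_decreasing, auto)

lemma dv_sum: "(\<And>i. i \<in> I \<Longrightarrow> dv m (f i)) \<Longrightarrow> dv m (sum f I)"
  by (induction I rule: infinite_finite_induct) (auto intro: dv_add)

lemma dv_prod: "(\<And>i. i \<in> I \<Longrightarrow> dv (e i) (f i)) \<Longrightarrow> dv (sum e I) (prod f I)"
  by (induction I rule: infinite_finite_induct) (auto simp: dv_0_iff intro: dv_mult)

lemma dv_prod_0: "(\<And>i. i \<in> I \<Longrightarrow> dv 0 (f i)) \<Longrightarrow> dv 0 (prod f I)"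
  using dv_prod[of I "\<lambda>_. 0" f] by simp

lemma dv_power: "dv m x \<Longrightarrow> dv (n * m) (x ^ n)"
  by (induction n) (auto simp: dv_0_iff intro: dv_mult)

lemma dv_power_0: "dv 0 x \<Longrightarrow> dv 0 (x ^ n)"
  using dv_power[of 0 x n] by simp

lemma dv_one [simp]: "dv 0 1" by (simp add: dv_0_iff)

lemma dv_of_int [simp]: "dv 0 (of_int z)"
  using p_gt_1 av_of_int_eq[of z] by (cases "z = 0") (auto simp: dv_0_iff power_le_one)

lemma dv_of_nat [simp]: "dv 0 (of_nat k)"
  using dv_of_int[of "int k"] by simp

lemma dv_p_power: "dv m (of_nat p ^ m)"
  by (simp add: dv_def av_power av_p)

lemma dv_p: "dv 1 (of_nat p)"
  using dv_p_power[of 1] by simp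

lemma dv_p_power_mult: "dv n x \<Longrightarrow> dv (m + n) (of_nat p ^ m * x)"
  by (intro dv_mult dv_p_power)

lemma dv_p_power_mult_iff: "dv (m + n) (of_nat p ^ m * x) \<longleftrightarrow> dv n x"
  using p_pos by (simp add: dv_def av_mult av_power av_p power_add)

lemma dv_iff_ex: "dv m x \<longleftrightarrow> (\<exists>z. dv 0 z \<and> x = of_nat p ^ m * z)"
proof
  assume "dv m x"
  then show "\<exists>z. dv 0 z \<and> x = of_nat p ^ m * z"
    using dv_p_power_mult_iff[of m 0 "x / of_nat p ^ m"] p_pos
    by (intro exI[of _ "x / of_nat p ^ m"]) auto
qed (use dv_p_power_mult[of 0] in auto)

lemma dv_of_int_iff: "dv m (of_int z) \<longleftrightarrow> int p ^ m dvd z"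
proof (cases "z = 0")
  case False
  then have "dv m (of_int z) \<longleftrightarrow> m \<le> multiplicity (int p) z"
    using p_gt_1 by (auto simp: dv_def av_of_int_eq power_decreasing_iff)
  also have "\<dots> \<longleftrightarrow> int p ^ m dvd z"
    using False prime_p p_gt_1 by (intro power_dvd_iff_le_multiplicity[symmetric]) auto
  finally show ?thesis .
qed simp

lemma dv_of_nat_iff: "dv m (of_nat k) \<longleftrightarrow> p ^ m dvd k"
  using dv_of_int_iff[of m "int k"] by (metis of_int_of_nat_eq of_nat_dvd_iff of_nat_power)

lemma dv_inverse: "av x = 1 \<Longrightarrow> dv 0 (inverse x)"
  by (simp add: dv_0_iff av_inverse)

lemma dv_cong_trans: "dv m (x - y) \<Longrightarrow> dv m (y - z) \<Longrightarrow> dv m (x - z)"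
  using dv_add[of m "x - y" "y - z"] by simp

lemma dv_cong_sym: "dv m (x - y) \<Longrightarrow> dv m (y - x)"
  by (simp add: dv_def av_minus_commute)

lemma dv_cong_iff: "dv m (x - y) \<Longrightarrow> dv m x \<longleftrightarrow> dv m y"
  using dv_add[of m "x - y" y] dv_diff[of m x "x - y"] by auto

lemma dv_cong_mult: "dv m (x - x') \<Longrightarrow> dv m (y - y') \<Longrightarrow> dv 0 x' \<Longrightarrow> dv 0 y \<Longrightarrow> dv m (x * y - x' * y')"
proof -
  assume "dv m (x - x')" "dv m (y - y')" "dv 0 x'" "dv 0 y"
  then have "dv m ((x - x') * y + x' * (y - y'))" by (intro dv_add dv_mult_right dv_mult_left)
  then show ?thesis by (simp add: algebra_simps)
qed

lemma dv_cong_prod: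
  assumes "\<And>i. i \<in> I \<Longrightarrow> dv m (f i - g i)" "\<And>i. i \<in> I \<Longrightarrow> dv 0 (f i)" "\<And>i. i \<in> I \<Longrightarrow> dv 0 (g i)"
  shows "dv m (prod f I - prod g I)"
  using assms
proof (induction I rule: infinite_finite_induct)
  case (insert i I)
  then show ?case by (auto intro!: dv_cong_mult dv_prod_0)
qed auto

lemma dv_cong_power:
  assumes "dv m (x - y)" "dv 0 x" "dv 0 y" shows "dv m (x ^ n - y ^ n)"
  using dv_cong_prod[of "{..<n}" m "\<lambda>_. x" "\<lambda>_. y"] assms by simp

lemma eq_of_dv_all:
  assumes "\<And>m. dv m x" shows "x = 0"
proof (rule ccontr)
  assume "x \<noteq> 0"
  then have "av x > 0" using av_nonneg[of x] av_eq_0_iff[of x] by linarith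
  then obtain m where "(1 / real p) ^ m < av x"
    using real_arch_pow_inv[of "av x" "1 / real p"] p_gt_1 by auto
  then show False using assms[of m] by (simp add: dv_def)
qed

subsection \<open>Unramifiedness\<close>

lemma metric_space_av: "Metric_space UNIV (dist_av av)"
proof
  fix x y z :: 'a
  show "0 \<le> dist_av av x y" by (simp add: dist_av_def)
  show "dist_av av x y = dist_av av y x" by (simp add: dist_av_def av_minus_commute)
  show "dist_av av x y = 0 \<longleftrightarrow> x = y" by (simp add: dist_av_def)
  have "av (x - z) \<le> max (av (x - y)) (av (y - z))" using av_add[of "x - y" "y - z"] by simp
  also have "\<dots> \<le> av (x - y) + av (y - z)" by simp
  finally show "dist_av av x z \<le> dist_av av x y + dist_av av y z" by (simp add: dist_av_def)
qed

lemma limitin_av_iff: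
  "limitin (top_av av) f l sequentially \<longleftrightarrow> (\<forall>e>0. \<exists>N. \<forall>n\<ge>N. av (f n - l) < e)"
  by (simp add: Metric_space.limit_metric_sequentially[OF metric_space_av] dist_av_def)

section \<open>The closure of the rationals, and the number of classes modulo
  \<open>p\<close>\<close>

lemma Qp_iff: "x \<in> Qp av \<longleftrightarrow> (\<forall>e>0. \<exists>r. av (x - of_rat r) < e)"
  unfolding Qp_def
  by (simp add: Metric_space.metric_closure_of[OF metric_space_av]
      Metric_space.in_mball[OF metric_space_av] dist_av_def)

lemma Qp_0: "0 \<in> Qp av"
  by (auto simp: Qp_iff intro!: exI[of _ 0])

lemma Qp_diff:
  assumes "x \<in> Qp av" "y \<in> Qp av" shows "x - y \<in> Qp av"
  unfolding Qp_iff
proof (intro allI impI)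
  fix e :: real assume "e > 0"
  with assms obtain r s where rs: "av (x - of_rat r) < e" "av (y - of_rat s) < e"
    unfolding Qp_iff by blast
  have "av (x - y - of_rat (r - s)) = av ((x - of_rat r) - (y - of_rat s))"
    by (simp add: of_rat_diff algebra_simps)
  also have "\<dots> < e" using av_diff[of "x - of_rat r" "y - of_rat s"] rs by simp
  finally show "\<exists>r. av (x - y - of_rat r) < e" ..
qed

lemma Qp_mult:
  assumes "x \<in> Qp av" "y \<in> Qp av" shows "x * y \<in> Qp av"
  unfolding Qp_iff
proof (intro allI impI)
  fix e :: real assume e: "e > 0"
  have ax: "av x + 1 > 0" using av_nonneg[of x] by linarith
  with e have "e / (av x + 1) > 0" by simp
  with assms(2) obtain s where s: "av (y - of_rat s) < e / (av x + 1)" unfolding Qp_iff by blast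
  have as: "av (of_rat s) + 1 > 0" using av_nonneg[of "of_rat s"] by linarith
  with e have "e / (av (of_rat s) + 1) > 0" by simp
  with assms(1) obtain r where r: "av (x - of_rat r) < e / (av (of_rat s) + 1)" unfolding Qp_iff by blast
  have 1: "av (x * (y - of_rat s)) < e"
  proof -
    have "av (x * (y - of_rat s)) \<le> (av x + 1) * av (y - of_rat s)"
      by (simp add: av_mult mult_right_mono)
    also have "\<dots> < (av x + 1) * (e / (av x + 1))" using s ax by (intro mult_strict_left_mono)
    finally show ?thesis using ax by simp
  qed
  have 2: "av (of_rat s * (x - of_rat r)) < e"
  proof -
    have "av (of_rat s * (x - of_rat r)) \<le> (av (of_rat s) + 1) * av (x - of_rat r)"
      by (simp add: av_mult mult_right_mono)
    also have "\<dots> < (av (of_rat s) + 1) * (e / (av (of_rat s) + 1))" using r as by (intro mult_strict_left_mono)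
    finally show ?thesis using as by simp
  qed
  have "av (x * y - of_rat (r * s)) = av (x * (y - of_rat s) + of_rat s * (x - of_rat r))"
    by (simp add: of_rat_mult algebra_simps)
  also have "\<dots> < e" using av_add[of "x * (y - of_rat s)" "of_rat s * (x - of_rat r)"] 1 2 by simp
  finally show "\<exists>r. av (x * y - of_rat r) < e" ..
qed

lemma Qp_inverse:
  assumes "x \<in> Qp av" "x \<noteq> 0" shows "inverse x \<in> Qp av"
  unfolding Qp_iff
proof (intro allI impI)
  fix e :: real assume e: "e > 0"
  have ax: "av x > 0" using assms(2) av_nonneg[of x] av_eq_0_iff[of x] by linarith
  \<comment> \<open>The first bound gives the approximating rational the absolute value of
    \<open>x\<close>, so it is nonzero; the second absorbs the denominator of the difference of the
    inverses.\<close>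
  with e have "min (av x) (e * (av x * av x)) > 0" by simp
  with assms(1) obtain r where r: "av (x - of_rat r) < min (av x) (e * (av x * av x))"
    unfolding Qp_iff by blast
  have avr: "av (of_rat r) = av x" using r by (intro av_eq_of_close) simp
  then have r0: "(of_rat r :: 'a) \<noteq> 0" using ax by force
  have "inverse x - of_rat (inverse r) = - (x - of_rat r) / (x * of_rat r)"
    using r0 assms(2) by (simp only: of_rat_inverse) (simp add: field_simps)
  then have "av (inverse x - of_rat (inverse r)) = av (x - of_rat r) / (av x * av x)"
    by (simp add: av_divide av_mult avr av_minus_commute)
  also have "\<dots> < e" using r ax by (simp add: divide_less_eq)
  finally show "\<exists>r. av (inverse x - of_rat r) < e" ..
qed

text \<open>A rational \<open>r\<close> at distance less than \<open>1 / p\<close> from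
  \<open>z\<close> is \<open>p\<close>-integral, so its reduced denominator \<open>b\<close> is
  prime to \<open>p\<close>, and \<open>n\<close> is the residue of \<open>a / b\<close> modulo
  \<open>p\<close>.\<close>

lemma Zp_digit:
  assumes "z \<in> Qp av" "av z \<le> 1"
  shows "\<exists>n<p. dv 1 (z - of_nat n)"
proof -
  have "1 / real p > 0" using p_pos by simp
  then obtain r where r: "av (z - of_rat r) < 1 / real p" using assms(1) unfolding Qp_iff by blast
  have rd: "dv 1 (z - of_rat r)" using r by (simp add: dv_def)
  have "dv 0 (of_rat r)"
    using dv_diff[of 0 z "z - of_rat r"] assms(2) dv_antimono[OF rd, of 0] by (simp add: dv_0_iff)
  then have r1: "padic_abs p r \<le> 1" by (simp add: dv_0_iff av_of_rat)
  obtain a b where ab: "quotient_of r = (a, b)" by force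
  have b0: "b > 0" and cop: "coprime a b" and rab: "r = of_int a / of_int b"
    using quotient_of_denom_pos[OF ab] quotient_of_coprime[OF ab] quotient_of_div[OF ab] by auto
  have nb: "\<not> int p dvd b"
  proof
    assume pb: "int p dvd b"
    have "\<not> int p dvd a" using pb cop prime_p
      by (meson coprime_common_divisor not_prime_unit prime_nat_int_transfer)
    then have "r \<noteq> 0" using rab b0 by auto
    then have "real p powi (int (multiplicity (int p) b) - int (multiplicity (int p) a)) \<le> 1"
      using r1 by (simp add: padic_abs_def ab)
    moreover have "multiplicity (int p) a = 0" using \<open>\<not> int p dvd a\<close> by (simp add: not_dvd_imp_multiplicity_0)
    moreover have "multiplicity (int p) b > 0" using pb b0 prime_p
      by (simp add: prime_multiplicity_gt_zero_iff)
    ultimately have le: "real p ^ multiplicity (int p) b \<le> 1" and pos: "multiplicity (int p) b > 0"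
      by (auto simp: power_int_def)
    have "1 < real p ^ multiplicity (int p) b" using p_gt_1 pos by (intro one_less_power) auto
    with le show False by linarith
  qed
  then have "coprime b (int p)" using prime_p
    by (metis coprime_commute prime_imp_coprime prime_nat_int_transfer)
  then obtain y where y: "[b * y = 1] (mod int p)" using cong_solve_coprime_int by blast
  define n where "n = nat ((y * a) mod int p)"
  have n: "int n = (y * a) mod int p" "n < p"
    using p_pos unfolding n_def by (auto simp: nat_less_iff)
  have "[int n = y * a] (mod int p)" by (simp add: n cong_def)
  then have "[b * int n = b * (y * a)] (mod int p)" by (rule cong_scalar_left)
  also have "[b * (y * a) = 1 * a] (mod int p)" using cong_scalar_right[OF y] by (simp add: mult.assoc)
  finally have "int p dvd (a - b * int n)" by (simp add: cong_iff_dvd_diff dvd_diff_commute)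
  then have d: "dv 1 (of_int (a - b * int n))" by (subst dv_of_int_iff) simp
  have avb: "av (of_int b) = 1"
    using av_of_int_eq[of b] b0 nb by (simp add: not_dvd_imp_multiplicity_0)
  have "(of_rat r - of_nat n :: 'a) = of_int (a - b * int n) * inverse (of_int b)"
    using b0 by (simp add: rab of_rat_divide field_simps)
  then have "dv 1 (of_rat r - of_nat n)" using d dv_inverse[OF avb] by (simp add: dv_mult_right)
  then show ?thesis using dv_cong_trans[OF rd] n(2) by blast
qed

text \<open>Gaussian elimination over the valuation ring, pivoting on a coordinate of maximal absolute
  value so that all multipliers are integral.\<close>

lemma integral_elimination:
  assumes "finite A" "\<And>x. x \<in> A \<Longrightarrow> av x \<le> 1"
    "\<And>x. x \<in> A \<Longrightarrow> \<exists>c. (\<forall>i<k. c i \<in> Qp av) \<and> x = (\<Sum>i<k. c i * b i)"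
  shows "\<exists>W. (\<forall>i<k::nat. av (W i) \<le> 1) \<and>
    (\<forall>x\<in>A. \<exists>z. (\<forall>i<k. z i \<in> Qp av \<and> av (z i) \<le> 1) \<and> x = (\<Sum>i<k. z i * W i))"
  using assms
proof (induction k arbitrary: A)
  case 0
  then show ?case by auto
next
  case (Suc k)
  from Suc.prems(3) obtain c where c: "\<And>x i. x \<in> A \<Longrightarrow> i < Suc k \<Longrightarrow> c x i \<in> Qp av"
    "\<And>x. x \<in> A \<Longrightarrow> x = (\<Sum>i<Suc k. c x i * b i)" by metis
  show ?case
  proof (cases "\<forall>x\<in>A. c x k = 0")
    case True
    have "\<exists>W. (\<forall>i<k. av (W i) \<le> 1) \<and>
      (\<forall>x\<in>A. \<exists>z. (\<forall>i<k. z i \<in> Qp av \<and> av (z i) \<le> 1) \<and> x = (\<Sum>i<k. z i * W i))"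
    proof (rule Suc.IH[OF Suc.prems(1,2)])
      fix x assume "x \<in> A"
      then show "\<exists>c. (\<forall>i<k. c i \<in> Qp av) \<and> x = (\<Sum>i<k. c i * b i)"
        using c[of x] True by (intro exI[of _ "c x"]) auto
    qed
    then obtain W where W: "\<forall>i<k. av (W i) \<le> 1"
      "\<forall>x\<in>A. \<exists>z. (\<forall>i<k. z i \<in> Qp av \<and> av (z i) \<le> 1) \<and> x = (\<Sum>i<k. z i * W i)" by blast
    show ?thesis
    proof (rule exI[of _ "W(k := 0)"], intro conjI ballI)
      show "\<forall>i<Suc k. av ((W(k := 0)) i) \<le> 1" using W(1) by (auto simp: less_Suc_eq)
      fix x assume "x \<in> A"
      then obtain z where z: "\<forall>i<k. z i \<in> Qp av \<and> av (z i) \<le> 1" "x = (\<Sum>i<k. z i * W i)"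
        using W(2) by blast
      then show "\<exists>z. (\<forall>i<Suc k. z i \<in> Qp av \<and> av (z i) \<le> 1) \<and> x = (\<Sum>i<Suc k. z i * (W(k := 0)) i)"
        using Qp_0 by (intro exI[of _ "z(k := 0)"]) (auto simp: less_Suc_eq)
    qed
  next
    case False
    then have "A \<noteq> {}" by auto
    obtain s where s: "s \<in> A" "\<And>x. x \<in> A \<Longrightarrow> av (c x k) \<le> av (c s k)"
    proof -
      have "Max ((\<lambda>x. av (c x k)) ` A) \<in> (\<lambda>x. av (c x k)) ` A"
        using Suc.prems(1) \<open>A \<noteq> {}\<close> by (intro Max_in) auto
      then obtain s where "s \<in> A" "av (c s k) = Max ((\<lambda>x. av (c x k)) ` A)" by auto
      then show ?thesis using that[of s] Suc.prems(1) by simp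
    qed
    from False obtain x0 where "x0 \<in> A" "c x0 k \<noteq> 0" by blast
    then have "av (c s k) > 0" using s(2)[of x0] av_nonneg[of "c x0 k"] av_eq_0_iff[of "c x0 k"] by linarith
    then have s0: "c s k \<noteq> 0" by auto
    define \<rho> where "\<rho> x = c x k / c s k" for x
    have \<rho>: "\<rho> x \<in> Qp av" "av (\<rho> x) \<le> 1" if "x \<in> A" for x
    proof -
      show "\<rho> x \<in> Qp av" using that c(1)[of _ k] s(1) s0 Qp_inverse Qp_mult
        by (simp add: \<rho>_def divide_inverse)
      show "av (\<rho> x) \<le> 1" using s(2)[OF that] \<open>av (c s k) > 0\<close> by (simp add: \<rho>_def av_divide)
    qed
    define A' where "A' = (\<lambda>x. x - \<rho> x * s) ` A"
    have "\<exists>W. (\<forall>i<k. av (W i) \<le> 1) \<and>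
      (\<forall>x\<in>A'. \<exists>z. (\<forall>i<k. z i \<in> Qp av \<and> av (z i) \<le> 1) \<and> x = (\<Sum>i<k. z i * W i))"
    proof (rule Suc.IH)
      show "finite A'" using Suc.prems(1) by (simp add: A'_def)
      fix x assume "x \<in> A'"
      then obtain y where y: "y \<in> A" "x = y - \<rho> y * s" by (auto simp: A'_def)
      show "av x \<le> 1"
        using Suc.prems(2)[OF y(1)] Suc.prems(2)[OF s(1)] \<rho>(2)[OF y(1)]
        by (simp add: y(2) flip: dv_0_iff) (intro dv_diff dv_mult_left)
      have "x = (\<Sum>i<Suc k. c y i * b i) - \<rho> y * (\<Sum>i<Suc k. c s i * b i)"
        using c(2)[OF y(1)] c(2)[OF s(1)] y(2) by simp
      also have "\<dots> = (\<Sum>i<k. (c y i - \<rho> y * c s i) * b i)"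
        using s0 by (simp add: \<rho>_def sum_distrib_left left_diff_distrib sum_subtractf algebra_simps)
      finally show "\<exists>c. (\<forall>i<k. c i \<in> Qp av) \<and> x = (\<Sum>i<k. c i * b i)"
        using c(1)[OF y(1)] c(1)[OF s(1)] \<rho>(1)[OF y(1)]
        by (intro exI[of _ "\<lambda>i. c y i - \<rho> y * c s i"]) (auto intro!: Qp_diff Qp_mult)
    qed
    then obtain W where W: "\<forall>i<k. av (W i) \<le> 1"
      "\<forall>x\<in>A'. \<exists>z. (\<forall>i<k. z i \<in> Qp av \<and> av (z i) \<le> 1) \<and> x = (\<Sum>i<k. z i * W i)" by blast
    show ?thesis
    proof (rule exI[of _ "W(k := s)"], intro conjI ballI)
      show "\<forall>i<Suc k. av ((W(k := s)) i) \<le> 1" using W(1) Suc.prems(2)[OF s(1)] by (auto simp: less_Suc_eq)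
      fix x assume x: "x \<in> A"
      then obtain z where z: "\<forall>i<k. z i \<in> Qp av \<and> av (z i) \<le> 1" "x - \<rho> x * s = (\<Sum>i<k. z i * W i)"
        using W(2) by (auto simp: A'_def)
      have "x = (\<Sum>i<k. z i * W i) + \<rho> x * s" using z(2) by (simp add: algebra_simps)
      then show "\<exists>z. (\<forall>i<Suc k. z i \<in> Qp av \<and> av (z i) \<le> 1) \<and> x = (\<Sum>i<Suc k. z i * (W(k := s)) i)"
        using z(1) \<rho>[OF x] by (intro exI[of _ "z(k := \<rho> x)"]) (auto simp: less_Suc_eq)
    qed
  qed
qed

text \<open>The degree bounds the number of classes modulo \<open>p\<close>: by elimination the
  elements of \<open>A\<close> are combinations of \<open>h\<close> integral elements with
  \<open>p\<close>-adic integers as coefficients, and modulo \<open>p\<close> only the last digits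
  of the \<open>h\<close> coefficients matter.\<close>

lemma card_incongruent_le:
  assumes "finite A" "\<And>x. x \<in> A \<Longrightarrow> av x \<le> 1"
    "\<And>x y. x \<in> A \<Longrightarrow> y \<in> A \<Longrightarrow> dv 1 (x - y) \<Longrightarrow> x = y"
  shows "card A \<le> p ^ h"
proof -
  obtain b :: "nat \<Rightarrow> 'a" where b: "\<And>x. \<exists>!c. c \<in> {..<h} \<rightarrow>\<^sub>E Qp av \<and> x = (\<Sum>i<h. c i * b i)"
    using ext unfolding unramified_extension_def degree_over_Qp_def by blast
  have ex: "\<exists>c. (\<forall>i<h. c i \<in> Qp av) \<and> x = (\<Sum>i<h. c i * b i)" for x
  proof -
    obtain c where "c \<in> {..<h} \<rightarrow>\<^sub>E Qp av" "x = (\<Sum>i<h. c i * b i)" using b[of x] by blast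
    then show ?thesis by (intro exI[of _ c]) auto
  qed
  obtain W where W: "\<forall>i<h. av (W i) \<le> 1"
    "\<forall>x\<in>A. \<exists>z. (\<forall>i<h. z i \<in> Qp av \<and> av (z i) \<le> 1) \<and> x = (\<Sum>i<h. z i * W i)"
    using integral_elimination[OF assms(1,2) ex] by metis
  then obtain z where z: "\<And>x i. x \<in> A \<Longrightarrow> i < h \<Longrightarrow> z x i \<in> Qp av \<and> av (z x i) \<le> 1"
    "\<And>x. x \<in> A \<Longrightarrow> x = (\<Sum>i<h. z x i * W i)" by metis
  have "\<exists>n. x \<in> A \<and> i < h \<longrightarrow> n < p \<and> dv 1 (z x i - of_nat n)" for x i
    using z(1)[of x i] Zp_digit[of "z x i"] by blast
  then obtain n where n: "\<And>x i. x \<in> A \<Longrightarrow> i < h \<Longrightarrow> n x i < p \<and> dv 1 (z x i - of_nat (n x i))"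
    by metis
  have "inj_on (\<lambda>x. restrict (n x) {..<h}) A"
  proof (rule inj_onI)
    fix x y assume xy: "x \<in> A" "y \<in> A" and eq: "restrict (n x) {..<h} = restrict (n y) {..<h}"
    have "dv 1 ((z x i - z y i) * W i)" if "i < h" for i
    proof -
      have "n x i = n y i" using eq that by (metis lessThan_iff restrict_apply')
      then have "dv 1 (z x i - z y i)"
        using n[OF xy(1) that] n[OF xy(2) that] dv_cong_trans dv_cong_sym by metis
      then show ?thesis using W(1) that by (intro dv_mult_right) (auto simp: dv_0_iff)
    qed
    then have "dv 1 (\<Sum>i<h. (z x i - z y i) * W i)" by (intro dv_sum) auto
    also have "(\<Sum>i<h. (z x i - z y i) * W i) = x - y"
      using z(2)[OF xy(1)] z(2)[OF xy(2)] by (simp add: left_diff_distrib sum_subtractf)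
    finally show "x = y" using assms(3) xy by blast
  qed
  moreover have "(\<lambda>x. restrict (n x) {..<h}) ` A \<subseteq> {..<h} \<rightarrow>\<^sub>E {..<p}"
    using n by (intro image_subsetI) simp
  ultimately have "card A \<le> card ({..<h} \<rightarrow>\<^sub>E {..<p})"
    by (intro card_inj_on_le) (auto intro: finite_PiE)
  then show ?thesis by (simp add: card_PiE)
qed

section \<open>Residue classes, and \<open>p\<close> as a uniformizer\<close>

definition q :: nat where "q = p ^ h"

lemma q_gt_1: "q > 1" unfolding q_def using p_gt_1 h_pos by (intro one_less_power) auto

lemma power_q: "x ^ q = x * x ^ (q - 1)"
  using q_gt_1 by (cases q) auto

text \<open>Classes are taken modulo the maximal ideal \<open>av x < 1\<close>, as in the definition
  of the residue field; that \<open>p\<close> generates this ideal is only shown below.\<close>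

lemma residue_reps:
  obtains R where "card R = q" "finite R" "\<And>x. x \<in> R \<Longrightarrow> av x \<le> 1"
    "\<And>x y. x \<in> R \<Longrightarrow> y \<in> R \<Longrightarrow> av (x - y) < 1 \<Longrightarrow> x = y"
    "\<And>x. av x \<le> 1 \<Longrightarrow> \<exists>y\<in>R. av (x - y) < 1"
proof -
  let ?O = "ring_of_integers av"
  let ?r = "{(x, y). x \<in> ?O \<and> y \<in> ?O \<and> av (x - y) < 1}"
  have eq: "equiv ?O ?r"
  proof (rule equivI)
    show "trans ?r"
    proof (rule transI)
      fix x y z assume a: "(x, y) \<in> ?r" "(y, z) \<in> ?r"
      have "av (x - z) \<le> max (av (x - y)) (av (y - z))" using av_add[of "x - y" "y - z"] by simp
      with a show "(x, z) \<in> ?r" by auto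
    qed
  qed (auto simp: refl_on_def sym_def av_minus_commute)
  define rep where "rep C = (SOME x. x \<in> C)" for C :: "'a set"
  have rep: "rep C \<in> C" "rep C \<in> ?O" if "C \<in> ?O // ?r" for C
  proof -
    have "C \<noteq> {}" using that in_quotient_imp_non_empty[OF eq] by blast
    then show "rep C \<in> C" unfolding rep_def by (simp add: some_in_eq)
    then show "rep C \<in> ?O" using that in_quotient_imp_subset[OF eq] by blast
  qed
  have cq: "card (?O // ?r) = q"
    using ext unfolding unramified_extension_def residue_field_def q_def by simp
  then have fin: "finite (?O // ?r)" using q_gt_1 card_ge_0_finite[of "?O // ?r"] by linarith
  have dist: "C = D" if "C \<in> ?O // ?r" "D \<in> ?O // ?r" "av (rep C - rep D) < 1" for C D
    using that rep[OF that(1)] rep[OF that(2)] quotient_eq_iff[OF eq that(1,2)] by auto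
  show ?thesis
  proof (rule that[of "rep ` (?O // ?r)"])
    have "inj_on rep (?O // ?r)" by (rule inj_onI) (use dist in auto)
    then show "card (rep ` (?O // ?r)) = q" using cq by (simp add: card_image)
    show "finite (rep ` (?O // ?r))" using fin by simp
    show "av x \<le> 1" if "x \<in> rep ` (?O // ?r)" for x using that rep(2) by (auto simp: ring_of_integers_def)
    show "x = y" if "x \<in> rep ` (?O // ?r)" "y \<in> rep ` (?O // ?r)" "av (x - y) < 1" for x y
      using that dist by blast
    show "\<exists>y\<in>rep ` (?O // ?r). av (x - y) < 1" if "av x \<le> 1" for x
    proof -
      have x: "x \<in> ?O" using that by (simp add: ring_of_integers_def)
      then have "?r `` {x} \<in> ?O // ?r" by (rule quotientI)
      then have "rep (?r `` {x}) \<in> ?r `` {x}" by (rule rep)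
      then show ?thesis using \<open>?r `` {x} \<in> ?O // ?r\<close> by auto
    qed
  qed
qed

lemma av_less_1_of_dv: "dv 1 x \<Longrightarrow> av x < 1"
proof -
  assume "dv 1 x"
  then have "av x \<le> 1 / real p" by (simp add: dv_def)
  also have "\<dots> < 1" using p_gt_1 by simp
  finally show ?thesis .
qed

text \<open>Unramifiedness is used here. If \<open>av x < 1\<close> but \<open>p\<close> did not
  divide \<open>x\<close>, then replacing the representative \<open>o'\<close> of the zero class by
  the two elements \<open>0\<close> and \<open>x\<close> would give \<open>q + 1\<close> integral
  elements incongruent modulo \<open>p\<close>, one more than the degree allows.\<close>

lemma dv_1_iff: "dv 1 x \<longleftrightarrow> av x < 1"
proof (rule iffI[OF av_less_1_of_dv])
  assume x: "av x < 1"
  show "dv 1 x"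
  proof (rule ccontr)
    assume nd: "\<not> dv 1 x"
    obtain R where R: "card R = q" "finite R" "\<And>x. x \<in> R \<Longrightarrow> av x \<le> 1"
      "\<And>x y. x \<in> R \<Longrightarrow> y \<in> R \<Longrightarrow> av (x - y) < 1 \<Longrightarrow> x = y"
      "\<And>x. av x \<le> 1 \<Longrightarrow> \<exists>y\<in>R. av (x - y) < 1" using residue_reps by metis
    obtain o' where o: "o' \<in> R" "av o' < 1" using R(5)[of 0] by auto
    have big: "\<not> av y < 1" if "y \<in> R - {o'}" for y
    proof
      assume "av y < 1"
      then have "av (y - o') < 1" using av_diff[of y o'] o by simp
      then show False using R(4)[of y o'] o that by auto
    qed
    have x0: "x \<noteq> 0" using nd by auto
    define A where "A = insert 0 (insert x (R - {o'}))"
    have "card A = q + 1"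
      using R(1,2) big[of 0] big[of x] x x0 o(1) q_gt_1 by (auto simp: A_def card_insert_if)
    moreover have "card A \<le> q"
      unfolding q_def
    proof (rule card_incongruent_le)
      show "finite A" using R(2) by (simp add: A_def)
      show "av y \<le> 1" if "y \<in> A" for y using that R(3) x by (auto simp: A_def)
      fix y z assume yz: "y \<in> A" "z \<in> A" and d: "dv 1 (y - z)"
      have a: "av (y - z) < 1" using av_less_1_of_dv[OF d] .
      have "av y < 1 \<longleftrightarrow> av z < 1"
        using a av_diff[of y "y - z"] av_add[of "y - z" z] by (auto simp: max_def split: if_splits)
      then consider "y \<in> {0, x}" "z \<in> {0, x}" | "y \<in> R" "z \<in> R"
        using yz big x by (auto simp: A_def)
      then show "y = z"
      proof cases
        case 1
        then show ?thesis using d nd by auto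
      next
        case 2
        then show ?thesis using R(4) a by blast
      qed
    qed
    ultimately show False by simp
  qed
qed


declare One_nat_def [simp del] \<comment> \<open>otherwise \<open>dv 1\<close> becomes \<open>dv (Suc 0)\<close>\<close>

subsection \<open>Teichmueller representatives\<close>

lemma cong_rel_iff: "(x, y) \<in> cong_rel p av m \<longleftrightarrow> dv 0 x \<and> dv 0 y \<and> dv m (x - y)"
  unfolding cong_rel_def ring_of_integers_def using dv_iff_ex[of m "x - y"]
  by (auto simp: dv_0_iff)

text \<open>Factor out \<open>x - y\<close>: the cofactor is a sum of \<open>p\<close> terms, each
  congruent to \<open>y ^ (p - 1)\<close> modulo \<open>p\<close>, hence divisible by
  \<open>p\<close>.\<close>

lemma dv_power_diff_p:
  assumes "dv m (x - y)" "m \<ge> 1" "dv 0 x" "dv 0 y"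
  shows "dv (Suc m) (x ^ p - y ^ p)"
proof -
  have 1: "dv 1 (y ^ (p - Suc i) * x ^ i - y ^ (p - 1))" if "i < p" for i
  proof -
    have "y ^ (p - Suc i) * y ^ i = y ^ (p - 1)" using that by (simp add: One_nat_def flip: power_add)
    then show ?thesis
      using dv_mult_left[OF dv_cong_power[OF dv_antimono[OF assms(1,2)] assms(3,4), of i]
          dv_power_0[OF assms(4), of "p - Suc i"]]
      by (simp add: right_diff_distrib)
  qed
  have "dv 1 ((\<Sum>i<p. y ^ (p - Suc i) * x ^ i - y ^ (p - 1)) + of_nat p * y ^ (p - 1))"
    using 1 by (intro dv_add dv_sum dv_mult_right dv_p dv_power_0 assms) auto
  then have "dv 1 (\<Sum>i<p. y ^ (p - Suc i) * x ^ i)" by (simp add: sum_subtractf)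
  then have "dv (m + 1) ((x - y) * (\<Sum>i<p. y ^ (p - Suc i) * x ^ i))" using assms(1) by (intro dv_mult)
  then show ?thesis by (simp add: power_diff_sumr2 One_nat_def)
qed

lemma dv_power_diff_p_power:
  assumes "dv m (x - y)" "m \<ge> 1" "dv 0 x" "dv 0 y"
  shows "dv (m + k) (x ^ (p ^ k) - y ^ (p ^ k))"
proof (induction k)
  case (Suc k)
  then show ?case using dv_power_diff_p[of "m + k" "x ^ (p ^ k)" "y ^ (p ^ k)"] assms
    by (simp add: dv_power_0 power_mult[symmetric] mult.commute)
qed (use assms in auto)

text \<open>Fermat's argument on representatives: multiplication by a unit \<open>x\<close> permutes
  the nonzero classes, so the products of \<open>r\<close> and of \<open>x * r\<close> over
  \<open>S\<close> agree modulo \<open>p\<close>, and the product of \<open>S\<close> is a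
  unit.\<close>

lemma residue_power_q:
  assumes "dv 0 x" shows "dv 1 (x ^ q - x)"
proof (cases "dv 1 x")
  case True
  then have "dv 1 (x * x ^ (q - 1))" by (intro dv_mult_right dv_power_0 assms)
  then have "dv 1 (x ^ q)" by (simp add: power_q)
  then show ?thesis using True by (rule dv_diff)
next
  case False
  then have avx: "av x = 1" using assms by (simp add: dv_1_iff dv_0_iff)
  obtain R where R: "card R = q" "finite R" "\<And>x. x \<in> R \<Longrightarrow> av x \<le> 1"
    "\<And>x y. x \<in> R \<Longrightarrow> y \<in> R \<Longrightarrow> av (x - y) < 1 \<Longrightarrow> x = y"
    "\<And>x. av x \<le> 1 \<Longrightarrow> \<exists>y\<in>R. av (x - y) < 1" by (rule residue_reps, rule that)
  obtain o' where o: "o' \<in> R" "av o' < 1" using R(5)[of 0] by auto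
  define S where "S = R - {o'}"
  have S1: "av y = 1" if "y \<in> S" for y
  proof -
    have "\<not> av y < 1"
    proof
      assume "av y < 1"
      then have "av (y - o') < 1" using av_diff[of y o'] o by simp
      then show False using R(4)[of y o'] o that by (auto simp: S_def)
    qed
    then show ?thesis using R(3)[of y] that by (auto simp: S_def)
  qed
  have cS: "card S = q - 1" "finite S" using R(1,2) o by (auto simp: S_def)
  define \<rho> where "\<rho> y = (SOME r. r \<in> R \<and> av (y - r) < 1)" for y
  have \<rho>: "\<rho> y \<in> R" "av (y - \<rho> y) < 1" if "av y \<le> 1" for y
  proof -
    have "\<exists>r. r \<in> R \<and> av (y - r) < 1" using R(5)[OF that] by blast
    from someI_ex[OF this] show "\<rho> y \<in> R" "av (y - \<rho> y) < 1" unfolding \<rho>_def by auto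
  qed
  have av_xr: "av (x * r) \<le> 1" if "r \<in> S" for r using S1[OF that] avx by (simp add: av_mult)
  have in_S: "\<rho> (x * r) \<in> S" if "r \<in> S" for r
  proof -
    have "av (x * r) = 1" using S1[OF that] avx by (simp add: av_mult)
    then have "av (\<rho> (x * r)) = 1"
      using av_eq_of_close[of "x * r" "\<rho> (x * r)"] \<rho>(2)[OF av_xr[OF that]] by simp
    then have "\<rho> (x * r) \<noteq> o'" using o by auto
    then show ?thesis using \<rho>(1)[OF av_xr[OF that]] by (simp add: S_def)
  qed
  have inj: "inj_on (\<lambda>r. \<rho> (x * r)) S"
  proof (rule inj_onI)
    fix r s assume rs: "r \<in> S" "s \<in> S" and eq: "\<rho> (x * r) = \<rho> (x * s)"
    have "av (x * r - x * s) \<le> max (av (x * r - \<rho> (x * r))) (av (x * s - \<rho> (x * s)))"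
      using av_diff[of "x * r - \<rho> (x * r)" "x * s - \<rho> (x * s)"] eq by simp
    also have "\<dots> < 1" using \<rho>(2)[OF av_xr] rs by simp
    finally have "av (x * (r - s)) < 1" by (simp add: right_diff_distrib)
    then have "av (r - s) < 1" by (simp add: av_mult avx)
    then show "r = s" using R(4) rs by (auto simp: S_def)
  qed
  have "bij_betw (\<lambda>r. \<rho> (x * r)) S S"
    using in_S by (intro bij_betw_imageI inj endo_inj_surj cS(2)) auto
  then have "(\<Prod>r\<in>S. \<rho> (x * r)) = \<Prod>S"
    using prod.reindex_bij_betw[of "\<lambda>r. \<rho> (x * r)" S S "\<lambda>r. r"] by simp
  moreover have "dv 1 ((\<Prod>r\<in>S. x * r) - (\<Prod>r\<in>S. \<rho> (x * r)))"
  proof (rule dv_cong_prod)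
    fix r assume r: "r \<in> S"
    show "dv 1 (x * r - \<rho> (x * r))" using \<rho>(2)[OF av_xr[OF r]] by (simp only: dv_1_iff)
    show "dv 0 (x * r)" using av_xr[OF r] by (simp add: dv_0_iff)
    show "dv 0 (\<rho> (x * r))" using R(3) in_S[OF r] by (simp add: dv_0_iff S_def)
  qed
  ultimately have "dv 1 (\<Prod>S * (x ^ (q - 1) - 1))"
    using cS by (simp add: prod.distrib algebra_simps)
  moreover have "av (\<Prod>S) = 1" using S1
    by (induction S rule: infinite_finite_induct) (auto simp: av_mult)
  ultimately have "dv 1 (x ^ (q - 1) - 1)" by (simp add: dv_1_iff av_mult)
  then have "dv 1 (x * (x ^ (q - 1) - 1))" by (intro dv_mult_left assms)
  then show ?thesis by (simp add: power_q right_diff_distrib)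
qed

text \<open>The powers \<open>x ^ (q ^ n)\<close> form a Cauchy sequence, because consecutive terms
  are \<open>p ^ (h * n)\<close>-th powers of the congruent elements \<open>x ^ q\<close> and
  \<open>x\<close>. Completeness supplies the limit.\<close>

lemma ex_fixed_power_q:
  assumes "dv 0 x" shows "\<exists>t. t ^ q = t \<and> dv 0 t \<and> dv 1 (t - x)"
proof -
  define s where "s n = x ^ (q ^ n)" for n
  have s0: "dv 0 (s n)" for n by (simp add: s_def dv_power_0 assms)
  have sSuc: "s (Suc n) = s n ^ q" for n by (simp add: s_def power_mult[symmetric] mult.commute)
  have step: "dv (Suc n) (s (Suc n) - s n)" for n
  proof -
    have "dv (1 + h * n) ((x ^ q) ^ (p ^ (h * n)) - x ^ (p ^ (h * n)))"
      by (intro dv_power_diff_p_power residue_power_q assms dv_power_0) simp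
    moreover have "n \<le> h * n" using h_pos by simp
    ultimately show ?thesis
      by (auto simp: s_def q_def power_mult[symmetric] power_add[symmetric] mult.commute intro: dv_antimono)
  qed
  have close: "dv (Suc n) (s (n + k) - s n)" for n k
  proof (induction k)
    case (Suc k)
    have "dv (Suc n) (s (Suc (n + k)) - s (n + k))" using dv_antimono[OF step] by simp
    then show ?case using dv_cong_trans[OF _ Suc] by simp
  qed simp
  have arch: "\<exists>n. \<forall>k\<ge>n. (1 / real p) ^ k < e" if e: "e > 0" for e
  proof -
    obtain n where "(1 / real p) ^ n < e" using real_arch_pow_inv[OF e, of "1 / real p"] p_gt_1 by auto
    moreover have "(1 / real p) ^ k \<le> (1 / real p) ^ n" if "k \<ge> n" for k
      using that p_gt_1 by (intro power_decreasing) auto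
    ultimately show ?thesis by (meson le_less_trans)
  qed
  have "Metric_space.MCauchy UNIV (dist_av av) s"
    unfolding Metric_space.MCauchy_def[OF metric_space_av]
  proof (intro conjI allI impI)
    fix e :: real assume "e > 0"
    then obtain N where N: "\<forall>k\<ge>N. (1 / real p) ^ k < e" using arch by blast
    show "\<exists>N. \<forall>n n'. N \<le> n \<longrightarrow> N \<le> n' \<longrightarrow> dist_av av (s n) (s n') < e"
    proof (intro exI[of _ N] allI impI)
      fix n n' assume "N \<le> n" "N \<le> n'"
      then have "dv (Suc N) (s n - s N)" "dv (Suc N) (s n' - s N)"
        using close[of N "n - N"] close[of N "n' - N"] by auto
      then have "dv (Suc N) (s n - s n')" using dv_cong_trans dv_cong_sym by blast
      then show "dist_av av (s n) (s n') < e"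
        using N[rule_format, of "Suc N"] by (simp add: dv_def dist_av_def)
    qed
  qed simp
  moreover have "Metric_space.mcomplete UNIV (dist_av av)"
    using ext by (simp add: unramified_extension_def)
  ultimately obtain l where "limitin (top_av av) s l sequentially"
    unfolding Metric_space.mcomplete_def[OF metric_space_av] by blast
  then have l: "\<exists>N. \<forall>n\<ge>N. dv m (s n - l)" for m
    unfolding limitin_av_iff dv_def using p_pos
    by (meson less_imp_le divide_pos_pos of_nat_0_less_iff zero_less_one zero_less_power)
  have dl: "dv 0 l"
  proof -
    obtain n where "dv 0 (s n - l)" using l[of 0] by blast
    then show ?thesis using dv_cong_iff s0 by blast
  qed
  have "l ^ q - l = 0"
  proof (rule eq_of_dv_all)
    fix m
    obtain N where N: "\<forall>n\<ge>N. dv m (s n - l)" using l by blast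
    have "dv m (s N ^ q - l ^ q)" using N s0 dl by (intro dv_cong_power) auto
    moreover have "dv m (s N ^ q - l)" using N[rule_format, of "Suc N"] by (simp add: sSuc)
    ultimately show "dv m (l ^ q - l)" using dv_cong_trans dv_cong_sym by blast
  qed
  moreover have "dv 1 (l - x)"
  proof -
    obtain N where N: "\<forall>n\<ge>N. dv 1 (s n - l)" using l by blast
    have "dv 1 (s N - x)" using close[of 0 N] by (simp add: s_def One_nat_def)
    then show ?thesis using N[rule_format, of N] dv_cong_trans dv_cong_sym by blast
  qed
  ultimately show ?thesis using dl by auto
qed

abbreviation T :: "'a set" where "T \<equiv> teich p h av"

lemma T_iff: "x \<in> T \<longleftrightarrow> x ^ q = x"
proof -
  have e: "x ^ q = x * x ^ (q - 1)" by (rule power_q)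
  have "av x = 1" if "x ^ (q - 1) = 1"
  proof -
    have "av x ^ (q - 1) = 1" using that by (simp flip: av_power)
    then show ?thesis using q_gt_1 power_eq_imp_eq_base[of "av x" "q - 1" 1] by simp
  qed
  then show ?thesis unfolding teich_def ring_of_integers_def e q_def[symmetric] by auto
qed

lemma T_0 [simp]: "0 \<in> T" and T_1 [simp]: "1 \<in> T"
  using q_gt_1 by (auto simp: T_iff)

lemma T_mult: "x \<in> T \<Longrightarrow> y \<in> T \<Longrightarrow> x * y \<in> T"
  by (simp add: T_iff power_mult_distrib)

lemma T_power: "x \<in> T \<Longrightarrow> x ^ n \<in> T"
  by (induction n) (auto intro: T_mult)

lemma T_prod: "(\<And>i. i \<in> I \<Longrightarrow> f i \<in> T) \<Longrightarrow> prod f I \<in> T"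
  by (induction I rule: infinite_finite_induct) (auto intro: T_mult)

lemma T_dv: "x \<in> T \<Longrightarrow> dv 0 x"
  by (simp add: teich_def ring_of_integers_def dv_0_iff)

lemma T_power_q_power: "x \<in> T \<Longrightarrow> x ^ (q ^ n) = x"
  by (induction n) (auto simp: power_mult T_iff)

text \<open>Raising to the power \<open>q ^ m\<close> fixes both elements, but improves a congruence
  modulo \<open>p\<close> to one modulo \<open>p ^ (1 + h * m)\<close>.\<close>

lemma T_eqI:
  assumes "x \<in> T" "y \<in> T" "dv 1 (x - y)" shows "x = y"
proof -
  have "dv m (x - y)" for m
  proof -
    have "dv (1 + h * m) (x ^ (p ^ (h * m)) - y ^ (p ^ (h * m)))"
      using assms by (intro dv_power_diff_p_power) (auto intro: T_dv)
    moreover have "m \<le> 1 + h * m" using mult_le_mono1[OF h_pos, of m] by linarith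
    ultimately have "dv m (x ^ (p ^ (h * m)) - y ^ (p ^ (h * m)))" by (rule dv_antimono)
    then show ?thesis
      using T_power_q_power[OF assms(1), of m] T_power_q_power[OF assms(2), of m]
      by (simp add: q_def power_mult[symmetric])
  qed
  then show ?thesis using eq_of_dv_all by fastforce
qed

lemma teich_lift:
  assumes "dv 0 x" shows "teich_lift p h av x \<in> T" "dv 1 (teich_lift p h av x - x)"
proof -
  obtain t where "t \<in> T" "dv 1 (t - x)" using ex_fixed_power_q[OF assms] by (auto simp: T_iff)
  moreover have "t = t'" if "t \<in> T" "t' \<in> T" "dv 1 (t - x)" "dv 1 (t' - x)" for t t'
    using that by (intro T_eqI) (auto intro: dv_cong_trans dv_cong_sym)
  ultimately have "\<exists>!t. t \<in> T \<and> (t, x) \<in> cong_rel p av 1"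
    using assms T_dv unfolding cong_rel_iff by blast
  from theI'[OF this] show "teich_lift p h av x \<in> T" "dv 1 (teich_lift p h av x - x)"
    unfolding teich_lift_def cong_rel_iff by auto
qed

text \<open>The Teichmueller lift as a total function. The default 0 off the ring of integers makes
  \<open>\<tau> x \<in> T\<close> unconditional and keeps \<open>\<tau>\<close> constant on classes
  modulo \<open>p\<close> in the whole field.\<close>

definition \<tau> :: "'a \<Rightarrow> 'a" where "\<tau> x = (if dv 0 x then teich_lift p h av x else 0)"

lemma \<tau>_in_T [simp]: "\<tau> x \<in> T"
  by (simp add: \<tau>_def teich_lift)

lemma \<tau>_cong: "dv 0 x \<Longrightarrow> dv 1 (\<tau> x - x)"
  by (simp add: \<tau>_def teich_lift)

lemma \<tau>_eqI: "t \<in> T \<Longrightarrow> dv 0 x \<Longrightarrow> dv 1 (t - x) \<Longrightarrow> \<tau> x = t"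
  using \<tau>_cong[of x] dv_cong_trans dv_cong_sym T_eqI[of "\<tau> x" t] \<tau>_in_T by blast

lemma \<tau>_T: "t \<in> T \<Longrightarrow> \<tau> t = t"
  by (intro \<tau>_eqI) (auto intro: T_dv)

lemma \<tau>_eq_of_cong: "dv 1 (x - y) \<Longrightarrow> \<tau> x = \<tau> y"
proof (cases "dv 0 y")
  case True
  assume a: "dv 1 (x - y)"
  then have "dv 0 x" using True dv_cong_iff dv_antimono[of 1 _ 0] by blast
  with True a show ?thesis by (intro \<tau>_eqI) (auto intro: dv_cong_trans dv_cong_sym \<tau>_cong)
next
  case False
  assume "dv 1 (x - y)"
  then have "\<not> dv 0 x" using False dv_cong_iff dv_antimono[of 1 _ 0] by blast
  then show ?thesis using False by (simp add: \<tau>_def)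
qed

lemma \<tau>_mult_T: "t \<in> T \<Longrightarrow> dv 0 x \<Longrightarrow> \<tau> (t * x) = t * \<tau> x"
  using dv_mult_left[OF \<tau>_cong[of x] T_dv[of t]] dv_mult_left[OF _ T_dv[of t], of 0 x]
  by (intro \<tau>_eqI T_mult) (auto simp: right_diff_distrib)

lemma finite_T [simp]: "finite T" and card_T: "card T = q"
proof -
  obtain R where R: "card R = q" "finite R" "\<And>x. x \<in> R \<Longrightarrow> av x \<le> 1"
    "\<And>x y. x \<in> R \<Longrightarrow> y \<in> R \<Longrightarrow> av (x - y) < 1 \<Longrightarrow> x = y"
    "\<And>x. av x \<le> 1 \<Longrightarrow> \<exists>y\<in>R. av (x - y) < 1" by (rule residue_reps, rule that)
  have "bij_betw \<tau> R T"
  proof (rule bij_betw_imageI)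
    show "inj_on \<tau> R"
    proof (rule inj_onI)
      fix x y assume xy: "x \<in> R" "y \<in> R" "\<tau> x = \<tau> y"
      then have "dv 1 (\<tau> x - x)" "dv 1 (\<tau> x - y)"
        using \<tau>_cong[of x] \<tau>_cong[of y] R(3) by (auto simp: dv_0_iff)
      then have "dv 1 (x - y)" using dv_cong_trans dv_cong_sym by blast
      then show "x = y" using R(4) xy by (simp add: dv_1_iff)
    qed
    show "\<tau> ` R = T"
    proof
      show "T \<subseteq> \<tau> ` R"
      proof
        fix t assume t: "t \<in> T"
        then obtain y where y: "y \<in> R" "av (t - y) < 1" using R(5) T_dv by (auto simp: dv_0_iff)
        then have "\<tau> y = t" using t R(3) by (intro \<tau>_eqI) (auto simp: dv_1_iff dv_0_iff)
        then show "t \<in> \<tau> ` R" using y by blast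
      qed
    qed auto
  qed
  then show "finite T" "card T = q" using R(1,2) by (auto simp: bij_betw_finite bij_betw_same_card)
qed

section \<open>The nonzero Teichmueller representatives and their power sums\<close>

definition Ts :: "'a set" where "Ts = T - {0}"

lemma Ts_D: "x \<in> Ts \<Longrightarrow> x \<in> T" "x \<in> Ts \<Longrightarrow> x \<noteq> 0"
  by (auto simp: Ts_def)

lemma Ts_power_q1: "x \<in> Ts \<Longrightarrow> x ^ (q - 1) = 1"
  using power_q[of x] by (auto simp: Ts_def T_iff)

lemma Ts_iff: "x \<in> Ts \<longleftrightarrow> x ^ (q - 1) = 1"
proof
  assume "x ^ (q - 1) = 1"
  moreover from this have "x \<noteq> 0" using q_gt_1 by (intro notI) (simp add: zero_power)
  ultimately show "x \<in> Ts" using power_q[of x] by (simp add: Ts_def T_iff)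
qed (rule Ts_power_q1)

lemma Ts_1 [simp]: "1 \<in> Ts" by (simp add: Ts_iff)

lemma Ts_mult: "x \<in> Ts \<Longrightarrow> y \<in> Ts \<Longrightarrow> x * y \<in> Ts"
  by (simp add: Ts_iff power_mult_distrib)

lemma Ts_inverse: "x \<in> Ts \<Longrightarrow> inverse x \<in> Ts"
  by (simp add: Ts_iff power_inverse)

lemma finite_Ts [simp]: "finite Ts" and card_Ts: "card Ts = q - 1"
  by (auto simp: Ts_def card_T)

lemma T_eq_insert: "T = insert 0 Ts" and zero_notin_Ts [simp]: "0 \<notin> Ts"
  by (auto simp: Ts_def)

lemma bij_betw_Ts_mult: "y \<in> Ts \<Longrightarrow> bij_betw ((*) y) Ts Ts"
  by (rule bij_betw_byWitness[of _ "(*) (inverse y)"])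
     (auto simp: Ts_mult Ts_inverse dest: Ts_D(2))

lemma Ts_power_mod: "x \<in> Ts \<Longrightarrow> x ^ j = x ^ (j mod (q - 1))"
proof -
  assume "x \<in> Ts"
  have "x ^ j = x ^ ((q - 1) * (j div (q - 1)) + j mod (q - 1))" by simp
  also have "\<dots> = x ^ (j mod (q - 1))"
    using Ts_power_q1[OF \<open>x \<in> Ts\<close>] by (simp only: power_add power_mult) simp
  finally show ?thesis .
qed

text \<open>If \<open>q - 1\<close> does not divide \<open>j\<close>, some \<open>y\<close> in
  \<open>Ts\<close> has \<open>y ^ j \<noteq> 1\<close>, as the polynomial \<open>X ^ r - 1\<close>
  with \<open>r = j mod (q - 1)\<close> has fewer roots than \<open>Ts\<close> has elements.
  Multiplication by \<open>y\<close> permutes \<open>Ts\<close> and multiplies the sum by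
  \<open>y ^ j\<close>.\<close>

lemma sum_Ts_power: "(\<Sum>x\<in>Ts. x ^ j) = (if (q - 1) dvd j then of_nat (q - 1) else 0)"
proof (cases "(q - 1) dvd j")
  case True
  then have "(\<Sum>x\<in>Ts. x ^ j) = (\<Sum>x\<in>Ts. 1)"
    by (intro sum.cong refl) (auto simp: power_mult Ts_power_q1)
  then show ?thesis using True by (simp add: card_Ts)
next
  case False
  define r where "r = j mod (q - 1)"
  have r: "0 < r" "r < q - 1" using False q_gt_1 by (auto simp: r_def dvd_eq_mod_eq_0)
  have "\<exists>y\<in>Ts. y ^ r \<noteq> 1"
  proof (rule ccontr)
    assume "\<not> ?thesis"
    then have sub: "Ts \<subseteq> {x. poly (monom 1 r - 1) x = 0}" by (auto simp: poly_monom)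
    have deg: "degree (monom 1 r - 1 :: 'a poly) = r"
      using r by (subst diff_conv_add_uminus, subst degree_add_eq_left) (auto simp: degree_monom_eq)
    have nz: "monom 1 r - 1 \<noteq> (0 :: 'a poly)" using deg r by auto
    have "card Ts \<le> card {x. poly (monom 1 r - 1 :: 'a poly) x = 0}"
      by (intro card_mono sub poly_roots_finite nz)
    also have "\<dots> \<le> r" using card_poly_roots_bound[OF nz] deg by simp
    finally show False using r card_Ts by simp
  qed
  then obtain y where y: "y \<in> Ts" "y ^ j \<noteq> 1" using Ts_power_mod unfolding r_def by metis
  have "(\<Sum>x\<in>Ts. x ^ j) = (\<Sum>x\<in>Ts. (y * x) ^ j)"
    using sum.reindex_bij_betw[OF bij_betw_Ts_mult[OF y(1)], of "\<lambda>x. x ^ j"] by simp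
  also have "\<dots> = y ^ j * (\<Sum>x\<in>Ts. x ^ j)" by (simp add: power_mult_distrib sum_distrib_left)
  finally have "(1 - y ^ j) * (\<Sum>x\<in>Ts. x ^ j) = 0" by (simp add: algebra_simps)
  then show ?thesis using y(2) False by simp
qed

text \<open>Since \<open>0 ^ 0 = 1\<close>, exponent 0 gives \<open>q\<close> and not
  \<open>q - 1\<close>. This is the source of the factor \<open>q\<close> from each variable absent
  from a monomial.\<close>

lemma sum_T_power:
  "(\<Sum>x\<in>T. x ^ j) = (if j = 0 then of_nat q else if (q - 1) dvd j then of_nat (q - 1) else 0)"
  using q_gt_1 by (cases "j = 0") (simp_all add: T_eq_insert sum_Ts_power card_Ts of_nat_diff)

lemma Ts_inverse_power:
  assumes "x \<in> Ts" "i \<le> q - 1" shows "inverse x ^ i = x ^ (q - 1 - i)"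
proof -
  have "x ^ i * x ^ (q - 1 - i) = 1" using Ts_power_q1[OF assms(1)] assms(2) by (simp flip: power_add del: diff_diff_left)
  then show ?thesis using inverse_unique power_inverse by metis
qed

text \<open>Exponents between 1 and \<open>q - 1\<close> put \<open>a + (q - 1 - i)\<close> strictly
  between 0 and \<open>2 * (q - 1)\<close>, so divisibility by \<open>q - 1\<close> means
  \<open>a = i\<close>.\<close>

lemma sum_Ts_orthogonal:
  assumes "1 \<le> a" "a \<le> q - 1" "1 \<le> i" "i \<le> q - 1"
  shows "(\<Sum>x\<in>Ts. x ^ a * inverse x ^ i) = (if a = i then of_nat (q - 1) else 0)"
proof -
  have "(\<Sum>x\<in>Ts. x ^ a * inverse x ^ i) = (\<Sum>x\<in>Ts. x ^ (a + (q - 1 - i)))"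
    using assms by (intro sum.cong refl) (simp only: Ts_inverse_power[OF _ assms(4)] power_add)
  moreover have "(q - 1) dvd (a + (q - 1 - i)) \<longleftrightarrow> a = i"
  proof
    assume "(q - 1) dvd (a + (q - 1 - i))"
    then obtain k where k: "a + (q - 1 - i) = (q - 1) * k" by (elim dvdE)
    have "0 < a + (q - 1 - i)" "a + (q - 1 - i) < (q - 1) * 2" using assms by linarith+
    then have "0 < (q - 1) * k" "(q - 1) * k < (q - 1) * 2" by (simp_all only: k)
    then have "0 < k" "k < 2" by (simp_all only: mult_less_cancel1 nat_0_less_mult_iff)
    then have "k = 1" by simp
    then have "a + (q - 1 - i) = q - 1" using k by simp
    then show "a = i" using assms by linarith
  next
    assume "a = i"
    then have "a + (q - 1 - i) = q - 1" using assms by linarith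
    then show "(q - 1) dvd (a + (q - 1 - i))" by simp
  qed
  ultimately show ?thesis by (simp add: sum_Ts_power)
qed

lemma sum_power_orthogonal:
  assumes "x \<in> Ts" "t \<in> Ts"
  shows "(\<Sum>j = 1..q - 1. t ^ j * inverse x ^ j) = (if t = x then of_nat (q - 1) else 0)"
proof -
  define z where "z = t * inverse x"
  have z: "z \<in> Ts" using assms by (simp add: z_def Ts_mult Ts_inverse)
  have "(\<Sum>j = 1..q - 1. t ^ j * inverse x ^ j) = (\<Sum>j<q - 1. z ^ Suc j)"
    by (rule sum.reindex_bij_witness[of _ Suc "\<lambda>j. j - 1"]) (auto simp: z_def power_mult_distrib)
  also have "\<dots> = z * (\<Sum>j<q - 1. z ^ j)" by (simp add: sum_distrib_left)
  also have "\<dots> = (if z = 1 then of_nat (q - 1) else 0)"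
    using geometric_sum[of z "q - 1"] Ts_power_q1[OF z] by simp
  also have "z = 1 \<longleftrightarrow> t = x" using Ts_D(2)[OF assms(1)] by (simp add: z_def field_simps)
  finally show ?thesis .
qed

end

subsection \<open>Linear functionals on finitely supported functions\<close>

text \<open>The linear extension of \<open>\<phi>\<close> to formal combinations. It pairs group
  ring elements with functions on the group; when \<open>\<phi>\<close> evaluates monomials at a
  point, it is the evaluation of polynomials. Both uses share \<open>ev_mult\<close>.\<close>

definition ev :: "('k \<Rightarrow> 'b) \<Rightarrow> ('k \<Rightarrow>\<^sub>0 'b) \<Rightarrow> 'b::comm_ring_1" where
  "ev \<phi> z = (\<Sum>x \<in> Poly_Mapping.keys z. Poly_Mapping.lookup z x * \<phi> x)"

lemma ev_superset:
  assumes "finite A" "Poly_Mapping.keys z \<subseteq> A"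
  shows "ev \<phi> z = (\<Sum>x\<in>A. Poly_Mapping.lookup z x * \<phi> x)"
  unfolding ev_def using assms by (intro sum.mono_neutral_left) (auto simp: in_keys_iff)

lemma ev_add: "ev \<phi> (z + w) = ev \<phi> z + ev \<phi> w"
proof -
  let ?A = "Poly_Mapping.keys z \<union> Poly_Mapping.keys w"
  have "Poly_Mapping.keys (z + w) \<subseteq> ?A" by (rule keys_add)
  then show ?thesis
    by (simp add: ev_superset[of ?A] lookup_add distrib_right sum.distrib)
qed

lemma ev_zero [simp]: "ev \<phi> 0 = 0" by (simp add: ev_def)

lemma ev_uminus: "ev \<phi> (- z) = - ev \<phi> z"
  using ev_add[of \<phi> z "- z"] by (simp add: eq_neg_iff_add_eq_0 add.commute)

lemma ev_diff: "ev \<phi> (z - w) = ev \<phi> z - ev \<phi> w"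
  using ev_add[of \<phi> z "- w"] by (simp add: ev_uminus)

lemma ev_sum: "ev \<phi> (sum f I) = (\<Sum>i\<in>I. ev \<phi> (f i))"
  by (induction I rule: infinite_finite_induct) (auto simp: ev_add)

lemma ev_single [simp]: "ev \<phi> (Poly_Mapping.single x a) = a * \<phi> x"
  by (cases "a = 0") (auto simp: ev_def)

lemma ev_one [simp]: "ev \<phi> 1 = \<phi> 0"
  using ev_single[of \<phi> 0 1] unfolding single_one by simp

lemma poly_mapping_sum_single:
  "z = (\<Sum>x \<in> Poly_Mapping.keys z. Poly_Mapping.single x (Poly_Mapping.lookup z x))"
proof (rule poly_mapping_eqI)
  fix k
  show "Poly_Mapping.lookup z k =
    Poly_Mapping.lookup (\<Sum>x \<in> Poly_Mapping.keys z. Poly_Mapping.single x (Poly_Mapping.lookup z x)) k"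
    by (auto simp: lookup_sum lookup_single when_def in_keys_iff sum.delta)
qed

lemma poly_mapping_single_induct [case_names single add]:
  fixes z :: "'k \<Rightarrow>\<^sub>0 'b::comm_monoid_add"
  assumes "\<And>x a. P (Poly_Mapping.single x a)" "\<And>z w. P z \<Longrightarrow> P w \<Longrightarrow> P (z + w)"
  shows "P z"
proof -
  have "P (\<Sum>x \<in> A. Poly_Mapping.single x (f x))" for A f
  proof (induction A rule: infinite_finite_induct)
    case (insert x A)
    then show ?case by (simp add: assms)
  qed (use assms(1)[of undefined 0] in auto)
  then show ?thesis using poly_mapping_sum_single[of z] by metis
qed

lemma ev_mult: "ev \<phi> (z * w) = ev (\<lambda>y. ev (\<lambda>x. \<phi> (x + y)) z) w"
proof (induction w rule: poly_mapping_single_induct)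
  case (single y b)
  show ?case
  proof (induction z rule: poly_mapping_single_induct)
    case (single x a)
    show ?case by (simp add: mult_single)
  next
    case (add z z')
    then show ?case by (simp add: distrib_right distrib_left ev_add)
  qed
next
  case (add w w')
  then show ?case by (simp add: distrib_left ev_add)
qed

abbreviation cst :: "'b::zero \<Rightarrow> 'k::zero \<Rightarrow>\<^sub>0 'b" where "cst a \<equiv> Poly_Mapping.single 0 a"

lemma ev_scale: "ev (\<lambda>y. a * \<phi> y) z = ev \<phi> z * a"
  by (simp add: ev_def sum_distrib_left sum_distrib_right mult_ac)

lemma ev_cst_mult: "ev \<phi> (cst a * z) = a * ev \<phi> z"
  by (subst mult.commute) (simp add: ev_mult ev_scale)

lemma cst_mult: "cst (a * b :: 'b::comm_ring_1) = (cst a * cst b :: 'k::comm_monoid_add \<Rightarrow>\<^sub>0 'b)"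
  by (simp add: mult_single)

lemma cst_sum: "cst (sum f I) = (\<Sum>i\<in>I. cst (f i))"
  by (induction I rule: infinite_finite_induct) (auto simp: single_add)

context unram
begin

lemma dv_mult_0: "dv 0 x \<Longrightarrow> dv 0 y \<Longrightarrow> dv 0 (x * y)"
  using dv_mult_left by blast

lemma dv_Ts: "x \<in> Ts \<Longrightarrow> dv 0 x" using T_dv Ts_D(1) by blast

lemma dv_inverse_power_Ts: "x \<in> Ts \<Longrightarrow> dv 0 (inverse x ^ i)"
  by (intro dv_power_0 dv_Ts Ts_inverse)

subsection \<open>The group ring of the residue field\<close>

text \<open>Instead of forming the group ring of the residue field, elements of the group ring of the
  additive group of the field are compared through functionals that are periodic modulo \<open>p\<close>.\<close>

definition per :: "('a \<Rightarrow> 'a) \<Rightarrow> bool" where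
  "per \<phi> \<longleftrightarrow> (\<forall>x y. dv 1 (x - y) \<longrightarrow> \<phi> x = \<phi> y)"

definition geq :: "('a \<Rightarrow>\<^sub>0 'a) \<Rightarrow> ('a \<Rightarrow>\<^sub>0 'a) \<Rightarrow> bool" (infix "\<equiv>\<^sub>p" 50) where
  "z \<equiv>\<^sub>p w \<longleftrightarrow> (\<forall>\<phi>. per \<phi> \<longrightarrow> ev \<phi> z = ev \<phi> w)"

lemma geq_refl [simp]: "z \<equiv>\<^sub>p z" by (simp add: geq_def)

lemma geq_trans [trans]: "x \<equiv>\<^sub>p y \<Longrightarrow> y \<equiv>\<^sub>p z \<Longrightarrow> x \<equiv>\<^sub>p z" by (simp add: geq_def)

lemma geq_sym: "x \<equiv>\<^sub>p y \<Longrightarrow> y \<equiv>\<^sub>p x" by (simp add: geq_def)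

lemma per_shift: "per \<phi> \<Longrightarrow> per (\<lambda>x. \<phi> (x + y))"
  by (simp add: per_def)

lemma geq_mult_right: "z \<equiv>\<^sub>p w \<Longrightarrow> z * v \<equiv>\<^sub>p w * v"
  by (simp add: geq_def ev_mult per_shift)

lemma geq_mult_left: "z \<equiv>\<^sub>p w \<Longrightarrow> v * z \<equiv>\<^sub>p v * w"
  using geq_mult_right[of z w v] by (simp add: mult.commute)

lemma geq_mult: "z \<equiv>\<^sub>p w \<Longrightarrow> z' \<equiv>\<^sub>p w' \<Longrightarrow> z * z' \<equiv>\<^sub>p w * w'"
  using geq_mult_right geq_mult_left geq_trans by blast

text \<open>Integrality of all coefficients (test with point masses), phrased through functionals so
  that products follow from \<open>ev_mult\<close>.\<close>

definition integ :: "('a \<Rightarrow>\<^sub>0 'a) \<Rightarrow> bool" where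
  "integ z \<longleftrightarrow> (\<forall>\<phi>. (\<forall>x. dv 0 (\<phi> x)) \<longrightarrow> dv 0 (ev \<phi> z))"

lemma integ_mult: "integ z \<Longrightarrow> integ w \<Longrightarrow> integ (z * w)"
  by (simp add: integ_def ev_mult)

lemma integ_one: "integ 1"
  by (simp add: integ_def)

lemma integ_power: "integ z \<Longrightarrow> integ (z ^ n)"
  by (induction n) (auto simp: integ_one integ_mult)

lemma integ_prod: "(\<And>i. i \<in> I \<Longrightarrow> integ (f i)) \<Longrightarrow> integ (prod f I)"
  by (induction I rule: infinite_finite_induct) (auto simp: integ_one integ_mult)

section \<open>Gauss sums and Fourier inversion\<close>

definition \<kappa> :: 'a where "\<kappa> = inverse (of_nat (q - 1))"

lemma \<kappa>_mult: "\<kappa> * of_nat (q - 1) = 1"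
  using q_gt_1 by (simp add: \<kappa>_def)

lemma dv_\<kappa>: "dv 0 \<kappa>"
proof -
  have "\<not> p dvd (q - 1)"
  proof
    assume "p dvd (q - 1)"
    moreover have "p dvd q" using h_pos by (simp add: q_def dvd_power)
    ultimately have "p dvd q - (q - 1)" by (rule dvd_diff_nat[rotated])
    moreover have "q - (q - 1) = 1" using q_gt_1 by simp
    ultimately show False using p_gt_1 by simp
  qed
  then have "\<not> dv 1 (of_nat (q - 1))" using dv_of_nat_iff[of 1 "q - 1"] by simp
  then have "av (of_nat (q - 1)) = 1"
    using dv_of_nat[of "q - 1"] unfolding dv_1_iff dv_0_iff by linarith
  then show ?thesis unfolding \<kappa>_def by (rule dv_inverse)
qed

text \<open>The Gauss sums of the powers of the Teichmueller character, with the group element \<open>x\<close>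
  replaced by \<open>x - 1\<close> so that the index \<open>w\<close> only matters modulo \<open>q - 1\<close> as long as it is positive.\<close>

definition gs :: "nat \<Rightarrow> 'a \<Rightarrow>\<^sub>0 'a" where
  "gs w = (if w = 0 then 1
     else (\<Sum>x\<in>Ts. cst (\<kappa> * inverse x ^ w) * (Poly_Mapping.single x 1 - 1)))"

lemma gs_0 [simp]: "gs 0 = 1" by (simp add: gs_def)

lemma ev_gs: "w \<ge> 1 \<Longrightarrow> ev \<phi> (gs w) = \<kappa> * (\<Sum>x\<in>Ts. inverse x ^ w * (\<phi> x - \<phi> 0))"
  by (simp add: gs_def ev_sum ev_cst_mult ev_diff sum_distrib_left mult.assoc del: power_inverse)

text \<open>Fourier inversion on \<open>Ts\<close>: summing over \<open>j\<close> first,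
  orthogonality leaves only \<open>x = t\<close>, with the term \<open>single t 1 - 1\<close>, and
  the index \<open>j = 0\<close> restores the 1. For \<open>t = 0\<close> all terms with positive
  \<open>j\<close> vanish, so the formula extends to all of \<open>T\<close>.\<close>

lemma single_eq_sum_gs:
  assumes "t \<in> T" shows "Poly_Mapping.single t 1 = (\<Sum>j<q. cst (t ^ j) * gs j)"
proof -
  have "{..<q} = insert 0 {1..q - 1}" using q_gt_1 by auto
  then have "(\<Sum>j<q. cst (t ^ j) * gs j) = 1 + (\<Sum>j = 1..q - 1. cst (t ^ j) * gs j)"
    by simp
  also have "(\<Sum>j = 1..q - 1. cst (t ^ j) * gs j) =
      (\<Sum>j = 1..q - 1. \<Sum>x\<in>Ts. cst (\<kappa> * (t ^ j * inverse x ^ j)) * (Poly_Mapping.single x 1 - 1))"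
  proof (rule sum.cong[OF refl])
    fix j assume j: "j \<in> {1..q - 1}"
    have "cst (t ^ j) * (cst (\<kappa> * inverse x ^ j) * z) = cst (\<kappa> * (t ^ j * inverse x ^ j)) * z" for x and z :: "'a \<Rightarrow>\<^sub>0 'a"
    proof -
      have "cst (t ^ j) * (cst (\<kappa> * inverse x ^ j) * z) = cst (t ^ j * (\<kappa> * inverse x ^ j)) * z"
        by (simp only: cst_mult mult.assoc)
      then show ?thesis by (simp only: mult.left_commute)
    qed
    then show "cst (t ^ j) * gs j =
      (\<Sum>x\<in>Ts. cst (\<kappa> * (t ^ j * inverse x ^ j)) * (Poly_Mapping.single x 1 - 1))"
      using j by (simp add: gs_def sum_distrib_left del: power_inverse)
  qed
  also have "\<dots> = (\<Sum>x\<in>Ts. \<Sum>j = 1..q - 1. cst (\<kappa> * (t ^ j * inverse x ^ j)) * (Poly_Mapping.single x 1 - 1))"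
    by (rule sum.swap)
  also have "\<dots> = (\<Sum>x\<in>Ts. cst (\<kappa> * (\<Sum>j = 1..q - 1. t ^ j * inverse x ^ j)) * (Poly_Mapping.single x 1 - 1))"
    by (intro sum.cong refl) (simp only: sum_distrib_left cst_sum sum_distrib_right)
  also have "\<dots> = (\<Sum>x\<in>Ts. if t = x then Poly_Mapping.single x 1 - 1 else 0)"
  proof (intro sum.cong refl)
    fix x assume x: "x \<in> Ts"
    show "cst (\<kappa> * (\<Sum>j = 1..q - 1. t ^ j * inverse x ^ j)) * (Poly_Mapping.single x 1 - 1) =
      (if t = x then Poly_Mapping.single x 1 - 1 else 0)"
    proof (cases "t = 0")
      case True
      then have "(\<Sum>j = 1..q - 1. t ^ j * inverse x ^ j) = 0" by (intro sum.neutral) auto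
      then show ?thesis using True x by auto
    next
      case False
      then have "t \<in> Ts" using assms by (simp add: Ts_def)
      then show ?thesis using sum_power_orthogonal[OF x] by (simp add: \<kappa>_mult)
    qed
  qed
  also have "1 + \<dots> = Poly_Mapping.single t 1"
    using assms by (cases "t = 0") (auto simp: Ts_def)
  finally show ?thesis ..
qed

section \<open>Products of Gauss sums, and Jacobi sums\<close>

lemma ev_gs_mult:
  assumes "i \<ge> 1" "j \<ge> 1"
  shows "ev \<phi> (gs i * gs j) = \<kappa> * \<kappa> * (\<Sum>x\<in>Ts. \<Sum>y\<in>Ts. inverse x ^ i * inverse y ^ j *
    (\<phi> (x + y) - \<phi> x - \<phi> y + \<phi> 0))"
proof -
  have "ev \<phi> (gs i * gs j) = \<kappa> * (\<Sum>y\<in>Ts. inverse y ^ j *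
     (\<kappa> * (\<Sum>x\<in>Ts. inverse x ^ i * (\<phi> (x + y) - \<phi> (0 + y))) - \<kappa> * (\<Sum>x\<in>Ts. inverse x ^ i * (\<phi> (x + 0) - \<phi> (0 + 0)))))"
    by (simp only: ev_mult ev_gs[OF assms(1)] ev_gs[OF assms(2)])
  also have "\<dots> = (\<Sum>y\<in>Ts. \<Sum>x\<in>Ts. \<kappa> * \<kappa> * (inverse x ^ i * inverse y ^ j * (\<phi> (x + y) - \<phi> x - \<phi> y + \<phi> 0)))"
    by (simp add: sum_distrib_left sum_subtractf[symmetric] algebra_simps del: power_inverse)
  also have "\<dots> = \<kappa> * \<kappa> * (\<Sum>x\<in>Ts. \<Sum>y\<in>Ts. inverse x ^ i * inverse y ^ j *
    (\<phi> (x + y) - \<phi> x - \<phi> y + \<phi> 0))"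
    by (subst sum.swap) (simp only: sum_distrib_left)
  finally show ?thesis .
qed

text \<open>For nonzero \<open>u\<close> in \<open>T\<close>, the coefficient of the class of
  \<open>u\<close> in \<open>[x + y] - [x] - [y] + [0]\<close>, the product of
  \<open>[x] - 1\<close> and \<open>[y] - 1\<close>.\<close>

definition \<delta> :: "'a \<Rightarrow> 'a \<Rightarrow> 'a \<Rightarrow> 'a" where
  "\<delta> u x y = of_bool (\<tau> (x + y) = u) - of_bool (x = u) - of_bool (y = u)"

text \<open>A Jacobi sum, the structure constant of the products of the \<open>gs\<close>; the
  correction terms in \<open>\<delta>\<close> come from using \<open>x - 1\<close> in place of
  \<open>x\<close>.\<close>

definition jac :: "nat \<Rightarrow> nat \<Rightarrow> 'a" where
  "jac i j = \<kappa> * (\<Sum>x\<in>Ts. \<Sum>y\<in>Ts. inverse x ^ i * inverse y ^ j * \<delta> 1 x y)"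

lemma dv_jac: "dv 0 (jac i j)"
  unfolding jac_def \<delta>_def
  by (intro dv_mult_0 dv_\<kappa> dv_sum dv_inverse_power_Ts dv_diff) (simp_all add: of_bool_def)

text \<open>Substitute \<open>u * x\<close> and \<open>u * y\<close>: the map \<open>\<tau>\<close>
  commutes with multiplication by \<open>u\<close>. The dependence on \<open>u\<close> becomes the
  character that defines \<open>gs (i + j)\<close>.\<close>

lemma sum_\<delta>_scale:
  assumes "u \<in> Ts"
  shows "(\<Sum>x\<in>Ts. \<Sum>y\<in>Ts. inverse x ^ i * inverse y ^ j * \<delta> u x y) =
    inverse u ^ (i + j) * (\<Sum>x\<in>Ts. \<Sum>y\<in>Ts. inverse x ^ i * inverse y ^ j * \<delta> 1 x y)"
proof -
  have d: "\<delta> u (u * x) (u * y) = \<delta> 1 x y" if "x \<in> Ts" "y \<in> Ts" for x y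
  proof -
    have "\<tau> (u * x + u * y) = u * \<tau> (x + y)"
      using \<tau>_mult_T[of u "x + y"] that assms Ts_D(1) dv_Ts by (simp add: distrib_left dv_add)
    then show ?thesis using Ts_D(2)[OF assms] by (simp add: \<delta>_def)
  qed
  have r: "(\<Sum>x\<in>Ts. f x) = (\<Sum>x\<in>Ts. f (u * x))" for f :: "'a \<Rightarrow> 'a"
    by (rule sum.reindex_bij_betw[OF bij_betw_Ts_mult[OF assms], symmetric])
  have "(\<Sum>x\<in>Ts. \<Sum>y\<in>Ts. inverse x ^ i * inverse y ^ j * \<delta> u x y) =
    (\<Sum>x\<in>Ts. \<Sum>y\<in>Ts. inverse (u * x) ^ i * inverse y ^ j * \<delta> u (u * x) y)"
    by (rule r)
  also have "\<dots> = (\<Sum>x\<in>Ts. \<Sum>y\<in>Ts. inverse (u * x) ^ i * inverse (u * y) ^ j * \<delta> u (u * x) (u * y))"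
    by (rule sum.cong[OF refl], rule r)
  also have "\<dots> = (\<Sum>x\<in>Ts. \<Sum>y\<in>Ts. inverse u ^ (i + j) * (inverse x ^ i * inverse y ^ j * \<delta> 1 x y))"
  proof (intro sum.cong refl)
    fix x y assume xy: "x \<in> Ts" "y \<in> Ts"
    show "inverse (u * x) ^ i * inverse (u * y) ^ j * \<delta> u (u * x) (u * y) =
      inverse u ^ (i + j) * (inverse x ^ i * inverse y ^ j * \<delta> 1 x y)"
      unfolding d[OF xy] by (simp add: power_mult_distrib power_add mult_ac del: power_inverse)
  qed
  finally show ?thesis by (simp only: sum_distrib_left)
qed

lemma per_\<tau>: "per \<phi> \<Longrightarrow> dv 0 x \<Longrightarrow> \<phi> (\<tau> x) = \<phi> x"
  using \<tau>_cong[of x] by (simp add: per_def)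

text \<open>Expanding the product gives the points \<open>x + y\<close>; periodicity permits
  collecting them by their Teichmueller representative \<open>u\<close>, and homogeneity in
  \<open>u\<close> splits off the Jacobi sum.\<close>

lemma gs_mult_pos:
  assumes "i \<ge> 1" "j \<ge> 1" shows "gs i * gs j \<equiv>\<^sub>p cst (jac i j) * gs (i + j)"
  unfolding geq_def
proof (intro allI impI)
  fix \<phi> assume per: "per \<phi>"
  have pick: "(\<Sum>u\<in>Ts. (\<phi> u - \<phi> 0) * of_bool (v = u)) = \<phi> v - \<phi> 0" if "v \<in> T" for v
    using that by (auto simp: T_eq_insert of_bool_def if_distrib sum.delta cong: if_cong)
  have e: "\<phi> (x + y) - \<phi> x - \<phi> y + \<phi> 0 = (\<Sum>u\<in>Ts. (\<phi> u - \<phi> 0) * \<delta> u x y)"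
    if "x \<in> Ts" "y \<in> Ts" for x y
  proof -
    have "(\<Sum>u\<in>Ts. (\<phi> u - \<phi> 0) * \<delta> u x y) =
       (\<phi> (\<tau> (x + y)) - \<phi> 0) - (\<phi> x - \<phi> 0) - (\<phi> y - \<phi> 0)"
      using that Ts_D(1) pick by (simp add: \<delta>_def right_diff_distrib[of "\<phi> _ - \<phi> 0"] sum_subtractf)
    also have "\<phi> (\<tau> (x + y)) = \<phi> (x + y)" using that by (intro per_\<tau> per dv_add dv_Ts)
    finally show ?thesis by simp
  qed
  have "ev \<phi> (gs i * gs j) = \<kappa> * \<kappa> * (\<Sum>x\<in>Ts. \<Sum>y\<in>Ts. inverse x ^ i * inverse y ^ j *
    (\<Sum>u\<in>Ts. (\<phi> u - \<phi> 0) * \<delta> u x y))"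
    using assms e by (simp add: ev_gs_mult)
  also have "(\<Sum>x\<in>Ts. \<Sum>y\<in>Ts. inverse x ^ i * inverse y ^ j * (\<Sum>u\<in>Ts. (\<phi> u - \<phi> 0) * \<delta> u x y)) =
     (\<Sum>x\<in>Ts. \<Sum>y\<in>Ts. \<Sum>u\<in>Ts. (\<phi> u - \<phi> 0) * (inverse x ^ i * inverse y ^ j * \<delta> u x y))"
    by (simp only: sum_distrib_left mult_ac)
  also have "\<dots> = (\<Sum>x\<in>Ts. \<Sum>u\<in>Ts. \<Sum>y\<in>Ts. (\<phi> u - \<phi> 0) * (inverse x ^ i * inverse y ^ j * \<delta> u x y))"
    by (rule sum.cong[OF refl], rule sum.swap)
  also have "\<dots> = (\<Sum>u\<in>Ts. \<Sum>x\<in>Ts. \<Sum>y\<in>Ts. (\<phi> u - \<phi> 0) * (inverse x ^ i * inverse y ^ j * \<delta> u x y))"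
    by (rule sum.swap)
  also have "\<dots> = (\<Sum>u\<in>Ts. (\<phi> u - \<phi> 0) * (\<Sum>x\<in>Ts. \<Sum>y\<in>Ts. inverse x ^ i * inverse y ^ j * \<delta> u x y))"
    by (simp only: sum_distrib_left)
  also have "\<dots> = (\<Sum>u\<in>Ts. (\<phi> u - \<phi> 0) * (inverse u ^ (i + j) *
      (\<Sum>x\<in>Ts. \<Sum>y\<in>Ts. inverse x ^ i * inverse y ^ j * \<delta> 1 x y)))"
    by (intro sum.cong refl) (simp only: sum_\<delta>_scale)
  also have "\<kappa> * \<kappa> * \<dots> = jac i j * (\<kappa> * (\<Sum>u\<in>Ts. inverse u ^ (i + j) * (\<phi> u - \<phi> 0)))"
    unfolding jac_def sum_distrib_left[of _ _ Ts] sum_distrib_right[of _ Ts] 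
    by (simp only: sum_distrib_left sum_distrib_right mult_ac)
  also have "\<dots> = ev \<phi> (cst (jac i j) * gs (i + j))"
    using assms by (simp add: ev_cst_mult ev_gs)
  finally show "ev \<phi> (gs i * gs j) = ev \<phi> (cst (jac i j) * gs (i + j))" .
qed

lemma gs_mult: "\<exists>J. dv 0 J \<and> gs i * gs j \<equiv>\<^sub>p cst J * gs (i + j)"
proof (cases "i = 0 \<or> j = 0")
  case True
  then show ?thesis by (intro exI[of _ 1]) (auto simp: single_one)
next
  case False
  then show ?thesis using gs_mult_pos[of i j] dv_jac by (intro exI[of _ "jac i j"]) auto
qed

text \<open>The functional \<open>\<phi> x = \<tau> x ^ W\<close> takes \<open>gs W\<close> to 1, so
  it reads off the Jacobi sum from \<open>gs i * gs j\<close>. Modulo \<open>p\<close>,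
  \<open>\<tau> (x + y)\<close> may be replaced by \<open>x + y\<close>, and in the binomial
  expansion orthogonality keeps only the term \<open>a = i\<close>. The bound
  \<open>i + j \<le> q\<close> keeps \<open>a\<close> and \<open>W - a\<close> between 1 and
  \<open>q - 1\<close>; it includes \<open>i + j = q\<close>, the carry out of the top
  digit.\<close>

lemma jac_cong:
  assumes "i \<ge> 1" "j \<ge> 1" "i + j \<le> q"
  shows "dv 1 (jac i j - of_nat ((i + j) choose i))"
proof -
  define W where "W = i + j"
  have W: "W \<ge> 1" "W \<noteq> 0" using assms by (auto simp: W_def)
  define \<phi> where "\<phi> x = \<tau> x ^ W" for x
  have per: "per \<phi>" unfolding per_def \<phi>_def using \<tau>_eq_of_cong by simp
  have \<phi>0: "\<phi> 0 = 0" using W by (simp add: \<phi>_def \<tau>_T)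
  have \<phi>T: "\<phi> x = x ^ W" if "x \<in> Ts" for x using that Ts_D(1) by (simp add: \<phi>_def \<tau>_T)
  have "ev \<phi> (gs W) = \<kappa> * (\<Sum>x\<in>Ts. 1)"
    unfolding ev_gs[OF W(1)] \<phi>0 
    by (intro arg_cong[where f = "\<lambda>s. \<kappa> * s"] sum.cong refl)
       (auto simp: \<phi>T power_mult_distrib[symmetric] dest: Ts_D(2) simp del: power_inverse)
  also have "\<dots> = 1" using \<kappa>_mult by (simp add: card_Ts)
  finally have "jac i j = ev \<phi> (gs i * gs j)"
    using gs_mult_pos[OF assms(1,2)] per by (simp add: geq_def ev_cst_mult W_def)
  also have "\<dots> = \<kappa> * \<kappa> * (\<Sum>x\<in>Ts. \<Sum>y\<in>Ts. inverse x ^ i * inverse y ^ j *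
    (\<tau> (x + y) ^ W - x ^ W - y ^ W))"
    unfolding ev_gs_mult[OF assms(1,2)]
    by (intro arg_cong[where f = "\<lambda>s. \<kappa> * \<kappa> * s"] sum.cong refl) (simp add: \<phi>0 \<phi>T, simp add: \<phi>_def)
  finally have jac: "jac i j = \<dots>" .
  have bin: "(\<Sum>x\<in>Ts. \<Sum>y\<in>Ts. inverse x ^ i * inverse y ^ j * ((x + y) ^ W - x ^ W - y ^ W)) =
    of_nat (W choose i) * (of_nat (q - 1) * of_nat (q - 1))"
  proof -
    have "{..W} = insert 0 (insert W {1..W - 1})" using W by auto
    then have b: "(x + y) ^ W - x ^ W - y ^ W = (\<Sum>a = 1..W - 1. of_nat (W choose a) * x ^ a * y ^ (W - a))"
      for x y :: 'a using W by (simp add: binomial_ring)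
    have "(\<Sum>x\<in>Ts. \<Sum>y\<in>Ts. inverse x ^ i * inverse y ^ j * ((x + y) ^ W - x ^ W - y ^ W)) =
      (\<Sum>x\<in>Ts. \<Sum>y\<in>Ts. \<Sum>a = 1..W - 1. of_nat (W choose a) * ((x ^ a * inverse x ^ i) * (y ^ (W - a) * inverse y ^ j)))"
      unfolding b sum_distrib_left by (intro sum.cong refl) (simp only: mult_ac)
    also have "\<dots> = (\<Sum>x\<in>Ts. \<Sum>a = 1..W - 1. \<Sum>y\<in>Ts. of_nat (W choose a) * ((x ^ a * inverse x ^ i) * (y ^ (W - a) * inverse y ^ j)))"
      by (rule sum.cong[OF refl], rule sum.swap)
    also have "\<dots> = (\<Sum>a = 1..W - 1. \<Sum>x\<in>Ts. \<Sum>y\<in>Ts. of_nat (W choose a) * ((x ^ a * inverse x ^ i) * (y ^ (W - a) * inverse y ^ j)))"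
      by (rule sum.swap)
    also have "\<dots> = (\<Sum>a = 1..W - 1. of_nat (W choose a) * ((\<Sum>x\<in>Ts. x ^ a * inverse x ^ i) * (\<Sum>y\<in>Ts. y ^ (W - a) * inverse y ^ j)))"
      unfolding sum_product unfolding sum_distrib_left ..
    also have "\<dots> = (\<Sum>a = 1..W - 1. if a = i then of_nat (W choose a) * (of_nat (q - 1) * of_nat (q - 1)) else 0)"
    proof (intro sum.cong refl)
      fix a assume "a \<in> {1..W - 1}"
      then have a: "1 \<le> a" "a \<le> q - 1" "1 \<le> W - a" "W - a \<le> q - 1" using assms unfolding W_def by auto
      have ij: "i \<le> q - 1" "j \<le> q - 1" using assms by auto
      have "W - a = j \<longleftrightarrow> a = i" using a by (auto simp: W_def)
      then show "of_nat (W choose a) * ((\<Sum>x\<in>Ts. x ^ a * inverse x ^ i) * (\<Sum>y\<in>Ts. y ^ (W - a) * inverse y ^ j)) =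
        (if a = i then of_nat (W choose a) * (of_nat (q - 1) * of_nat (q - 1)) else (0::'a))"
        using sum_Ts_orthogonal[OF a(1,2) assms(1) ij(1)] sum_Ts_orthogonal[OF a(3,4) assms(2) ij(2)] by simp
    qed
    also have "\<dots> = of_nat (W choose i) * (of_nat (q - 1) * of_nat (q - 1))"
      using assms by (simp add: sum.delta W_def)
    finally show ?thesis .
  qed
  have \<tau>W: "dv 1 (\<tau> (x + y) ^ W - (x + y) ^ W)" if "x \<in> Ts" "y \<in> Ts" for x y
  proof -
    have "dv 0 (x + y)" using that by (intro dv_add dv_Ts)
    then show ?thesis by (intro dv_cong_power \<tau>_cong T_dv[OF \<tau>_in_T])
  qed
  have "dv 1 (\<kappa> * \<kappa> * (\<Sum>x\<in>Ts. \<Sum>y\<in>Ts. inverse x ^ i * inverse y ^ j * (\<tau> (x + y) ^ W - (x + y) ^ W)))"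
    by (intro dv_mult_left[of 1] dv_sum \<tau>W dv_mult_0 dv_\<kappa> dv_inverse_power_Ts)
  also have "\<kappa> * \<kappa> * (\<Sum>x\<in>Ts. \<Sum>y\<in>Ts. inverse x ^ i * inverse y ^ j * (\<tau> (x + y) ^ W - (x + y) ^ W)) =
     jac i j - \<kappa> * \<kappa> * (\<Sum>x\<in>Ts. \<Sum>y\<in>Ts. inverse x ^ i * inverse y ^ j * ((x + y) ^ W - x ^ W - y ^ W))"
    unfolding jac right_diff_distrib[symmetric] sum_subtractf[symmetric]
    by (intro arg_cong[where f = "\<lambda>s. \<kappa> * \<kappa> * s"] sum.cong refl) (simp add: algebra_simps del: power_inverse)
  also have "\<kappa> * \<kappa> * (\<Sum>x\<in>Ts. \<Sum>y\<in>Ts. inverse x ^ i * inverse y ^ j * ((x + y) ^ W - x ^ W - y ^ W)) =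
     (\<kappa> * of_nat (q - 1)) * (\<kappa> * of_nat (q - 1)) * of_nat (W choose i)"
    unfolding bin by (simp only: mult_ac)
  finally show ?thesis by (simp add: \<kappa>_mult W_def)
qed

subsection \<open>Stickelberger's bound\<close>

definition gprod :: "(nat \<Rightarrow> nat) \<Rightarrow> 'a \<Rightarrow>\<^sub>0 'a" where
  "gprod n = (\<Prod>k<h. gs (p ^ k) ^ n k)"

lemma gprod_upd:
  assumes "k < h" shows "gprod (n(k := n k + r)) = gs (p ^ k) ^ r * gprod n"
proof -
  have "gprod n = gs (p ^ k) ^ n k * (\<Prod>i\<in>{..<h} - {k}. gs (p ^ i) ^ n i)" for n
    unfolding gprod_def using assms by (intro prod.remove) auto
  moreover have "(\<Prod>i\<in>{..<h} - {k}. gs (p ^ i) ^ (n(k := n k + r)) i) = (\<Prod>i\<in>{..<h} - {k}. gs (p ^ i) ^ n i)"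
    by (intro prod.cong) auto
  ultimately show ?thesis by (simp add: power_add mult_ac)
qed

lemma gprod_add: "gprod (\<lambda>k. m k + n k) = gprod m * gprod n"
  by (simp add: gprod_def power_add prod.distrib)

lemma gprod_0 [simp]: "gprod (\<lambda>_. 0) = 1"
  by (simp add: gprod_def)

lemma gprod_sum: "gprod (\<lambda>k. \<Sum>e\<in>E. n e k) = (\<Prod>e\<in>E. gprod (n e))"
  by (induction E rule: infinite_finite_induct) (auto simp: gprod_add)

lemma sum_upd:
  assumes "k < (h::nat)" shows "(\<Sum>i<h. f i * (n(k := n k + r)) i) = (\<Sum>i<h. f i * n i) + f k * (r::nat)"
proof -
  have "(\<Sum>i<h. f i * n i) = f k * n k + (\<Sum>i\<in>{..<h} - {k}. f i * n i)" for n
    using assms by (intro sum.remove) auto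
  moreover have "(\<Sum>i\<in>{..<h} - {k}. f i * (n(k := n k + r)) i) = (\<Sum>i\<in>{..<h} - {k}. f i * n i)"
    by (intro sum.cong) auto
  ultimately show ?thesis by (simp add: distrib_left)
qed

text \<open>Split \<open>p ^ k\<close>, the exact power of \<open>p\<close> in \<open>j\<close>, off
  \<open>j\<close>. The binomial coefficient of \<open>j\<close> over \<open>p ^ k\<close> is prime
  to \<open>p\<close>, so the Jacobi sum linking \<open>gs j\<close> to
  \<open>gs j' * gs (p ^ k)\<close> is a unit and can be inverted.\<close>

lemma gs_digits_pos:
  assumes "1 \<le> j" "j < q"
  shows "\<exists>n u. (\<Sum>k<h. p ^ k * n k) = j \<and> dv 0 u \<and> gs j \<equiv>\<^sub>p cst u * gprod n"
  using assms
proof (induction j rule: less_induct)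
  case (less j)
  define k where "k = multiplicity p j"
  obtain m where m: "j = p ^ k * m" "\<not> p dvd m"
    using less.prems(1) p_gt_1 multiplicity_decompose'[of j p] unfolding k_def by auto
  have m1: "m \<ge> 1" using m less.prems by (cases m) auto
  have kh: "k < h"
  proof -
    have "p ^ k * 1 \<le> p ^ k * m" using m1 by (intro mult_le_mono2)
    then have "p ^ k < p ^ h" using m(1) less.prems(2) unfolding q_def by linarith
    then show ?thesis using p_gt_1 by (simp add: power_strict_increasing_iff)
  qed
  show ?case
  proof (cases "m = 1")
    case True
    define n0 where "n0 = (\<lambda>_::nat. 0::nat)(k := 0 + 1)"
    have "(\<Sum>i<h. p ^ i * n0 i) = j"
      unfolding n0_def sum_upd[OF kh, of _ "\<lambda>_. 0" 1] using True m(1) by simp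
    moreover have "gprod n0 = gs j"
      unfolding n0_def gprod_upd[OF kh, of "\<lambda>_. 0" 1] using True m(1) by simp
    ultimately show ?thesis
      by (intro exI[of _ n0] exI[of _ 1]) (simp add: single_one)
  next
    case False
    define j' where "j' = p ^ k * (m - 1)"
    have jj: "j = j' + p ^ k" using m m1 by (simp add: j'_def right_diff_distrib' algebra_simps)
    have pk: "p ^ k \<ge> 1" using p_gt_1 by (simp add: Suc_leI One_nat_def)
    have j1: "1 \<le> j'" "j' < j" "j' < q"
      using False m1 pk jj less.prems p_gt_1 by (auto simp: j'_def Suc_leI One_nat_def)
    obtain n u where nu: "(\<Sum>k<h. p ^ k * n k) = j'" "dv 0 u" "gs j' \<equiv>\<^sub>p cst u * gprod n"
      using less.IH[OF j1(2,1,3)] by blast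
    have "(j choose j') = (j choose (p ^ k))" using binomial_symmetric[of "p ^ k" j] jj by simp
    moreover have "multiplicity p (j choose (p ^ k)) = 0"
      unfolding m(1) using const_p_fac[of m p k] m m1 prime_p by (simp add: not_dvd_imp_multiplicity_0)
    moreover have "j choose (p ^ k) \<noteq> 0" using jj by simp
    ultimately have "\<not> p dvd (j choose j')"
      using prime_p prime_multiplicity_gt_zero_iff[of p "j choose j'"] by auto
    then have nd: "\<not> dv 1 (of_nat (j choose j'))" using dv_of_nat_iff[of 1 "j choose j'"] by simp
    define J where "J = jac j' (p ^ k)"
    have "dv 1 (J - of_nat (j choose j'))"
      using jac_cong[OF j1(1) pk] jj less.prems(2) by (simp add: J_def)
    then have "\<not> dv 1 J" using nd dv_cong_iff by blast
    then have avJ: "av J = 1" using dv_jac[of j' "p ^ k"] unfolding J_def dv_1_iff dv_0_iff by linarith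
    then have J0: "J \<noteq> 0" by auto
    have "gs j = cst (inverse J) * (cst J * gs j)"
      using J0 by (simp add: mult.assoc[symmetric] cst_mult[symmetric] single_one)
    also have "\<dots> \<equiv>\<^sub>p cst (inverse J) * (gs j' * gs (p ^ k))"
      unfolding J_def jj by (intro geq_mult_left geq_sym[OF gs_mult_pos] j1(1) pk)
    also have "\<dots> \<equiv>\<^sub>p cst (inverse J) * (cst u * gprod n * gs (p ^ k))"
      by (intro geq_mult_left geq_mult_right nu(3))
    also have "\<dots> = cst (inverse J * u) * gprod (n(k := n k + 1))"
      by (simp add: gprod_upd[OF kh] cst_mult mult_ac)
    finally have "gs j \<equiv>\<^sub>p cst (inverse J * u) * gprod (n(k := n k + 1))" .
    moreover have "dv 0 (inverse J * u)" using dv_inverse[OF avJ] nu(2) by (intro dv_mult_left)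
    moreover have "(\<Sum>i<h. p ^ i * (n(k := n k + 1)) i) = j"
      unfolding sum_upd[OF kh] using nu(1) jj by simp
    ultimately show ?thesis by blast
  qed
qed

lemma gs_digits:
  assumes "j < q"
  shows "\<exists>n u. (\<Sum>k<h. p ^ k * n k) = j \<and> dv 0 u \<and> gs j \<equiv>\<^sub>p cst u * gprod n"
proof (cases "j = 0")
  case True
  then show ?thesis by (intro exI[of _ "\<lambda>_. 0"] exI[of _ 1]) (simp add: single_one)
qed (use gs_digits_pos assms in auto)

definition dig :: "nat \<Rightarrow> nat \<Rightarrow> nat" where
  "dig j = (SOME n. \<exists>u. (\<Sum>k<h. p ^ k * n k) = j \<and> dv 0 u \<and> gs j \<equiv>\<^sub>p cst u * gprod n)"

lemma dig:
  assumes "j < q"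
  shows "(\<Sum>k<h. p ^ k * dig j k) = j" "\<exists>u. dv 0 u \<and> gs j \<equiv>\<^sub>p cst u * gprod (dig j)"
proof -
  from someI_ex[OF gs_digits[OF assms]]
  show "(\<Sum>k<h. p ^ k * dig j k) = j" "\<exists>u. dv 0 u \<and> gs j \<equiv>\<^sub>p cst u * gprod (dig j)"
    unfolding dig_def by auto
qed

lemma gs_q: "gs q = gs 1"
proof -
  have "inverse x ^ q = inverse x ^ 1" if "x \<in> Ts" for x
    using Ts_D(1)[OF Ts_inverse[OF that]] unfolding T_iff by simp
  then show ?thesis unfolding gs_def using q_gt_1 by (auto intro!: sum.cong simp del: power_inverse)
qed

lemma gs_power:
  assumes "a \<ge> 1" shows "\<exists>v. dv 0 v \<and> gs w ^ a \<equiv>\<^sub>p cst v * gs (a * w)"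
  using assms
proof (induction a rule: dec_induct)
  case base
  show ?case by (intro exI[of _ 1]) (simp add: single_one)
next
  case (step a)
  then obtain v where v: "dv 0 v" "gs w ^ a \<equiv>\<^sub>p cst v * gs (a * w)" by blast
  obtain J where J: "dv 0 J" "gs (a * w) * gs w \<equiv>\<^sub>p cst J * gs (a * w + w)" using gs_mult by blast
  have "gs w ^ Suc a = gs w ^ a * gs w" by (simp add: mult.commute)
  also have "\<dots> \<equiv>\<^sub>p cst v * gs (a * w) * gs w" by (intro geq_mult_right v)
  also have "\<dots> = cst v * (gs (a * w) * gs w)" by (simp add: mult.assoc)
  also have "\<dots> \<equiv>\<^sub>p cst v * (cst J * gs (a * w + w))" by (intro geq_mult_left J)
  also have "\<dots> = cst (v * J) * gs (Suc a * w)" by (simp add: cst_mult mult.assoc add.commute)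
  finally show ?case using v(1) J(1) dv_mult_left by blast
qed

text \<open>Multiplying up to index \<open>(p - 1) * p ^ k\<close> costs only integral factors. The
  last step reaches \<open>p ^ (k + 1)\<close>, and its Jacobi sum is congruent to the binomial
  coefficient of \<open>p ^ (k + 1)\<close> over \<open>p ^ k\<close>, a multiple of
  \<open>p\<close>. For \<open>k = h - 1\<close> the index wraps around by
  \<open>gs q = gs 1\<close>.\<close>

lemma gs_power_p:
  assumes "k < h"
  shows "\<exists>v. dv 1 v \<and> gs (p ^ k) ^ p \<equiv>\<^sub>p cst v * gs (p ^ (Suc k mod h))"
proof -
  have p1: "p - 1 \<ge> 1" "p = Suc (p - 1)" using p_gt_1 by auto
  obtain v where v: "dv 0 v" "gs (p ^ k) ^ (p - 1) \<equiv>\<^sub>p cst v * gs ((p - 1) * p ^ k)"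
    using gs_power[OF p1(1)] by blast
  define i where "i = (p - 1) * p ^ k"
  have pk: "p ^ k \<ge> 1" using p_gt_1 by (simp add: Suc_leI One_nat_def)
  have "1 * 1 \<le> (p - 1) * p ^ k" using p1(1) pk by (intro mult_le_mono)
  then have i1: "i \<ge> 1" by (simp add: i_def)
  have isum: "i + p ^ k = p ^ Suc k" using p1(2) unfolding i_def by (metis add.commute mult_Suc power_Suc)
  have le: "i + p ^ k \<le> q" unfolding isum q_def using assms p_pos by (intro power_increasing) auto
  define J where "J = jac i (p ^ k)"
  have "(i + p ^ k choose i) = (i + p ^ k choose p ^ k)"
    using binomial_symmetric[of i "i + p ^ k"] by simp
  also have "\<dots> = (p ^ k * p choose p ^ k)" using isum by (simp add: mult.commute)
  finally have "(i + p ^ k choose i) = (p ^ k * p choose p ^ k)" .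
  moreover have "multiplicity p (p ^ k * p choose p ^ k) = 1"
    using const_p_fac[of p p k] p_pos prime_p by (simp add: multiplicity_self)
  ultimately have "p dvd (i + p ^ k choose i)"
    by (metis multiplicity_eq_zero_iff not_dvd_imp_multiplicity_0 zero_neq_one)
  then have "dv 1 (of_nat (i + p ^ k choose i))" using dv_of_nat_iff[of 1] by simp
  then have dJ: "dv 1 J" using jac_cong[OF i1 pk le] dv_cong_iff unfolding J_def by blast
  have e: "gs (p ^ Suc k) = gs (p ^ (Suc k mod h))"
  proof (cases "Suc k = h")
    case True
    then show ?thesis using gs_q by (simp add: q_def)
  qed (use assms in auto)
  have "gs (p ^ k) ^ p = gs (p ^ k) ^ (p - 1) * gs (p ^ k)" by (subst p1(2)) (simp add: mult.commute)
  also have "\<dots> \<equiv>\<^sub>p cst v * gs i * gs (p ^ k)" unfolding i_def by (intro geq_mult_right v)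
  also have "\<dots> = cst v * (gs i * gs (p ^ k))" by (simp add: mult.assoc)
  also have "\<dots> \<equiv>\<^sub>p cst v * (cst J * gs (i + p ^ k))"
    unfolding J_def by (intro geq_mult_left gs_mult_pos i1 pk)
  also have "\<dots> = cst (v * J) * gs (p ^ (Suc k mod h))"
    unfolding isum e by (simp add: cst_mult mult.assoc)
  finally show ?thesis using dv_mult_left[OF dJ v(1)] by blast
qed

text \<open>Trading \<open>p\<close> equal factors for one of the next index gains a factor
  \<open>p\<close> and lowers the exponent sum by \<open>p - 1\<close>, so the process ends, with
  all exponents at most \<open>p - 1\<close>.\<close>

lemma gprod_reduce:
  "\<exists>e v n'. dv e v \<and> gprod n \<equiv>\<^sub>p cst v * gprod n' \<and> (\<forall>k<h. n' k \<le> p - 1) \<and>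
     (\<Sum>k<h. n k) = (\<Sum>k<h. n' k) + e * (p - 1)"
proof (induction "\<Sum>k<h. n k" arbitrary: n rule: less_induct)
  case less
  show ?case
  proof (cases "\<forall>k<h. n k \<le> p - 1")
    case True
    then show ?thesis
      by (intro exI[of _ 0] exI[of _ 1] exI[of _ n]) (simp add: single_one)
  next
    case False
    then obtain k where k: "k < h" "n k \<ge> p" by force
    define n1 where "n1 = n(k := n k - p)"
    define k' where "k' = Suc k mod h"
    have k': "k' < h" using h_pos by (simp add: k'_def)
    define n2 where "n2 = n1(k' := n1 k' + 1)"
    have n: "n = n1(k := n1 k + p)" using k by (auto simp: n1_def)
    have "(\<Sum>i<h. n i) = (\<Sum>i<h. n1 i) + p"
      using sum_upd[OF k(1), of "\<lambda>_. 1" n1 p] unfolding n[symmetric] by simp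
    moreover have "(\<Sum>i<h. n2 i) = (\<Sum>i<h. n1 i) + 1"
      using sum_upd[OF k', of "\<lambda>_. 1" n1 1] unfolding n2_def[symmetric] by simp
    ultimately have s: "(\<Sum>i<h. n i) = (\<Sum>i<h. n2 i) + (p - 1)" "(\<Sum>i<h. n2 i) < (\<Sum>i<h. n i)"
      using p_gt_1 by auto
    from less[OF s(2)] obtain e v n' where e: "dv e v" "gprod n2 \<equiv>\<^sub>p cst v * gprod n'"
      "\<forall>k<h. n' k \<le> p - 1" "(\<Sum>k<h. n2 k) = (\<Sum>k<h. n' k) + e * (p - 1)" by blast
    obtain w where w: "dv 1 w" "gs (p ^ k) ^ p \<equiv>\<^sub>p cst w * gs (p ^ k')"
      using gs_power_p[OF k(1)] unfolding k'_def by blast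
    have "gprod n = gs (p ^ k) ^ p * gprod n1" by (subst n) (rule gprod_upd[OF k(1)])
    also have "\<dots> \<equiv>\<^sub>p cst w * gs (p ^ k') * gprod n1" by (intro geq_mult_right w)
    also have "\<dots> = cst w * gprod n2" unfolding n2_def gprod_upd[OF k'] by (simp add: mult.assoc)
    also have "\<dots> \<equiv>\<^sub>p cst w * (cst v * gprod n')" by (intro geq_mult_left e)
    also have "\<dots> = cst (w * v) * gprod n'" by (simp add: cst_mult mult.assoc)
    finally have "gprod n \<equiv>\<^sub>p cst (w * v) * gprod n'" .
    moreover have "dv (1 + e) (w * v)" using w(1) e(1) by (rule dv_mult)
    moreover have "(\<Sum>k<h. n k) = (\<Sum>k<h. n' k) + (1 + e) * (p - 1)" using s(1) e(4) by (simp add: distrib_right)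
    ultimately show ?thesis using e(3) by blast
  qed
qed

text \<open>The coefficient of the zero class. On a single group element \<open>x\<close> it is the
  indicator of \<open>dv 1 x\<close>.\<close>

definition \<Lambda> :: "('a \<Rightarrow>\<^sub>0 'a) \<Rightarrow> 'a" where "\<Lambda> z = ev (\<lambda>x. of_bool (dv 1 x)) z"

lemma \<Lambda>_geq: "z \<equiv>\<^sub>p w \<Longrightarrow> \<Lambda> z = \<Lambda> w"
proof -
  have "per (\<lambda>x. of_bool (dv 1 x))" unfolding per_def using dv_cong_iff by simp
  then show "z \<equiv>\<^sub>p w \<Longrightarrow> \<Lambda> z = \<Lambda> w" by (simp add: geq_def \<Lambda>_def)
qed

lemma integ_gs: "integ (gs w)"
proof (cases "w = 0")
  case False
  then show ?thesis unfolding integ_def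
    by (auto simp: ev_gs Suc_le_eq One_nat_def intro!: dv_mult_0 dv_sum dv_diff dv_\<kappa> dv_inverse_power_Ts
        simp del: power_inverse)
qed (simp add: integ_one)

lemma dv_\<Lambda>_integ: "integ z \<Longrightarrow> dv 0 (\<Lambda> z)"
  unfolding integ_def \<Lambda>_def by (simp add: of_bool_def)

lemma gs_prod: "\<exists>u. dv 0 u \<and> (\<Prod>e\<in>E. gs (\<mu> e)) \<equiv>\<^sub>p cst u * gs (\<Sum>e\<in>E. \<mu> e)"
proof (induction E rule: infinite_finite_induct)
  case (insert e E)
  then obtain u where u: "dv 0 u" "(\<Prod>e\<in>E. gs (\<mu> e)) \<equiv>\<^sub>p cst u * gs (\<Sum>e\<in>E. \<mu> e)" by blast
  obtain J where J: "dv 0 J" "gs (\<mu> e) * gs (\<Sum>e\<in>E. \<mu> e) \<equiv>\<^sub>p cst J * gs (\<mu> e + (\<Sum>e\<in>E. \<mu> e))"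
    using gs_mult by blast
  have "(\<Prod>e\<in>insert e E. gs (\<mu> e)) = gs (\<mu> e) * (\<Prod>e\<in>E. gs (\<mu> e))" using insert by simp
  also have "\<dots> \<equiv>\<^sub>p gs (\<mu> e) * (cst u * gs (\<Sum>e\<in>E. \<mu> e))" by (intro geq_mult_left u)
  also have "\<dots> = cst u * (gs (\<mu> e) * gs (\<Sum>e\<in>E. \<mu> e))" by (simp add: mult_ac)
  also have "\<dots> \<equiv>\<^sub>p cst u * (cst J * gs (\<mu> e + (\<Sum>e\<in>E. \<mu> e)))" by (intro geq_mult_left J)
  also have "\<dots> = cst (u * J) * gs (\<Sum>e\<in>insert e E. \<mu> e)" using insert by (simp add: cst_mult mult.assoc)
  finally show ?case using u(1) J(1) dv_mult_left by blast
qed (auto intro!: exI[of _ 1] simp: single_one)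

text \<open>The product is a multiple of \<open>gs w\<close> for the total index \<open>w\<close>,
  and the zero class enters \<open>gs w\<close> only through the terms \<open>- 1\<close>, which
  gives a power sum over \<open>Ts\<close>.\<close>

lemma \<Lambda>_prod_gs_eq_0:
  assumes "\<not> (q - 1) dvd (\<Sum>e\<in>E. \<mu> e)" shows "\<Lambda> (\<Prod>e\<in>E. gs (\<mu> e)) = 0"
proof -
  define w where "w = (\<Sum>e\<in>E. \<mu> e)"
  have w: "w \<ge> 1" using assms by (cases w) (auto simp: w_def One_nat_def)
  obtain u where "(\<Prod>e\<in>E. gs (\<mu> e)) \<equiv>\<^sub>p cst u * gs w" unfolding w_def using gs_prod by blast
  then have "\<Lambda> (\<Prod>e\<in>E. gs (\<mu> e)) = u * \<Lambda> (gs w)" using \<Lambda>_geq by (simp add: \<Lambda>_def ev_cst_mult)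
  also have "\<Lambda> (gs w) = \<kappa> * (\<Sum>x\<in>Ts. inverse x ^ w * (- 1))"
  proof -
    have "\<not> dv 1 x" if "x \<in> Ts" for x
      using T_eqI[of x 0] that Ts_D by auto
    then show ?thesis unfolding \<Lambda>_def ev_gs[OF w] by (simp del: power_inverse)
  qed
  also have "(\<Sum>x\<in>Ts. inverse x ^ w * (- 1)) = - (\<Sum>x\<in>Ts. x ^ w)"
    unfolding sum_negf[symmetric]
    by (rule sum.reindex_bij_witness[of _ inverse inverse]) (auto intro: Ts_inverse)
  also have "(\<Sum>x\<in>Ts. x ^ w) = 0" using assms by (simp add: sum_Ts_power w_def)
  finally show ?thesis by simp
qed

text \<open>Each \<open>p - 1\<close> of the digit sum yields one factor \<open>p\<close>, except
  that the reduced monomial may keep up to \<open>h * (p - 1)\<close> factors, which accounts for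
  the loss \<open>h\<close>.\<close>

lemma dv_\<Lambda>_prod_gs:
  assumes "finite E" "\<And>e. e \<in> E \<Longrightarrow> \<mu> e < q"
  shows "\<exists>m. dv m (\<Lambda> (\<Prod>e\<in>E. gs (\<mu> e))) \<and> (\<Sum>e\<in>E. \<Sum>k<h. dig (\<mu> e) k) \<le> (m + h) * (p - 1)"
proof -
  have "\<exists>u. dv 0 u \<and> (\<Prod>e\<in>E. gs (\<mu> e)) \<equiv>\<^sub>p cst u * (\<Prod>e\<in>E. gprod (dig (\<mu> e)))"
    using assms
  proof (induction E rule: finite_induct)
    case empty
    show ?case by (intro exI[of _ 1]) (simp add: single_one)
  next
    case (insert e E)
    then obtain u where u: "dv 0 u" "(\<Prod>e\<in>E. gs (\<mu> e)) \<equiv>\<^sub>p cst u * (\<Prod>e\<in>E. gprod (dig (\<mu> e)))" by auto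
    obtain v where v: "dv 0 v" "gs (\<mu> e) \<equiv>\<^sub>p cst v * gprod (dig (\<mu> e))" using dig(2) insert.prems by blast
    have "gs (\<mu> e) * (\<Prod>e\<in>E. gs (\<mu> e)) \<equiv>\<^sub>p (cst v * gprod (dig (\<mu> e))) * (cst u * (\<Prod>e\<in>E. gprod (dig (\<mu> e))))"
      by (intro geq_mult u v)
    also have "\<dots> = cst (v * u) * (gprod (dig (\<mu> e)) * (\<Prod>e\<in>E. gprod (dig (\<mu> e))))"
      by (simp only: cst_mult mult_ac)
    finally show ?case using insert.hyps u(1) v(1) dv_mult_left by auto
  qed
  then obtain u where u: "dv 0 u" "(\<Prod>e\<in>E. gs (\<mu> e)) \<equiv>\<^sub>p cst u * gprod (\<lambda>k. \<Sum>e\<in>E. dig (\<mu> e) k)"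
    by (auto simp: gprod_sum)
  obtain m v n' where m: "dv m v" "gprod (\<lambda>k. \<Sum>e\<in>E. dig (\<mu> e) k) \<equiv>\<^sub>p cst v * gprod n'"
    "\<forall>k<h. n' k \<le> p - 1" "(\<Sum>k<h. \<Sum>e\<in>E. dig (\<mu> e) k) = (\<Sum>k<h. n' k) + m * (p - 1)"
    using gprod_reduce[of "\<lambda>k. \<Sum>e\<in>E. dig (\<mu> e) k"] by blast
  have "(\<Prod>e\<in>E. gs (\<mu> e)) \<equiv>\<^sub>p cst u * (cst v * gprod n')"
    using u(2) geq_mult_left[OF m(2)] by (rule geq_trans)
  then have "\<Lambda> (\<Prod>e\<in>E. gs (\<mu> e)) = u * (v * \<Lambda> (gprod n'))"
    using \<Lambda>_geq by (simp add: \<Lambda>_def ev_cst_mult)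
  moreover have "dv 0 (\<Lambda> (gprod n'))"
    unfolding gprod_def by (intro dv_\<Lambda>_integ integ_prod integ_power integ_gs)
  ultimately have "dv m (\<Lambda> (\<Prod>e\<in>E. gs (\<mu> e)))" using u(1) m(1) by (simp add: dv_mult_left dv_mult_right)
  moreover have "(\<Sum>e\<in>E. \<Sum>k<h. dig (\<mu> e) k) \<le> (m + h) * (p - 1)"
  proof -
    have "(\<Sum>k<h. n' k) \<le> (\<Sum>k<h. p - 1)" using m(3) by (intro sum_mono) auto
    then show ?thesis using m(4) by (subst sum.swap) (simp add: distrib_right)
  qed
  ultimately show ?thesis by blast
qed

text \<open>The group element of a sum is the product of the group elements of its terms. Each of
  these is expanded by \<open>single_eq_sum_gs\<close>, and \<open>\<Lambda>\<close> of the product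
  is the indicator.\<close>

lemma of_bool_dv_sum_expand:
  assumes "finite E" "\<And>e. e \<in> E \<Longrightarrow> t e \<in> T"
  shows "of_bool (dv 1 (\<Sum>e\<in>E. t e)) =
    (\<Sum>\<mu>\<in>E \<rightarrow>\<^sub>E {..<q}. \<Lambda> (\<Prod>e\<in>E. gs (\<mu> e)) * (\<Prod>e\<in>E. t e ^ \<mu> e))"
proof -
  have s: "Poly_Mapping.single (\<Sum>e\<in>E. t e) (1::'a) = (\<Prod>e\<in>E. Poly_Mapping.single (t e) 1)"
    using assms(1)
  proof (induction E rule: finite_induct)
    case (insert x F)
    then show ?case using mult_single[of "t x" "1::'a" "sum t F" 1] by simp
  qed simp
  have c: "(\<Prod>e\<in>E. cst (f e)) = (cst (\<Prod>e\<in>E. f e) :: 'a \<Rightarrow>\<^sub>0 'a)" for f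
    using assms(1) by (induction E rule: finite_induct) (auto simp: mult_single single_one)
  have "Poly_Mapping.single (\<Sum>e\<in>E. t e) 1 = (\<Prod>e\<in>E. \<Sum>j<q. cst (t e ^ j) * gs j)"
    unfolding s using assms(2) by (intro prod.cong refl single_eq_sum_gs)
  also have "\<dots> = (\<Sum>\<mu>\<in>E \<rightarrow>\<^sub>E {..<q}. \<Prod>e\<in>E. cst (t e ^ \<mu> e) * gs (\<mu> e))"
    using assms(1) by (intro prod_sum_PiE) auto
  also have "\<dots> = (\<Sum>\<mu>\<in>E \<rightarrow>\<^sub>E {..<q}. cst (\<Prod>e\<in>E. t e ^ \<mu> e) * (\<Prod>e\<in>E. gs (\<mu> e)))"
    by (simp add: prod.distrib c)
  finally have "\<Lambda> (Poly_Mapping.single (\<Sum>e\<in>E. t e) 1) =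
    (\<Sum>\<mu>\<in>E \<rightarrow>\<^sub>E {..<q}. (\<Prod>e\<in>E. t e ^ \<mu> e) * \<Lambda> (\<Prod>e\<in>E. gs (\<mu> e)))"
    by (simp add: \<Lambda>_def ev_sum ev_cst_mult)
  moreover have "\<Lambda> (Poly_Mapping.single (\<Sum>e\<in>E. t e) 1) = of_bool (dv 1 (\<Sum>e\<in>E. t e))"
    by (simp add: \<Lambda>_def)
  ultimately show ?thesis by (simp add: mult.commute)
qed

end

subsection \<open>The Ax-Katz theorem\<close>

lemma bij_betw_add_mod:
  fixes h :: nat assumes "h \<ge> 1"
  shows "bij_betw (\<lambda>i. (j + i) mod h) {..<h} {..<h}"
proof -
  have inj: "inj_on (\<lambda>i. (j + i) mod h) {..<h}"
  proof (rule inj_onI)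
    fix x y assume "x \<in> {..<h}" "y \<in> {..<h}" "(j + x) mod h = (j + y) mod h"
    then have "[x = y] (mod h)" by (metis cong_add_lcancel_nat cong_def)
    then show "x = y" using \<open>x \<in> {..<h}\<close> \<open>y \<in> {..<h}\<close> by (simp add: cong_def)
  qed
  have "(\<lambda>i. (j + i) mod h) ` {..<h} \<subseteq> {..<h}" using assms by auto
  then show ?thesis using inj by (intro bij_betw_imageI endo_inj_surj) auto
qed

lemma sum_le_card_mult:
  fixes f :: "'l \<Rightarrow> nat"
  assumes "finite S" "\<And>l. l \<in> S \<Longrightarrow> r \<le> f l" shows "card S * r \<le> sum f S"
  using sum_bounded_below[of S r f] assms by simp

context unram
begin

lemma p_power_mod_cong: "[p ^ (i mod h) = p ^ i] (mod (q - 1))"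
proof -
  have "[q = 1] (mod (q - 1))" using q_gt_1 by (simp add: cong_altdef_nat)
  then have "[q ^ (i div h) * p ^ (i mod h) = 1 ^ (i div h) * p ^ (i mod h)] (mod (q - 1))"
    by (intro cong_mult cong_pow) auto
  moreover have "q ^ (i div h) * p ^ (i mod h) = p ^ i"
    unfolding q_def by (simp flip: power_mult power_add)
  ultimately show ?thesis by (simp add: cong_sym)
qed

lemma sum_p_power: "(p - 1) * (\<Sum>i<h. p ^ i) = q - 1"
proof -
  have "int ((p - 1) * (\<Sum>i<h. p ^ i)) = int (q - 1)"
    using p_gt_1 q_gt_1 power_diff_1_eq[of "int p" h] by (simp add: q_def of_nat_diff)
  then show ?thesis using of_nat_eq_iff by blast
qed

text \<open>Rotating the base-\<open>p\<close> digits of all exponents multiplies them by a power of \<open>p\<close> modulo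
  \<open>q - 1\<close>. For each rotation the quotients \<open>\<alpha>\<close> are integers, which is what yields the bound with
  the ceiling in \<open>q\<close>-adic rather than \<open>p\<close>-adic units.\<close>

lemma digit_weight_bound:
  fixes K :: "'k set" and L :: "'k \<Rightarrow> nat" and M :: "'k \<Rightarrow> nat \<Rightarrow> nat"
    and w :: "'k \<Rightarrow> nat \<Rightarrow> 'n::finite \<Rightarrow> nat" and D m :: "'k \<Rightarrow> nat"
    and dg :: "'k \<Rightarrow> nat \<Rightarrow> nat \<Rightarrow> nat"
  assumes fin: "finite K"
    and deg: "\<And>k e. k \<in> K \<Longrightarrow> e < L k \<Longrightarrow> (\<Sum>l\<in>UNIV. w k e l) \<le> D k"
    and Dm: "\<And>k. k \<in> K \<Longrightarrow> D k \<le> Dm" "Dm \<ge> 1"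
    and c: "\<And>b. CARD('n) \<le> (\<Sum>k\<in>K. D k) + Dm * b \<Longrightarrow> c \<le> b"
    and dg: "\<And>k e. k \<in> K \<Longrightarrow> e < L k \<Longrightarrow> (\<Sum>j<h. p ^ j * dg k e j) = M k e"
    and dvd_A: "\<And>k. k \<in> K \<Longrightarrow> (q - 1) dvd (\<Sum>e<L k. M k e)"
    and dvd_C: "\<And>l. (q - 1) dvd (\<Sum>k\<in>K. \<Sum>e<L k. M k e * w k e l)"
    and m: "\<And>k. k \<in> K \<Longrightarrow> (\<Sum>e<L k. \<Sum>j<h. dg k e j) \<le> (m k + h) * (p - 1)"
  shows "h * c \<le> (\<Sum>k\<in>K. m k) + h * card {l. (\<Sum>k\<in>K. \<Sum>e<L k. M k e * w k e l) = 0}"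
proof -
  define C where "C l = (\<Sum>k\<in>K. \<Sum>e<L k. M k e * w k e l)" for l
  define z where "z = card {l. C l = 0}"
  \<comment> \<open>\<open>R i k e\<close> is \<open>M k e\<close> with its digits rotated by
    \<open>i\<close> places, which is multiplication by \<open>p ^ i\<close> modulo
    \<open>q - 1\<close>. \<open>A\<close> and \<open>Cr\<close> are the rotated sums of
    \<open>dvd_A\<close> and \<open>dvd_C\<close>.\<close>
  define R where "R i k e = (\<Sum>j<h. dg k e j * p ^ ((j + i) mod h))" for i k e
  define A where "A i k = (\<Sum>e<L k. R i k e)" for i k
  define Cr where "Cr i l = (\<Sum>k\<in>K. \<Sum>e<L k. R i k e * w k e l)" for i l
  define \<alpha> where "\<alpha> i k = A i k div (q - 1)" for i k
  have q1: "q - 1 > 0" using q_gt_1 by simp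
  have R_cong: "[R i k e = p ^ i * M k e] (mod (q - 1))" if "k \<in> K" "e < L k" for i k e
  proof -
    have "[R i k e = (\<Sum>j<h. dg k e j * p ^ (j + i))] (mod (q - 1))"
      unfolding R_def by (intro cong_sum cong_scalar_left p_power_mod_cong)
    also have "(\<Sum>j<h. dg k e j * p ^ (j + i)) = p ^ i * (\<Sum>j<h. p ^ j * dg k e j)"
      by (simp add: sum_distrib_left power_add mult_ac)
    finally show ?thesis using dg[OF that] by simp
  qed
  have A_dvd: "(q - 1) dvd A i k" if "k \<in> K" for i k
  proof -
    have "[A i k = (\<Sum>e<L k. p ^ i * M k e)] (mod (q - 1))"
      unfolding A_def using R_cong that by (intro cong_sum) auto
    moreover have "(q - 1) dvd (\<Sum>e<L k. p ^ i * M k e)"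
      unfolding sum_distrib_left[symmetric] using dvd_A[OF that] by simp
    ultimately show ?thesis using cong_dvd_iff by blast
  qed
  have Cr_dvd: "(q - 1) dvd Cr i l" for i l
  proof -
    have "[Cr i l = (\<Sum>k\<in>K. \<Sum>e<L k. p ^ i * M k e * w k e l)] (mod (q - 1))"
      unfolding Cr_def using R_cong by (intro cong_sum cong_scalar_right) auto
    moreover have "(q - 1) dvd (\<Sum>k\<in>K. \<Sum>e<L k. p ^ i * M k e * w k e l)"
      unfolding mult.assoc sum_distrib_left[symmetric] using dvd_C[of l] by simp
    ultimately show ?thesis using cong_dvd_iff by blast
  qed
  have A_\<alpha>: "A i k = (q - 1) * \<alpha> i k" if "k \<in> K" for i k
    using A_dvd[OF that] by (simp add: \<alpha>_def)
  have R_pos: "R i k e > 0" if ke: "k \<in> K" "e < L k" and M0: "M k e > 0" for i k e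
  proof -
    have "(\<Sum>j<h. p ^ j * dg k e j) \<noteq> 0" using dg[OF ke] M0 by simp
    then obtain j where j: "j < h" "dg k e j > 0" by (metis (no_types, lifting) lessThan_iff mult_0_right neq0_conv sum.neutral)
    have "dg k e j * p ^ ((j + i) mod h) \<le> R i k e"
      unfolding R_def using j by (intro member_le_sum) auto
    moreover have "dg k e j * p ^ ((j + i) mod h) > 0" using j p_pos by simp
    ultimately show ?thesis by linarith
  qed
  have R_0: "R i k e = 0" if ke: "k \<in> K" "e < L k" and M0: "M k e = 0" for i k e
  proof -
    have "(\<Sum>j<h. p ^ j * dg k e j) = 0" using dg[OF ke] M0 by simp
    then have "\<forall>j<h. dg k e j = 0" using p_pos by simp
    then show ?thesis by (simp add: R_def)
  qed
  \<comment> \<open>Fix a rotation. Each variable with \<open>C l \<noteq> 0\<close> has a rotated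
    exponent that is a positive multiple of \<open>q - 1\<close>, while all rotated exponents
    together are at most \<open>(q - 1) * (\<Sum>k\<in>K. \<alpha> i k * D k)\<close>.\<close>
  have step: "c \<le> (\<Sum>k\<in>K. \<alpha> i k - 1) + z" for i
  proof (rule c)
    have "card {l. C l \<noteq> 0} * (q - 1) \<le> (\<Sum>l | C l \<noteq> 0. Cr i l)"
    proof (rule sum_le_card_mult)
      fix l assume "l \<in> {l. C l \<noteq> 0}"
      then have "(\<Sum>k\<in>K. \<Sum>e<L k. M k e * w k e l) \<noteq> 0" by (simp add: C_def)
      then obtain k where k: "k \<in> K" "(\<Sum>e<L k. M k e * w k e l) \<noteq> 0" by (meson sum.neutral)
      then obtain e where e: "e \<in> {..<L k}" "M k e * w k e l \<noteq> 0" by (meson sum.neutral)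
      have "R i k e * w k e l \<le> (\<Sum>e<L k. R i k e * w k e l)" using e by (intro member_le_sum) auto
      also have "\<dots> \<le> Cr i l" unfolding Cr_def using k fin
        by (intro member_le_sum[of k K "\<lambda>k. \<Sum>e<L k. R i k e * w k e l"]) auto
      finally have "Cr i l > 0" using R_pos[OF k(1), of e i] e
        by (metis gr0I lessThan_iff mult_eq_0_iff not_le)
      then show "q - 1 \<le> Cr i l" using Cr_dvd by (intro dvd_imp_le)
    qed simp
    also have "\<dots> \<le> (\<Sum>l\<in>UNIV. Cr i l)" by (intro sum_mono2) auto
    also have "\<dots> = (\<Sum>k\<in>K. \<Sum>e<L k. R i k e * (\<Sum>l\<in>UNIV. w k e l))"
    proof -
      have "(\<Sum>l\<in>UNIV. Cr i l) = (\<Sum>k\<in>K. \<Sum>l\<in>UNIV. \<Sum>e<L k. R i k e * w k e l)"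
        unfolding Cr_def by (rule sum.swap)
      also have "\<dots> = (\<Sum>k\<in>K. \<Sum>e<L k. \<Sum>l\<in>UNIV. R i k e * w k e l)"
        by (rule sum.cong[OF refl], rule sum.swap)
      finally show ?thesis by (simp only: sum_distrib_left)
    qed
    also have "\<dots> \<le> (\<Sum>k\<in>K. \<Sum>e<L k. R i k e * D k)" using deg by (intro sum_mono mult_le_mono2) auto
    also have "\<dots> = (\<Sum>k\<in>K. (q - 1) * (\<alpha> i k * D k))"
      using A_\<alpha> unfolding A_def sum_distrib_right[symmetric] by (simp add: mult.assoc)
    also have "\<dots> = (\<Sum>k\<in>K. \<alpha> i k * D k) * (q - 1)" by (simp add: sum_distrib_left mult.commute)
    finally have "card {l. C l \<noteq> 0} \<le> (\<Sum>k\<in>K. \<alpha> i k * D k)" using q1 by simp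
    \<comment> \<open>One \<open>D k\<close> is set aside, and in each of the other
      \<open>\<alpha> i k - 1\<close> copies \<open>D k\<close> is bounded by \<open>Dm\<close>.
      Truncated subtraction is harmless, as the left side is 0 for
      \<open>\<alpha> i k = 0\<close>.\<close>
    also have "\<dots> \<le> (\<Sum>k\<in>K. D k + Dm * (\<alpha> i k - 1))"
    proof (rule sum_mono)
      fix k assume "k \<in> K"
      then have "(\<alpha> i k - 1) * D k \<le> (\<alpha> i k - 1) * Dm" using Dm by simp
      then show "\<alpha> i k * D k \<le> D k + Dm * (\<alpha> i k - 1)" by (cases "\<alpha> i k") (auto simp: mult.commute)
    qed
    also have "\<dots> = (\<Sum>k\<in>K. D k) + Dm * (\<Sum>k\<in>K. \<alpha> i k - 1)" by (simp add: sum.distrib sum_distrib_left)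
    finally have n': "card {l. C l \<noteq> 0} \<le> (\<Sum>k\<in>K. D k) + Dm * (\<Sum>k\<in>K. \<alpha> i k - 1)" .
    have "CARD('n) = card ({l. C l \<noteq> 0} \<union> {l. C l = 0})" by (rule arg_cong[where f = card]) auto
    also have "\<dots> = card {l. C l \<noteq> 0} + z" unfolding z_def by (rule card_Un_disjoint) auto
    \<comment> \<open>\<open>Dm \<ge> 1\<close> lets the \<open>z\<close> absent variables count in
      the factor of \<open>Dm\<close>, next to the \<open>\<alpha> i k - 1\<close>.\<close>
    also have "\<dots> \<le> card {l. C l \<noteq> 0} + Dm * z" using Dm(2) by simp
    finally show "CARD('n) \<le> (\<Sum>k\<in>K. D k) + Dm * ((\<Sum>k\<in>K. \<alpha> i k - 1) + z)"
      using n' by (simp add: distrib_left)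
  qed
  \<comment> \<open>Over all rotations every digit meets each power of \<open>p\<close> once, so the
    \<open>\<alpha> i k\<close> add up to the digit sum divided by \<open>p - 1\<close>. If some
    exponent is positive, every \<open>\<alpha> i k\<close> is at least 1, and the subtracted ones
    add up to the \<open>h\<close> in the hypothesis on \<open>m\<close>. Otherwise all
    \<open>\<alpha> i k\<close> are 0.\<close>
  have \<alpha>_m: "(\<Sum>i<h. \<alpha> i k - 1) \<le> m k" if k: "k \<in> K" for k
  proof (cases "\<forall>e<L k. M k e = 0")
    case True
    then have "\<alpha> i k = 0" for i using R_0[OF k] by (simp add: \<alpha>_def A_def)
    then show ?thesis by simp
  next
    case False
    then obtain e where e: "e < L k" "M k e > 0" by auto
    have \<alpha>1: "\<alpha> i k \<ge> 1" for i
    proof -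
      have "R i k e \<le> A i k" unfolding A_def using e by (intro member_le_sum) auto
      then have "A i k > 0" using R_pos[OF k e, of i] by linarith
      then show ?thesis using A_\<alpha>[OF k, of i] by (cases "\<alpha> i k") (auto simp: One_nat_def)
    qed
    have "(q - 1) * (\<Sum>i<h. \<alpha> i k) = (\<Sum>i<h. A i k)" using A_\<alpha>[OF k] by (simp add: sum_distrib_left)
    also have "\<dots> = (\<Sum>e<L k. \<Sum>i<h. \<Sum>j<h. dg k e j * p ^ ((j + i) mod h))"
      unfolding A_def R_def by (rule sum.swap)
    also have "\<dots> = (\<Sum>e<L k. \<Sum>j<h. \<Sum>i<h. dg k e j * p ^ ((j + i) mod h))"
      by (rule sum.cong[OF refl], rule sum.swap)
    also have "\<dots> = (\<Sum>e<L k. \<Sum>j<h. dg k e j * (\<Sum>i<h. p ^ i))"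
    proof (intro sum.cong refl)
      fix e j
      have "(\<Sum>i<h. p ^ ((j + i) mod h)) = (\<Sum>i<h. p ^ i)"
        using sum.reindex_bij_betw[OF bij_betw_add_mod[OF h_pos], of "\<lambda>i. p ^ i" j] .
      then show "(\<Sum>i<h. dg k e j * p ^ ((j + i) mod h)) = dg k e j * (\<Sum>i<h. p ^ i)"
        by (simp only: sum_distrib_left[symmetric])
    qed
    also have "\<dots> = (\<Sum>e<L k. \<Sum>j<h. dg k e j) * (\<Sum>i<h. p ^ i)"
      by (simp only: sum_distrib_right)
    also have "\<dots> \<le> (m k + h) * (p - 1) * (\<Sum>i<h. p ^ i)"
      using m[OF k] by (intro mult_le_mono1)
    also have "\<dots> = (q - 1) * (m k + h)" using sum_p_power by (simp add: mult.assoc mult.commute)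
    finally have "(\<Sum>i<h. \<alpha> i k) \<le> m k + h" using q1 by simp
    moreover have "(\<Sum>i<h. \<alpha> i k) = (\<Sum>i<h. \<alpha> i k - 1) + h"
    proof -
      have "(\<Sum>i<h. \<alpha> i k) = (\<Sum>i<h. (\<alpha> i k - 1) + 1)" using \<alpha>1 by (intro sum.cong) auto
      also have "\<dots> = (\<Sum>i<h. \<alpha> i k - 1) + h" unfolding sum.distrib by simp
      finally show ?thesis .
    qed
    ultimately show ?thesis by linarith
  qed
  have "h * c = (\<Sum>i<h. c)" by simp
  also have "\<dots> \<le> (\<Sum>i<h. (\<Sum>k\<in>K. \<alpha> i k - 1) + z)" by (intro sum_mono step)
  also have "\<dots> = (\<Sum>k\<in>K. \<Sum>i<h. \<alpha> i k - 1) + h * z"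
    unfolding sum.distrib by (subst sum.swap) simp
  also have "\<dots> \<le> (\<Sum>k\<in>K. m k) + h * z" using \<alpha>_m by (intro add_right_mono sum_mono)
  finally show ?thesis unfolding z_def C_def .
qed

section \<open>Counting Teichmueller points\<close>

definition Tn :: "('n \<Rightarrow> 'a) set" where "Tn = {X. \<forall>l. X l \<in> T}"

lemma Tn_PiE: "Tn = UNIV \<rightarrow>\<^sub>E T"
  by (auto simp: Tn_def PiE_def)

lemma finite_Tn: "finite (Tn :: ('n::finite \<Rightarrow> 'a) set)"
  unfolding Tn_PiE by (intro finite_PiE) auto

lemma sum_Tn_monomial:
  "(\<Sum>X\<in>Tn. \<Prod>l\<in>UNIV. X l ^ C l) = (\<Prod>l\<in>UNIV. \<Sum>x\<in>T. x ^ C (l::'n::finite))"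
  unfolding Tn_PiE by (rule prod_sum_PiE[symmetric]) auto

lemma dv_sum_Tn_monomial: "dv (h * card {l. C l = 0}) (\<Sum>X\<in>Tn. \<Prod>l\<in>UNIV. X l ^ C (l::'n::finite))"
proof -
  have "dv (\<Sum>l\<in>UNIV. if C l = 0 then h else 0) (\<Prod>l\<in>UNIV. \<Sum>x\<in>T. x ^ C l)"
  proof (rule dv_prod)
    fix l
    show "dv (if C l = 0 then h else 0) (\<Sum>x\<in>T. x ^ C l)"
      using dv_of_nat_iff[of h q] by (auto simp: sum_T_power q_def intro!: dv_sum dv_power_0 T_dv)
  qed
  also have "(\<Sum>l\<in>UNIV. if C l = 0 then h else 0) = h * card {l. C l = 0}"
    by (simp add: sum.If_cases)
  finally show ?thesis by (simp add: sum_Tn_monomial)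
qed

lemma sum_Tn_monomial_eq_0:
  assumes "\<not> (q - 1) dvd C l" shows "(\<Sum>X\<in>Tn. \<Prod>l\<in>UNIV. X l ^ C (l::'n::finite)) = 0"
proof -
  have "(\<Sum>x\<in>T. x ^ C l) = 0" using assms by (auto simp: sum_T_power)
  then show ?thesis unfolding sum_Tn_monomial by (intro prod_zero) auto
qed

text \<open>After expanding the indicators and summing over \<open>X\<close>, a family
  \<open>M\<close> of exponents contributes only if \<open>q - 1\<close> divides the total index for
  each \<open>k\<close> and the exponent of each variable. For these,
  \<open>digit_weight_bound\<close> combines the valuations of the coefficients and of the power
  sums. The hypothesis \<open>c\<close> says without division that \<open>c\<close> is at most the
  starred ceiling of \<open>(CARD('n) - (\<Sum>k\<in>K. D k)) / Dm\<close>.\<close>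

lemma ax_katz:
  fixes K :: "'k set" and L :: "'k \<Rightarrow> nat" and a :: "'k \<Rightarrow> nat \<Rightarrow> 'a"
    and w :: "'k \<Rightarrow> nat \<Rightarrow> 'n::finite \<Rightarrow> nat" and D :: "'k \<Rightarrow> nat"
  assumes fin: "finite K"
    and aT: "\<And>k e. k \<in> K \<Longrightarrow> e < L k \<Longrightarrow> a k e \<in> T"
    and deg: "\<And>k e. k \<in> K \<Longrightarrow> e < L k \<Longrightarrow> (\<Sum>l\<in>UNIV. w k e l) \<le> D k"
    and Dm: "\<And>k. k \<in> K \<Longrightarrow> D k \<le> Dm" "Dm \<ge> 1"
    and c: "\<And>b. CARD('n) \<le> (\<Sum>k\<in>K. D k) + Dm * b \<Longrightarrow> c \<le> b"
  shows "p ^ (h * c) dvd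
    card {X \<in> Tn. \<forall>k\<in>K. dv 1 (\<Sum>e<L k. a k e * (\<Prod>l\<in>UNIV. X l ^ w k e l))}"
proof -
  define t where "t k e X = a k e * (\<Prod>l\<in>UNIV. X l ^ w k e l)" for k e X
  define G where "G k \<mu> = \<Lambda> (\<Prod>e<L k. gs (\<mu> e))" for k and \<mu> :: "nat \<Rightarrow> nat"
  define P where "P k = {..<L k} \<rightarrow>\<^sub>E {..<q}" for k
  define C where "C M l = (\<Sum>k\<in>K. \<Sum>e<L k. M k e * w k e l)" for M l
  have tT: "t k e X \<in> T" if "X \<in> Tn" "k \<in> K" "e < L k" for k e X
    unfolding t_def using that aT by (intro T_mult T_prod T_power) (auto simp: Tn_def)
  have finP: "finite (P k)" for k unfolding P_def by (intro finite_PiE) auto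
  have "of_nat (card {X \<in> Tn. \<forall>k\<in>K. dv 1 (\<Sum>e<L k. t k e X)}) =
    (\<Sum>X\<in>Tn. of_bool (\<forall>k\<in>K. dv 1 (\<Sum>e<L k. t k e X)) :: 'a)"
    by (simp add: of_bool_def sum.If_cases finite_Tn Int_def)
  also have "\<dots> = (\<Sum>X\<in>Tn. \<Prod>k\<in>K. of_bool (dv 1 (\<Sum>e<L k. t k e X)))"
  proof (rule sum.cong[OF refl])
    fix X :: "'n \<Rightarrow> 'a"
    show "(of_bool (\<forall>k\<in>K. dv 1 (\<Sum>e<L k. t k e X)) :: 'a) =
      (\<Prod>k\<in>K. of_bool (dv 1 (\<Sum>e<L k. t k e X)))"
      using fin by (induction K rule: finite_induct) auto
  qed
  also have "\<dots> = (\<Sum>X\<in>Tn. \<Prod>k\<in>K. \<Sum>\<mu>\<in>P k. G k \<mu> * (\<Prod>e<L k. t k e X ^ \<mu> e))"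
    unfolding P_def G_def using tT by (intro sum.cong prod.cong refl of_bool_dv_sum_expand) auto
  also have "\<dots> = (\<Sum>X\<in>Tn. \<Sum>M\<in>PiE K P. \<Prod>k\<in>K. G k (M k) * (\<Prod>e<L k. t k e X ^ M k e))"
    using fin finP by (intro sum.cong refl prod_sum_PiE)
  also have "\<dots> = (\<Sum>M\<in>PiE K P. \<Sum>X\<in>Tn. \<Prod>k\<in>K. G k (M k) * (\<Prod>e<L k. t k e X ^ M k e))"
    by (rule sum.swap)
  also have "\<dots> = (\<Sum>M\<in>PiE K P. (\<Prod>k\<in>K. G k (M k)) * ((\<Prod>k\<in>K. \<Prod>e<L k. a k e ^ M k e) *
      (\<Sum>X\<in>Tn. \<Prod>l\<in>UNIV. X l ^ C M l)))"
  proof (rule sum.cong[OF refl])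
    fix M
    have "(\<Prod>k\<in>K. \<Prod>e<L k. t k e X ^ M k e) =
      (\<Prod>k\<in>K. \<Prod>e<L k. a k e ^ M k e) * (\<Prod>l\<in>UNIV. X l ^ C M l)" for X
    proof -
      have "(\<Prod>k\<in>K. \<Prod>e<L k. t k e X ^ M k e) =
        (\<Prod>k\<in>K. \<Prod>e<L k. a k e ^ M k e) * (\<Prod>k\<in>K. \<Prod>e<L k. \<Prod>l\<in>UNIV. X l ^ (M k e * w k e l))"
        by (simp add: t_def power_mult_distrib prod.distrib prod_power_distrib power_mult[symmetric] mult.commute)
      also have "(\<Prod>k\<in>K. \<Prod>e<L k. \<Prod>l\<in>UNIV. X l ^ (M k e * w k e l)) =
        (\<Prod>k\<in>K. \<Prod>l\<in>UNIV. \<Prod>e<L k. X l ^ (M k e * w k e l))"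
        by (rule prod.cong[OF refl], rule prod.swap)
      also have "\<dots> = (\<Prod>l\<in>UNIV. \<Prod>k\<in>K. \<Prod>e<L k. X l ^ (M k e * w k e l))" by (rule prod.swap)
      also have "\<dots> = (\<Prod>l\<in>UNIV. X l ^ C M l)" by (simp add: C_def power_sum)
      finally show ?thesis .
    qed
    then show "(\<Sum>X\<in>Tn. \<Prod>k\<in>K. G k (M k) * (\<Prod>e<L k. t k e X ^ M k e)) =
      (\<Prod>k\<in>K. G k (M k)) * ((\<Prod>k\<in>K. \<Prod>e<L k. a k e ^ M k e) * (\<Sum>X\<in>Tn. \<Prod>l\<in>UNIV. X l ^ C M l))"
      by (simp add: prod.distrib sum_distrib_left)
  qed
  finally have eq: "of_nat (card {X \<in> Tn. \<forall>k\<in>K. dv 1 (\<Sum>e<L k. t k e X)}) = \<dots>" .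
  have "dv (h * c) \<dots>"
  proof (rule dv_sum)
    fix M assume M: "M \<in> PiE K P"
    then have Mq: "M k e < q" if "k \<in> K" "e < L k" for k e
      using that by (auto simp: P_def PiE_iff Pi_iff)
    show "dv (h * c) ((\<Prod>k\<in>K. G k (M k)) * ((\<Prod>k\<in>K. \<Prod>e<L k. a k e ^ M k e) *
      (\<Sum>X\<in>Tn. \<Prod>l\<in>UNIV. X l ^ C M l)))"
    proof (cases "(\<forall>k\<in>K. (q - 1) dvd (\<Sum>e<L k. M k e)) \<and> (\<forall>l. (q - 1) dvd C M l)")
      case False
      then consider k where "k \<in> K" "\<not> (q - 1) dvd (\<Sum>e<L k. M k e)" | l where "\<not> (q - 1) dvd C M l" by auto
      then show ?thesis
      proof cases
        case 1
        then have "G k (M k) = 0" unfolding G_def by (intro \<Lambda>_prod_gs_eq_0)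
        then have "(\<Prod>k\<in>K. G k (M k)) = 0" using 1 fin by auto
        then show ?thesis by simp
      next
        case 2
        then show ?thesis by (simp add: sum_Tn_monomial_eq_0)
      qed
    next
      case True
      have "\<exists>m. dv m (G k (M k)) \<and> (\<Sum>e<L k. \<Sum>j<h. dig (M k e) j) \<le> (m + h) * (p - 1)" if "k \<in> K" for k
        unfolding G_def using Mq[OF that] by (intro dv_\<Lambda>_prod_gs) auto
      then obtain m where m: "\<And>k. k \<in> K \<Longrightarrow> dv (m k) (G k (M k))"
        "\<And>k. k \<in> K \<Longrightarrow> (\<Sum>e<L k. \<Sum>j<h. dig (M k e) j) \<le> (m k + h) * (p - 1)" by metis
      have "h * c \<le> (\<Sum>k\<in>K. m k) + h * card {l. (\<Sum>k\<in>K. \<Sum>e<L k. M k e * w k e l) = 0}"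
        by (rule digit_weight_bound[OF fin deg Dm c, where dg = "\<lambda>k e. dig (M k e)"])
           (use m True Mq dig(1) in \<open>auto simp: C_def\<close>)
      also have "{l. (\<Sum>k\<in>K. \<Sum>e<L k. M k e * w k e l) = 0} = {l. C M l = 0}" by (simp only: C_def)
      finally have le: "h * c \<le> (\<Sum>k\<in>K. m k) + h * card {l. C M l = 0}" .
      have "dv ((\<Sum>k\<in>K. m k) + h * card {l. C M l = 0}) ((\<Prod>k\<in>K. G k (M k)) *
        ((\<Prod>k\<in>K. \<Prod>e<L k. a k e ^ M k e) * (\<Sum>X\<in>Tn. \<Prod>l\<in>UNIV. X l ^ C M l)))"
        using m(1) aT
        by (intro dv_mult dv_prod dv_mult_left dv_sum_Tn_monomial dv_prod_0 dv_power_0 T_dv) auto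
      then show ?thesis using le by (rule dv_antimono)
    qed
  qed
  then have "dv (h * c) (of_nat (card {X \<in> Tn. \<forall>k\<in>K. dv 1 (\<Sum>e<L k. t k e X)}))"
    unfolding eq[symmetric] .
  then show ?thesis unfolding dv_of_nat_iff t_def .
qed

end

subsection \<open>Homogeneous integral combinations\<close>

text \<open>Values of forms of degree \<open>D\<close> with integer coefficients at elements of
  \<open>Z\<close>. Over the ring of functions of \<open>X\<close> it records that a carry is built
  from products of \<open>D\<close> given functions; over the field it gives integrality.\<close>

inductive hom_span :: "'r::comm_ring_1 set \<Rightarrow> nat \<Rightarrow> 'r \<Rightarrow> bool" for Z D where
  zero: "hom_span Z D 0"
| add: "hom_span Z D x \<Longrightarrow> hom_span Z D y \<Longrightarrow> hom_span Z D (x + y)"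
| uminus: "hom_span Z D x \<Longrightarrow> hom_span Z D (- x)"
| monom: "set zs \<subseteq> Z \<Longrightarrow> length zs = D \<Longrightarrow> hom_span Z D (prod_list zs)"

lemma hom_span_gen: "z \<in> Z \<Longrightarrow> hom_span Z 1 z"
  using hom_span.monom[of "[z]" Z 1] by simp

lemma hom_span_one: "hom_span Z 0 1"
  using hom_span.monom[of "[]" Z 0] by simp

lemma hom_span_mult:
  assumes "hom_span Z D x" "hom_span Z E y" shows "hom_span Z (D + E) (x * y)"
  using assms(1)
proof induction
  case (monom zs)
  from assms(2) show ?case
  proof induction
    case (monom zs')
    then show ?case using hom_span.monom[of "zs @ zs'" Z "D + E"] \<open>set zs \<subseteq> Z\<close> \<open>length zs = D\<close> by simp
  qed (auto simp: distrib_left intro: hom_span.intros)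
qed (auto simp: distrib_right intro: hom_span.intros)

lemma hom_span_sum: "(\<And>i. i \<in> I \<Longrightarrow> hom_span Z D (f i)) \<Longrightarrow> hom_span Z D (sum f I)"
  by (induction I rule: infinite_finite_induct) (auto intro: hom_span.intros)

lemma hom_span_sum_list: "(\<And>z. z \<in> set zs \<Longrightarrow> hom_span Z D (f z)) \<Longrightarrow> hom_span Z D (\<Sum>z\<leftarrow>zs. f z)"
  by (induction zs) (auto intro: hom_span.intros)

lemma hom_span_of_nat: "hom_span Z D x \<Longrightarrow> hom_span Z D (of_nat n * x)"
  by (induction n) (auto simp: distrib_right intro: hom_span.intros)

lemma hom_span_power: "hom_span Z D x \<Longrightarrow> hom_span Z (n * D) (x ^ n)"
  by (induction n) (auto simp: hom_span_one intro: hom_span_mult)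

text \<open>In the binomial expansion of \<open>(y + p ^ a * Q) ^ p\<close> the term
  \<open>i = 1\<close> has a further \<open>p\<close> from the binomial coefficient, and the terms
  \<open>i \<ge> 2\<close> have \<open>a * i \<ge> a + 1\<close>.\<close>

lemma hom_span_p_power_diff:
  fixes x y :: "'r::comm_ring_1"
  assumes "a \<ge> 1" "p \<ge> 2" "hom_span Z D y" "hom_span Z D Q" "x = y + of_nat p ^ a * Q"
  shows "\<exists>Q'. hom_span Z (p * D) Q' \<and> x ^ p - y ^ p = of_nat p ^ Suc a * Q'"
proof -
  define c where "c i = (if i = 1 then 1 else (p choose i) * p ^ (a * i - Suc a))" for i
  define Q' where "Q' = (\<Sum>i\<in>{1..p}. of_nat (c i) * (Q ^ i * y ^ (p - i)))"
  have c: "(p choose i) * p ^ (a * i) = p ^ Suc a * c i" if "i \<ge> 1" for i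
  proof (cases "i = 1")
    case False
    then have "a * 2 \<le> a * i" using that by (intro mult_le_mono2) auto
    then have "Suc a \<le> a * i" using assms(1) by linarith
    then have "p ^ Suc a * p ^ (a * i - Suc a) = p ^ (a * i)" by (simp only: power_add[symmetric] le_add_diff_inverse)
    then show ?thesis using False by (simp add: c_def mult.left_commute)
  qed (simp add: c_def)
  have "hom_span Z (p * D) (Q ^ i * y ^ (p - i))" if "i \<in> {1..p}" for i
  proof -
    have "i * D + (p - i) * D = p * D" using that by (simp flip: distrib_right)
    then show ?thesis
      using hom_span_mult[OF hom_span_power[OF assms(4), of i] hom_span_power[OF assms(3), of "p - i"]] by simp
  qed
  then have "hom_span Z (p * D) Q'" unfolding Q'_def by (intro hom_span_sum hom_span_of_nat)
  moreover have "x ^ p - y ^ p = of_nat p ^ Suc a * Q'"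
  proof -
    have "{..p} = insert 0 {1..p}" by auto
    then have "(of_nat p ^ a * Q + y) ^ p =
      y ^ p + (\<Sum>i = 1..p. of_nat (p choose i) * (of_nat p ^ a * Q) ^ i * y ^ (p - i))"
      by (simp add: binomial_ring)
    also have "(\<Sum>i = 1..p. of_nat (p choose i) * (of_nat p ^ a * Q) ^ i * y ^ (p - i)) = of_nat p ^ Suc a * Q'"
      unfolding Q'_def sum_distrib_left
    proof (rule sum.cong[OF refl])
      fix i assume "i \<in> {1..p}"
      then have "(p choose i) * p ^ (a * i) = p ^ Suc a * c i" by (intro c) simp
      then have e: "of_nat (p choose i) * of_nat p ^ (a * i) = (of_nat p ^ Suc a * of_nat (c i) :: 'r)"
        by (metis of_nat_mult of_nat_power)
      have "of_nat (p choose i) * (of_nat p ^ a * Q) ^ i * y ^ (p - i) =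
        (of_nat (p choose i) * of_nat p ^ (a * i)) * (Q ^ i * y ^ (p - i))"
        by (simp only: power_mult_distrib power_mult mult.assoc)
      then show "of_nat (p choose i) * (of_nat p ^ a * Q) ^ i * y ^ (p - i) =
        of_nat p ^ Suc a * (of_nat (c i) * (Q ^ i * y ^ (p - i)))"
        unfolding e by (simp only: mult.assoc)
    qed
    finally show ?thesis using assms(5) by (simp add: add.commute)
  qed
  ultimately show ?thesis by blast
qed

lemma hom_span_freshman:
  fixes zs :: "'r::comm_ring_1 list"
  assumes "prime p"
  shows "\<exists>Q. hom_span (set zs) p Q \<and> sum_list zs ^ p - (\<Sum>z\<leftarrow>zs. z ^ p) = of_nat p * Q"
proof -
  \<comment> \<open>Fixing a superset \<open>Z\<close> as generating set lets the form of the
    shorter list be reused in the induction.\<close>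
  have "\<exists>Q. hom_span Z p Q \<and> sum_list zs ^ p - (\<Sum>z\<leftarrow>zs. z ^ p) = of_nat p * Q"
    if "set zs \<subseteq> Z" for Z
    using that
  proof (induction zs)
    case Nil
    then show ?case using prime_gt_0_nat[OF assms] by (intro exI[of _ 0]) (auto intro: hom_span.zero simp: zero_power)
  next
    case (Cons z zs)
    then obtain Q where Q: "hom_span Z p Q" "sum_list zs ^ p - (\<Sum>z\<leftarrow>zs. z ^ p) = of_nat p * Q" by auto
    define s where "s = sum_list zs"
    have hz: "hom_span Z 1 z" using Cons.prems by (intro hom_span_gen) auto
    have "hom_span Z 1 (\<Sum>z\<leftarrow>zs. z)" using Cons.prems by (intro hom_span_sum_list hom_span_gen) auto
    then have hs: "hom_span Z 1 s" by (simp add: s_def)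
    define Q' where "Q' = (\<Sum>i\<in>{1..p - 1}. of_nat ((p choose i) div p) * (z ^ i * s ^ (p - i)))"
    have p0: "p > 1" using prime_gt_1_nat[OF assms] .
    have "hom_span Z p (z ^ i * s ^ (p - i))" if i: "i \<in> {1..p - 1}" for i
    proof -
      have "i * 1 + (p - i) * 1 = p" using i p0 unfolding atLeastAtMost_iff mult_1_right by linarith
      then show ?thesis using hom_span_mult[OF hom_span_power[OF hz, of i] hom_span_power[OF hs, of "p - i"]] by simp
    qed
    then have hQ': "hom_span Z p Q'" unfolding Q'_def by (intro hom_span_sum hom_span_of_nat)
    have "{..p} = insert 0 (insert p {1..p - 1})" using p0 by auto
    then have "(z + s) ^ p = s ^ p + (z ^ p + (\<Sum>i = 1..p - 1. of_nat (p choose i) * z ^ i * s ^ (p - i)))"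
      using p0 by (simp add: binomial_ring)
    also have "(\<Sum>i = 1..p - 1. of_nat (p choose i) * z ^ i * s ^ (p - i)) = of_nat p * Q'"
      unfolding Q'_def sum_distrib_left
    proof (rule sum.cong[OF refl])
      fix i assume i: "i \<in> {1..p - 1}"
      then have "p dvd (p choose i)" using assms p0 by (intro dvd_choose_prime) auto
      then have "of_nat (p choose i) = (of_nat p * of_nat ((p choose i) div p) :: 'r)"
        by (metis dvd_mult_div_cancel of_nat_mult)
      then show "of_nat (p choose i) * z ^ i * s ^ (p - i) = of_nat p * (of_nat ((p choose i) div p) * (z ^ i * s ^ (p - i)))"
        by (simp only: mult.assoc)
    qed
    finally have "sum_list (z # zs) ^ p - (\<Sum>z\<leftarrow>z # zs. z ^ p) = of_nat p * (Q + Q')"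
      using Q(2) by (simp add: s_def algebra_simps)
    then show ?case using Q(1) hQ' by (intro exI[of _ "Q + Q'"]) (auto intro: hom_span.add)
  qed
  then show ?thesis by blast
qed

text \<open>The congruence behind the ghost components of Witt vectors, with a homogeneous quotient.
  Each passage to the \<open>p\<close>-th power, starting from the case \<open>a = 1\<close>, gains
  one more factor \<open>p\<close>.\<close>

lemma hom_span_witt:
  fixes zs :: "'r::comm_ring_1 list"
  assumes "prime p" "a \<ge> 1"
  shows "\<exists>Q. hom_span (set zs) (p ^ a) Q \<and>
    sum_list zs ^ (p ^ a) - (\<Sum>z\<leftarrow>zs. z ^ p) ^ (p ^ (a - 1)) = of_nat p ^ a * Q"
  using assms(2)
proof (induction a rule: dec_induct)
  case base
  then show ?case using hom_span_freshman[OF assms(1), of zs] by simp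
next
  case (step a)
  then obtain Q where Q: "hom_span (set zs) (p ^ a) Q"
    "sum_list zs ^ (p ^ a) - (\<Sum>z\<leftarrow>zs. z ^ p) ^ (p ^ (a - 1)) = of_nat p ^ a * Q" by blast
  have "hom_span (set zs) (p * 1) (z ^ p)" if "z \<in> set zs" for z
    using that by (intro hom_span_power hom_span_gen)
  then have "hom_span (set zs) p (\<Sum>z\<leftarrow>zs. z ^ p)" by (intro hom_span_sum_list) simp
  then have "hom_span (set zs) (p ^ (a - 1) * p) ((\<Sum>z\<leftarrow>zs. z ^ p) ^ (p ^ (a - 1)))" by (rule hom_span_power)
  moreover have "p ^ (a - 1) * p = p ^ a" using step(1) by (cases a) auto
  ultimately have y: "hom_span (set zs) (p ^ a) ((\<Sum>z\<leftarrow>zs. z ^ p) ^ (p ^ (a - 1)))" by simp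
  have "sum_list zs ^ (p ^ a) = (\<Sum>z\<leftarrow>zs. z ^ p) ^ (p ^ (a - 1)) + of_nat p ^ a * Q"
    using Q(2) by (simp add: algebra_simps)
  from hom_span_p_power_diff[OF step(1) prime_ge_2_nat[OF assms(1)] y Q(1) this]
  obtain Q' where Q': "hom_span (set zs) (p * p ^ a) Q'"
    "(sum_list zs ^ (p ^ a)) ^ p - ((\<Sum>z\<leftarrow>zs. z ^ p) ^ (p ^ (a - 1))) ^ p = of_nat p ^ Suc a * Q'" by blast
  have e: "p ^ a = p ^ (a - 1) * p" using step(1) by (cases a) auto
  have "(sum_list zs ^ (p ^ a)) ^ p = sum_list zs ^ (p ^ Suc a)"
    by (simp add: power_mult[symmetric] mult.commute)
  moreover have "((\<Sum>z\<leftarrow>zs. z ^ p) ^ (p ^ (a - 1))) ^ p = (\<Sum>z\<leftarrow>zs. z ^ p) ^ (p ^ (Suc a - 1))"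
    by (simp only: power_mult[symmetric] e[symmetric] diff_Suc_1)
  ultimately show ?case using Q' by auto
qed

lemma power_fun_apply: "((f :: 'x \<Rightarrow> 'r::comm_ring_1) ^ n) x = f x ^ n"
  by (induction n) auto

lemma sum_list_fun_apply: "sum_list (fs :: ('x \<Rightarrow> 'r::comm_ring_1) list) x = (\<Sum>f\<leftarrow>fs. f x)"
  by (induction fs) auto

lemma prod_list_fun_apply: "prod_list (fs :: ('x \<Rightarrow> 'r::comm_ring_1) list) x = (\<Prod>f\<leftarrow>fs. f x)"
  by (induction fs) auto

context unram
begin

subsection \<open>Reduction of congruences modulo prime powers\<close>

text \<open>Carrying from level \<open>0\<close> to level \<open>v\<close> multiplies degrees by \<open>p ^ v\<close>, but the carries are forms
  in the \<open>p ^ v\<close>-th roots of the original terms; hence the \<open>v\<close> Frobenius twists.\<close>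

definition twisted_monom :: "nat \<Rightarrow> nat \<Rightarrow> (('n::finite \<Rightarrow> 'a) \<Rightarrow> 'a) set" where
  "twisted_monom d v = {t. (\<forall>X\<in>Tn. t X \<in> T) \<and> (\<exists>c\<in>T. \<exists>w. (\<Sum>l\<in>UNIV. w l) \<le> d * p ^ v \<and>
     (\<forall>X\<in>Tn. t X ^ (p ^ v) = c * (\<Prod>l\<in>UNIV. X l ^ w l)))}"

text \<open>The level \<open>v\<close> ties the power of \<open>p\<close> in front to the admissible
  degree \<open>d * p ^ v\<close>, the invariant kept under carrying. \<open>v0\<close> bounds the
  levels of the terms from below, and \<open>m\<close> is the precision beyond which
  \<open>small\<close> forgets the shape of a function.\<close>

inductive filt :: "nat \<Rightarrow> nat \<Rightarrow> nat \<Rightarrow> (('n::finite \<Rightarrow> 'a) \<Rightarrow> 'a) \<Rightarrow> bool" for d m v0 where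
  small: "(\<And>X. X \<in> Tn \<Longrightarrow> dv m (F X)) \<Longrightarrow> filt d m v0 F"
| monom: "t \<in> twisted_monom d v \<Longrightarrow> v0 \<le> v \<Longrightarrow> filt d m v0 (\<lambda>X. of_nat p ^ v * t X)"
| add: "filt d m v0 F \<Longrightarrow> filt d m v0 G \<Longrightarrow> filt d m v0 (\<lambda>X. F X + G X)"

lemma twisted_monom_T: "t \<in> twisted_monom d v \<Longrightarrow> X \<in> Tn \<Longrightarrow> t X \<in> T"
  by (simp add: twisted_monom_def)

lemma filt_dv:
  assumes "filt d m v0 F" "v0 \<le> m" "X \<in> Tn" shows "dv v0 (F X)"
  using assms
proof induction
  case (small F)
  then show ?case using dv_antimono by blast
next
  case (monom t v)
  have "dv (v + 0) (of_nat p ^ v * t X)"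
    using monom by (intro dv_p_power_mult T_dv twisted_monom_T)
  then show ?case using dv_antimono[of v _ v0] monom(2) by simp
qed (auto intro: dv_add)

lemma filt_dv_0: "filt d m v0 F \<Longrightarrow> X \<in> Tn \<Longrightarrow> dv 0 (F X)"
proof (induction rule: filt.induct)
  case (small F)
  then show ?case using dv_antimono[of m _ 0] by simp
next
  case (monom t v)
  then show ?case by (intro dv_mult_0 dv_power_0 dv_of_nat T_dv twisted_monom_T)
qed (auto intro: dv_add)

lemma filt_cong:
  assumes "filt d m v0 F" "\<And>X. X \<in> Tn \<Longrightarrow> dv m (F X - G X)" shows "filt d m v0 G"
proof -
  have "filt d m v0 (\<lambda>X. F X + (G X - F X))"
    by (rule filt.add[OF assms(1) filt.small]) (rule dv_cong_sym, rule assms(2))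
  then show ?thesis by simp
qed

lemma filt_of_nat_mult: "filt d m v0 F \<Longrightarrow> filt d m v0 (\<lambda>X. of_nat n * F X)"
proof (induction n)
  case 0
  show ?case by (rule filt.small) simp
next
  case (Suc n)
  then have "filt d m v0 (\<lambda>X. F X + of_nat n * F X)" by (intro filt.add)
  then show ?case by (simp add: distrib_right)
qed

text \<open>Minus one need not be a Teichmueller representative, but it is congruent to \<open>p ^ m - 1\<close>.\<close>

lemma filt_uminus:
  assumes "filt d m v0 F" shows "filt d m v0 (\<lambda>X. - F X)"
proof (rule filt_cong)
  show "filt d m v0 (\<lambda>X. of_nat (p ^ m - 1) * F X)" using assms by (rule filt_of_nat_mult)
  fix X :: "'b \<Rightarrow> 'a" assume X: "X \<in> Tn"
  have "of_nat (p ^ m - 1) * F X - - F X = of_nat p ^ m * F X"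
    using p_pos by (simp add: of_nat_diff One_nat_def Suc_leI left_diff_distrib)
  moreover have "dv (m + 0) (of_nat p ^ m * F X)"
    by (intro dv_p_power_mult filt_dv_0[OF assms X])
  ultimately show "dv m (of_nat (p ^ m - 1) * F X - - F X)" by simp
qed

lemma filt_sum:
  "(\<And>i. i \<in> I \<Longrightarrow> filt d m v0 (F i)) \<Longrightarrow> filt d m v0 (\<lambda>X. \<Sum>i\<in>I. F i X)"
proof (induction I rule: infinite_finite_induct)
  case (insert i I)
  then have "filt d m v0 (\<lambda>X. F i X + (\<Sum>i\<in>I. F i X))" by (intro filt.add) auto
  then show ?case using insert by simp
qed (auto intro: filt.small)

lemma filt_split:
  assumes "filt d m v0 F"
  shows "\<exists>ts F1. set ts \<subseteq> twisted_monom d v0 \<and> filt d m (Suc v0) F1 \<and>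
    (\<forall>X\<in>Tn. F X = of_nat p ^ v0 * (\<Sum>t\<leftarrow>ts. t X) + F1 X)"
  using assms
proof induction
  case (small F)
  then show ?case by (intro exI[of _ "[]"] exI[of _ F]) (auto intro: filt.small)
next
  case (monom t v)
  show ?case
  proof (cases "v = v0")
    case True
    then show ?thesis using monom by (intro exI[of _ "[t]"] exI[of _ "\<lambda>X. 0"]) (auto intro: filt.small)
  next
    case False
    then have "filt d m (Suc v0) (\<lambda>X. of_nat p ^ v * t X)" using monom by (intro filt.monom) auto
    then show ?thesis by (intro exI[of _ "[]"] exI[of _ "\<lambda>X. of_nat p ^ v * t X"]) auto
  qed
next
  case (add F G)
  then obtain ts F1 us G1 where
    "set ts \<subseteq> twisted_monom d v0" "filt d m (Suc v0) F1" "\<forall>X\<in>Tn. F X = of_nat p ^ v0 * (\<Sum>t\<leftarrow>ts. t X) + F1 X"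
    "set us \<subseteq> twisted_monom d v0" "filt d m (Suc v0) G1" "\<forall>X\<in>Tn. G X = of_nat p ^ v0 * (\<Sum>t\<leftarrow>us. t X) + G1 X"
    by blast
  then show ?case
    by (intro exI[of _ "ts @ us"] exI[of _ "\<lambda>X. F1 X + G1 X"]) (auto simp: algebra_simps intro: filt.add)
qed

text \<open>On \<open>T\<close> the power \<open>q ^ a\<close> is the identity, so the exponent
  \<open>p ^ (h * a - a)\<close> extracts a \<open>p ^ a\<close>-th root; \<open>h \<ge> 1\<close>
  makes the subtraction exact.\<close>

lemma T_power_untwist: "x \<in> T \<Longrightarrow> (x ^ (p ^ (h * a - a))) ^ (p ^ a) = x"
proof -
  assume x: "x \<in> T"
  have "a \<le> h * a" using h_pos by simp
  then have "p ^ (h * a - a) * p ^ a = q ^ a" by (simp add: q_def flip: power_add power_mult)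
  then show ?thesis using T_power_q_power[OF x, of a] by (simp add: power_mult[symmetric])
qed

text \<open>Each factor is a \<open>p ^ a\<close>-th root of a function of level \<open>v\<close>,
  so its \<open>p ^ (v + a)\<close>-th power is a monomial of degree at most
  \<open>d * p ^ v\<close>. The \<open>p ^ a\<close> factors together reach
  \<open>d * p ^ (v + a)\<close>, the bound of level \<open>v + a\<close>.\<close>

lemma twisted_monom_prod_list:
  assumes "set zs \<subseteq> (\<lambda>t X. t X ^ (p ^ (h * a - a))) ` twisted_monom d v" "length zs = p ^ a"
  shows "prod_list zs \<in> twisted_monom d (v + a)"
proof -
  have "(\<forall>X\<in>Tn. (\<Prod>z\<leftarrow>zs. z X) \<in> T) \<and> (\<exists>c\<in>T. \<exists>w. (\<Sum>l\<in>UNIV. w l) \<le> length zs * (d * p ^ v) \<and>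
     (\<forall>X\<in>Tn. (\<Prod>z\<leftarrow>zs. z X) ^ (p ^ (v + a)) = c * (\<Prod>l\<in>UNIV. X l ^ w l)))"
    using assms(1)
  proof (induction zs)
    case Nil
    show ?case by (auto intro!: bexI[of _ 1] exI[of _ "\<lambda>_. 0"])
  next
    case (Cons z zs)
    then obtain c w where cw: "c \<in> T" "(\<Sum>l\<in>UNIV. w l) \<le> length zs * (d * p ^ v)"
      "\<forall>X\<in>Tn. (\<Prod>z\<leftarrow>zs. z X) ^ (p ^ (v + a)) = c * (\<Prod>l\<in>UNIV. X l ^ w l)"
      and T: "\<forall>X\<in>Tn. (\<Prod>z\<leftarrow>zs. z X) \<in> T" by auto
    obtain t where t: "t \<in> twisted_monom d v" "z = (\<lambda>X. t X ^ (p ^ (h * a - a)))" using Cons.prems by auto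
    then obtain c' w' where cw': "c' \<in> T" "(\<Sum>l\<in>UNIV. w' l) \<le> d * p ^ v"
      "\<forall>X\<in>Tn. t X ^ (p ^ v) = c' * (\<Prod>l\<in>UNIV. X l ^ w' l)"
      unfolding twisted_monom_def by auto
    have "z X ^ (p ^ (v + a)) = c' * (\<Prod>l\<in>UNIV. X l ^ w' l)" if "X \<in> Tn" for X
    proof -
      have "z X ^ (p ^ (v + a)) = ((t X ^ (p ^ (h * a - a))) ^ (p ^ a)) ^ (p ^ v)"
        unfolding t(2) power_mult[symmetric] power_add by (simp only: mult_ac)
      then show ?thesis using T_power_untwist[OF twisted_monom_T[OF t(1) that]] cw'(3) that by simp
    qed
    then have "(\<Prod>z\<leftarrow>z # zs. z X) ^ (p ^ (v + a)) = (c' * c) * (\<Prod>l\<in>UNIV. X l ^ (w' l + w l))" if "X \<in> Tn" for X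
      using cw(3) that by (simp add: power_mult_distrib power_add prod.distrib)
    moreover have "(\<Sum>l\<in>UNIV. w' l + w l) \<le> length (z # zs) * (d * p ^ v)"
      using cw(2) cw'(2) by (simp add: sum.distrib)
    moreover have "c' * c \<in> T" using cw(1) cw'(1) by (rule T_mult[rotated])
    moreover have "\<forall>X\<in>Tn. (\<Prod>z\<leftarrow>z # zs. z X) \<in> T"
      using T twisted_monom_T[OF t(1)] unfolding t(2) by (auto intro: T_mult T_power)
    ultimately show ?case by blast
  qed
  moreover have "length zs * (d * p ^ v) = d * p ^ (v + a)" using assms(2) by (simp add: power_add)
  ultimately show ?thesis unfolding twisted_monom_def prod_list_fun_apply by simp
qed

lemma filt_hom_span:
  assumes "hom_span (set (map (\<lambda>t X. t X ^ (p ^ (h * a - a))) ts)) (p ^ a) Q"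
    "set ts \<subseteq> twisted_monom d v" "v0 \<le> v + a"
  shows "filt d m v0 (\<lambda>X. of_nat p ^ (v + a) * Q X)"
  using assms(1)
proof induction
  case zero
  show ?case by (rule filt.small) simp
next
  case (add x y)
  then have "filt d m v0 (\<lambda>X. of_nat p ^ (v + a) * x X + of_nat p ^ (v + a) * y X)" by (intro filt.add)
  then show ?case by (simp add: distrib_left)
next
  case (uminus x)
  then show ?case using filt_uminus by fastforce
next
  case (monom zs)
  then have "prod_list zs \<in> twisted_monom d (v + a)"
    using assms(2) by (intro twisted_monom_prod_list) auto
  then show ?case using assms(3) by (rule filt.monom)
qed

lemma dv_1_power_iff: "n > 0 \<Longrightarrow> dv 1 (x ^ n) \<longleftrightarrow> dv 1 x"
  unfolding dv_1_iff av_power using power_less_one_iff[of "av x" n] by simp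

text \<open>Let \<open>s a\<close> be the \<open>p ^ a\<close>-th power of the sum of the
  \<open>p ^ a\<close>-th roots of the \<open>t X\<close>. The difference of
  \<open>s (a + 1)\<close> and \<open>s a\<close> is \<open>p ^ (a + 1)\<close> times a form in the
  roots, so it contributes at level \<open>v + a + 1\<close>. If \<open>p\<close> divides the sum of
  the \<open>t X\<close>, it divides \<open>s m\<close>, hence the sum of the roots, and then
  \<open>s m\<close> is divisible by \<open>p ^ (p ^ m)\<close> and vanishes modulo
  \<open>p ^ m\<close>. Only the carries remain, with a minus sign.\<close>

lemma filt_step:
  assumes "set ts \<subseteq> twisted_monom d v" "filt d m (Suc v) F1"
  shows "\<exists>F'. filt d m (Suc v) F' \<and>
    (\<forall>X\<in>Tn. dv 1 (\<Sum>t\<leftarrow>ts. t X) \<longrightarrow> dv m (of_nat p ^ v * (\<Sum>t\<leftarrow>ts. t X) + F1 X - F' X))"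
proof -
  define zs where "zs a = map (\<lambda>t X. t X ^ (p ^ (h * a - a))) ts" for a
  define s where "s a X = (\<Sum>t\<leftarrow>ts. t X ^ (p ^ (h * a - a))) ^ (p ^ a)" for a X
  have "\<exists>Q. a \<ge> 1 \<longrightarrow> hom_span (set (zs a)) (p ^ a) Q \<and>
    sum_list (zs a) ^ (p ^ a) - (\<Sum>z\<leftarrow>zs a. z ^ p) ^ (p ^ (a - 1)) = of_nat p ^ a * Q" for a
    using hom_span_witt[OF prime_p, of a "zs a"] by blast
  then obtain Q where Q: "\<And>a. a \<ge> 1 \<Longrightarrow> hom_span (set (zs a)) (p ^ a) (Q a)"
    "\<And>a. a \<ge> 1 \<Longrightarrow> sum_list (zs a) ^ (p ^ a) - (\<Sum>z\<leftarrow>zs a. z ^ p) ^ (p ^ (a - 1)) = of_nat p ^ a * Q a"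
    by metis
  have step: "s (Suc a) X - s a X = of_nat p ^ Suc a * Q (Suc a) X" if X: "X \<in> Tn" for a X
  proof -
    have "(sum_list (zs (Suc a)) ^ (p ^ Suc a) - (\<Sum>z\<leftarrow>zs (Suc a). z ^ p) ^ (p ^ a)) X =
      (of_nat p ^ Suc a * Q (Suc a)) X" using Q(2)[of "Suc a"] by (simp add: One_nat_def)
    then have "(\<Sum>t\<leftarrow>ts. t X ^ (p ^ (h * Suc a - Suc a))) ^ (p ^ Suc a) -
        (\<Sum>t\<leftarrow>ts. (t X ^ (p ^ (h * Suc a - Suc a))) ^ p) ^ (p ^ a) = of_nat p ^ Suc a * Q (Suc a) X"
      by (simp only: minus_apply times_fun_apply power_fun_apply of_nat_fun_apply sum_list_fun_apply
            zs_def map_map o_def)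
    moreover have "(\<Sum>t\<leftarrow>ts. (t X ^ (p ^ (h * Suc a - Suc a))) ^ p) = (\<Sum>t\<leftarrow>ts. t X ^ (p ^ (h * a - a)))"
    proof (intro arg_cong[where f = sum_list] map_cong refl)
      fix t assume t: "t \<in> set ts"
      have "a \<le> h * a" using h_pos by simp
      then have "h * Suc a - Suc a + 1 = h + (h * a - a)" using h_pos unfolding mult_Suc_right by linarith
      then have "p ^ (h * Suc a - Suc a) * p = q * p ^ (h * a - a)"
        unfolding q_def power_add[symmetric] by (metis power_add power_one_right)
      then have "(t X ^ (p ^ (h * Suc a - Suc a))) ^ p = (t X ^ q) ^ (p ^ (h * a - a))"
        by (simp only: power_mult[symmetric])
      also have "t X ^ q = t X" using twisted_monom_T[of t d v X] assms(1) t X by (auto simp: T_iff)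
      finally show "(t X ^ (p ^ (h * Suc a - Suc a))) ^ p = t X ^ (p ^ (h * a - a))" .
    qed
    ultimately show ?thesis by (simp only: s_def)
  qed
  have tele: "s a X = s 0 X + (\<Sum>i<a. of_nat p ^ Suc i * Q (Suc i) X)" if "X \<in> Tn" for a X
  proof (induction a)
    case (Suc a)
    then show ?case using step[OF that, of a] by (simp add: algebra_simps)
  qed simp
  have Qf: "filt d m v' (\<lambda>X. of_nat p ^ (v + Suc i) * Q (Suc i) X)" if "v' \<le> v + Suc i" for i m v'
    using Q(1)[of "Suc i"] that assms(1) unfolding zs_def by (intro filt_hom_span) (auto simp: One_nat_def)
  define F' where "F' X = F1 X + - (\<Sum>i<m. of_nat p ^ (v + Suc i) * Q (Suc i) X)" for X
  have "filt d m (Suc v) F'"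
    unfolding F'_def by (intro filt.add assms(2) filt_uminus filt_sum Qf) simp
  moreover have "dv m (of_nat p ^ v * (\<Sum>t\<leftarrow>ts. t X) + F1 X - F' X)"
    if X: "X \<in> Tn" and d: "dv 1 (\<Sum>t\<leftarrow>ts. t X)" for X
  proof -
    have tm: "s m X = (\<Sum>t\<leftarrow>ts. t X) + (\<Sum>i<m. of_nat p ^ Suc i * Q (Suc i) X)"
      using tele[OF X, of m] by (simp add: s_def)
    \<comment> \<open>Integrality of the form is read off from its place in the filtration, at
      precision \<open>v + Suc i\<close>.\<close>
    have Qd: "dv 0 (Q (Suc i) X)" for i
    proof -
      have "dv (v + Suc i) (of_nat p ^ (v + Suc i) * Q (Suc i) X)"
        using filt_dv[OF Qf[of "v + Suc i" i "v + Suc i"] _ X] by simp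
      then show ?thesis using dv_p_power_mult_iff[of "v + Suc i" 0] by simp
    qed
    have "dv 1 (of_nat p ^ Suc i * Q (Suc i) X)" for i
      using dv_p_power_mult[OF Qd[of i], of "Suc i"] by (rule dv_antimono) (simp add: One_nat_def)
    then have "dv 1 (\<Sum>i<m. of_nat p ^ Suc i * Q (Suc i) X)" by (intro dv_sum)
    then have "dv 1 (s m X)" unfolding tm by (intro dv_add d)
    then have "dv 1 (\<Sum>t\<leftarrow>ts. t X ^ (p ^ (h * m - m)))"
      unfolding s_def using p_pos by (subst (asm) dv_1_power_iff) auto
    then have "dv (p ^ m * 1) (s m X)" unfolding s_def by (rule dv_power)
    moreover have "m \<le> p ^ m * 1" using less_exp[of m] power_mono[of 2 p m] p_gt_1 by linarith
    ultimately have sm: "dv m (s m X)" by (rule dv_antimono)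
    have "of_nat p ^ v * (\<Sum>t\<leftarrow>ts. t X) + F1 X - F' X = of_nat p ^ v * s m X"
      unfolding tm F'_def distrib_left sum_distrib_left power_add by (simp only: mult.assoc) simp
    moreover have "dv m (of_nat p ^ v * s m X)" by (intro dv_mult_left sm dv_power_0 dv_of_nat)
    ultimately show ?thesis by simp
  qed
  ultimately show ?thesis by blast
qed

text \<open>Divisibility of \<open>F X\<close> by \<open>p ^ m\<close> with \<open>v0 < m\<close>
  forces the sum of level \<open>v0\<close> to vanish modulo \<open>p\<close>, as the other terms
  are divisible by \<open>p ^ (v0 + 1)\<close>; once it does, \<open>F\<close> may be exchanged for
  a function of level \<open>v0 + 1\<close>. The induction descends from \<open>v0 = m\<close>,
  where divisibility is automatic.\<close>

lemma filt_reduce: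
  assumes "filt d m v0 F" "v0 \<le> m"
  shows "\<exists>ts. (\<forall>v\<in>{v0..<m}. set (ts v) \<subseteq> twisted_monom d v) \<and>
    (\<forall>X\<in>Tn. dv m (F X) \<longleftrightarrow> (\<forall>v\<in>{v0..<m}. dv 1 (\<Sum>t\<leftarrow>ts v. t X)))"
  using assms(2,1)
proof (induction v0 arbitrary: F rule: inc_induct)
  case base
  then show ?case using filt_dv by fastforce
next
  case (step v0)
  obtain ts F1 where ts: "set ts \<subseteq> twisted_monom d v0" "filt d m (Suc v0) F1"
    "\<forall>X\<in>Tn. F X = of_nat p ^ v0 * (\<Sum>t\<leftarrow>ts. t X) + F1 X" using filt_split[OF step.prems] by blast
  obtain F' where F': "filt d m (Suc v0) F'" 
    "\<forall>X\<in>Tn. dv 1 (\<Sum>t\<leftarrow>ts. t X) \<longrightarrow> dv m (of_nat p ^ v0 * (\<Sum>t\<leftarrow>ts. t X) + F1 X - F' X)"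
    using filt_step[OF ts(1,2)] by blast
  obtain us where us: "\<forall>v\<in>{Suc v0..<m}. set (us v) \<subseteq> twisted_monom d v"
    "\<forall>X\<in>Tn. dv m (F' X) \<longleftrightarrow> (\<forall>v\<in>{Suc v0..<m}. dv 1 (\<Sum>t\<leftarrow>us v. t X))"
    using step.IH[OF F'(1)] by blast
  have iv: "{v0..<m} = insert v0 {Suc v0..<m}" using step.hyps by auto
  have nec: "dv 1 (\<Sum>t\<leftarrow>ts. t X)" if X: "X \<in> Tn" and d: "dv m (F X)" for X
  proof -
    have "dv (Suc v0) (F X)" using d step.hyps by (auto elim: dv_antimono)
    moreover have "dv (Suc v0) (F1 X)" using filt_dv[OF ts(2) _ X] step.hyps by auto
    ultimately have "dv (Suc v0) (F X - F1 X)" by (rule dv_diff)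
    then have "dv (v0 + 1) (of_nat p ^ v0 * (\<Sum>t\<leftarrow>ts. t X))" using ts(3) X by (simp add: One_nat_def)
    then show ?thesis by (simp only: dv_p_power_mult_iff)
  qed
  have eq: "dv m (F X) \<longleftrightarrow> dv m (F' X)" if "X \<in> Tn" "dv 1 (\<Sum>t\<leftarrow>ts. t X)" for X
    using F'(2) ts(3) that dv_cong_iff[of m "F X" "F' X"] by simp
  define vs where "vs = us(v0 := ts)"
  have vs: "(\<forall>v\<in>{v0..<m}. R v (vs v)) \<longleftrightarrow> R v0 ts \<and> (\<forall>v\<in>{Suc v0..<m}. R v (us v))" for R
    unfolding iv vs_def by simp
  have "dv m (F X) \<longleftrightarrow> (\<forall>v\<in>{v0..<m}. dv 1 (\<Sum>t\<leftarrow>vs v. t X))" if "X \<in> Tn" for X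
    unfolding vs[of "\<lambda>_ l. dv 1 (\<Sum>t\<leftarrow>l. t X)"] using us(2) nec eq that by blast
  moreover have "\<forall>v\<in>{v0..<m}. set (vs v) \<subseteq> twisted_monom d v"
    unfolding vs[of "\<lambda>v l. set l \<subseteq> twisted_monom d v"] using us(1) ts(1) by blast
  ultimately show ?case by blast
qed

section \<open>From twisted monomials to polynomials modulo \<open>p\<close>\<close>

lemma freshman_dv: 
  assumes "\<And>x. x \<in> set xs \<Longrightarrow> dv 0 x" shows "dv 1 (sum_list xs ^ p - (\<Sum>x\<leftarrow>xs. x ^ p))"
proof -
  obtain Q where Q: "hom_span (set xs) p Q" "sum_list xs ^ p - (\<Sum>x\<leftarrow>xs. x ^ p) = of_nat p * Q"
    using hom_span_freshman[OF prime_p] by blast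
  have pl: "dv 0 (prod_list zs)" if "set zs \<subseteq> set xs" for zs
    using that assms by (induction zs) (auto intro!: dv_mult_0)
  have "dv 0 Q" if "hom_span (set xs) D Q" for D Q
    using that by induction (auto intro: dv_add pl)
  from this[OF Q(1)] show ?thesis unfolding Q(2) by (intro dv_mult_right dv_p)
qed

lemma dv_1_sum_list_twist:
  assumes "\<And>x. x \<in> set xs \<Longrightarrow> dv 0 x"
  shows "dv 1 (sum_list xs) \<longleftrightarrow> dv 1 (\<Sum>x\<leftarrow>xs. x ^ (p ^ v))"
proof (induction v)
  case (Suc v)
  have "dv 1 ((\<Sum>x\<leftarrow>xs. x ^ (p ^ v)) ^ p - (\<Sum>y\<leftarrow>map (\<lambda>x. x ^ (p ^ v)) xs. y ^ p))"
    using assms by (intro freshman_dv) (auto intro: dv_power_0)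
  moreover have "map ((\<lambda>y. y ^ p) \<circ> (\<lambda>x. x ^ (p ^ v))) xs = map (\<lambda>x. x ^ (p ^ Suc v)) xs"
    by (simp add: o_def power_mult[symmetric] mult.commute)
  ultimately have "dv 1 ((\<Sum>x\<leftarrow>xs. x ^ (p ^ v)) ^ p - (\<Sum>x\<leftarrow>xs. x ^ (p ^ Suc v)))" by simp
  then show ?case using Suc dv_cong_iff dv_1_power_iff[OF p_pos] by blast
qed simp

text \<open>Modulo \<open>p\<close> a sum vanishes exactly when the sum of the
  \<open>p ^ v\<close>-th powers does, and these powers are genuine monomials with coefficients in
  \<open>T\<close>.\<close>

lemma twisted_monom_untwist:
  assumes "set ts \<subseteq> twisted_monom d v"
  shows "\<exists>(L::nat) a w. (\<forall>e<L. a e \<in> T \<and> (\<Sum>l\<in>UNIV. w e l) \<le> d * p ^ v) \<and>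
    (\<forall>X\<in>Tn. dv 1 (\<Sum>t\<leftarrow>ts. t X) \<longleftrightarrow> dv 1 (\<Sum>e<L. a e * (\<Prod>l\<in>UNIV. X l ^ w e l)))"
proof -
  define P where "P e c w \<longleftrightarrow> (e < length ts \<longrightarrow> c \<in> T \<and> (\<Sum>l\<in>UNIV. w l) \<le> d * p ^ v \<and>
     (\<forall>X\<in>Tn. (ts ! e) X ^ (p ^ v) = c * (\<Prod>l\<in>UNIV. X l ^ w l)))" for e c w
  have "\<exists>c w. P e c w" for e
  proof (cases "e < length ts")
    case True
    then have "ts ! e \<in> twisted_monom d v" using assms by auto
    then show ?thesis unfolding twisted_monom_def P_def by blast
  qed (auto simp: P_def)
  then obtain c w where "\<And>e. P e (c e) (w e)" by metis
  then have cw: "\<And>e. e < length ts \<Longrightarrow> c e \<in> T \<and> (\<Sum>l\<in>UNIV. w e l) \<le> d * p ^ v \<and>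
     (\<forall>X\<in>Tn. (ts ! e) X ^ (p ^ v) = c e * (\<Prod>l\<in>UNIV. X l ^ w e l))" unfolding P_def by blast
  have "dv 1 (\<Sum>t\<leftarrow>ts. t X) \<longleftrightarrow> dv 1 (\<Sum>e<length ts. c e * (\<Prod>l\<in>UNIV. X l ^ w e l))" if X: "X \<in> Tn" for X
  proof -
    have "dv 0 (t X)" if "t \<in> set ts" for t
      using that assms X by (intro T_dv twisted_monom_T[of t d v]) auto
    then have "dv 1 (\<Sum>t\<leftarrow>ts. t X) \<longleftrightarrow> dv 1 (\<Sum>x\<leftarrow>map (\<lambda>t. t X) ts. x ^ (p ^ v))"
      by (intro dv_1_sum_list_twist) auto
    also have "(\<Sum>x\<leftarrow>map (\<lambda>t. t X) ts. x ^ (p ^ v)) = (\<Sum>e<length ts. (ts ! e) X ^ (p ^ v))"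
      by (simp add: sum_list_sum_nth atLeast0LessThan)
    also have "\<dots> = (\<Sum>e<length ts. c e * (\<Prod>l\<in>UNIV. X l ^ w e l))"
      using cw X by (intro sum.cong) auto
    finally show ?thesis .
  qed
  then show ?thesis using cw by (intro exI[of _ "length ts"] exI[of _ c] exI[of _ w]) blast
qed

end

subsection \<open>Polynomials on boxes\<close>

lemma ev_scale_right: "ev (\<lambda>y. \<phi> y * a) z = ev \<phi> z * a"
  by (simp only: ev_def sum_distrib_right mult.assoc)

lemma mpoly_eval_eq_ev:
  "mpoly_eval P X = ev (\<lambda>u. \<Prod>j\<in>UNIV. X j ^ Poly_Mapping.lookup u j) P"
  by (simp add: mpoly_eval_def ev_def)

lemma mpoly_eval_mult:
  fixes P Q :: "('n::finite, 'a::comm_ring_1) mpoly"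
  shows "mpoly_eval (P * Q) X = mpoly_eval P X * mpoly_eval Q X"
  unfolding mpoly_eval_eq_ev ev_mult lookup_add power_add prod.distrib
  by (simp only: ev_scale_right ev_scale mult.commute)

lemma mpoly_eval_one: "mpoly_eval (1 :: ('n::finite, 'a::comm_ring_1) mpoly) X = 1"
  unfolding mpoly_eval_eq_ev by simp

lemma mpoly_eval_prod:
  "mpoly_eval (prod P I :: ('n::finite, 'a::comm_ring_1) mpoly) X = (\<Prod>i\<in>I. mpoly_eval (P i) X)"
  by (induction I rule: infinite_finite_induct) (auto simp: mpoly_eval_mult mpoly_eval_one)

lemma mpoly_eval_monomial:
  "mpoly_eval (monomial_poly a u :: ('n::finite, 'a::comm_ring_1) mpoly) X =
    a * (\<Prod>j\<in>UNIV. X j ^ Poly_Mapping.lookup u j)"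
  unfolding mpoly_eval_eq_ev monomial_poly_def by simp

lemma mpoly_eval_sum:
  "mpoly_eval (sum P I :: ('n::finite, 'a::comm_ring_1) mpoly) X = (\<Sum>i\<in>I. mpoly_eval (P i) X)"
  unfolding mpoly_eval_eq_ev by (rule ev_sum)

lemma lookup_eq_ev: "Poly_Mapping.lookup z k = ev (\<lambda>x. of_bool (x = k)) z"
  by (auto simp: ev_def of_bool_def if_distrib in_keys_iff sum.delta cong: if_cong)

lemma degree_le_total_degree:
  fixes P :: "('n::finite, 'a::zero) mpoly"
  assumes "u \<in> Poly_Mapping.keys P"
  shows "(\<Sum>j\<in>UNIV. Poly_Mapping.lookup u j) \<le> total_degree P"
  unfolding total_degree_def using assms by (intro Max_ge) auto

context unram
begin

definition ipolys :: "('n::finite, 'a) mpoly set" where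
  "ipolys = {P. \<forall>u. dv 0 (Poly_Mapping.lookup P u)}"

lemma ipolys_ev: "P \<in> ipolys \<Longrightarrow> (\<And>x. dv 0 (\<phi> x)) \<Longrightarrow> dv 0 (ev \<phi> P)"
  unfolding ipolys_def ev_def by (intro dv_sum dv_mult_0) auto

lemma ipolys_mult: "P \<in> ipolys \<Longrightarrow> Q \<in> ipolys \<Longrightarrow> P * Q \<in> ipolys"
  unfolding ipolys_def mem_Collect_eq lookup_eq_ev[of "P * Q"] ev_mult
  by (intro allI ipolys_ev) (auto simp: ipolys_def of_bool_def)

lemma ipolys_one: "1 \<in> ipolys"
  unfolding ipolys_def by (auto simp: lookup_one when_def)

lemma ipolys_prod: "(\<And>i. i \<in> I \<Longrightarrow> P i \<in> ipolys) \<Longrightarrow> prod P I \<in> ipolys"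
  by (induction I rule: infinite_finite_induct) (auto simp: ipolys_one ipolys_mult)

lemma ipolys_monomial: "dv 0 a \<Longrightarrow> monomial_poly a u \<in> ipolys"
  unfolding ipolys_def monomial_poly_def by (auto simp: lookup_single when_def)

lemma ipolys_teich: "P \<in> polys_over T \<Longrightarrow> P \<in> ipolys"
  unfolding ipolys_def polys_over_def by (auto intro: T_dv)

lemma dv_mpoly_eval: "P \<in> ipolys \<Longrightarrow> (\<And>l. dv 0 (X l)) \<Longrightarrow> dv 0 (mpoly_eval P X)"
  unfolding mpoly_eval_eq_ev by (intro ipolys_ev dv_prod_0 dv_power_0)

lemma p_expansion_dv:
  assumes "p_expansion p av c y" "\<And>i. dv 0 (c i)"
  shows "dv M (y - (\<Sum>i<M. of_nat p ^ i * c i))"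
proof -
  have lim: "\<forall>e>0. \<exists>N. \<forall>n\<ge>N. av ((\<Sum>i<n. of_nat p ^ i * c i) - y) < e"
    using assms(1) unfolding p_expansion_def limitin_av_iff .
  have "(1 / real p) ^ M > 0" using p_pos by simp
  then obtain N where N: "\<forall>n\<ge>N. av ((\<Sum>i<n. of_nat p ^ i * c i) - y) < (1 / real p) ^ M"
    using lim by blast
  define n where "n = M + N"
  have "dv M ((\<Sum>i<n. of_nat p ^ i * c i) - y)" using N[rule_format, of n] by (simp add: dv_def n_def)
  moreover have "dv M ((\<Sum>i<n. of_nat p ^ i * c i) - (\<Sum>i<M. of_nat p ^ i * c i))"
  proof -
    have "{..<n} = {..<M} \<union> {M..<n}" by (auto simp: n_def)
    then have "(\<Sum>i<n. of_nat p ^ i * c i) - (\<Sum>i<M. of_nat p ^ i * c i) = (\<Sum>i\<in>{M..<n}. of_nat p ^ i * c i)"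
      by (simp add: sum.union_disjoint ivl_disj_int)
    moreover have "dv M (of_nat p ^ i * c i)" if "i \<in> {M..<n}" for i
      using dv_p_power_mult[OF assms(2), of i i] that by (auto elim: dv_antimono)
    then have "dv M (\<Sum>i\<in>{M..<n}. of_nat p ^ i * c i)" by (rule dv_sum)
    ultimately show ?thesis by simp
  qed
  ultimately show ?thesis using dv_cong_trans dv_cong_sym by blast
qed

text \<open>Splitting \<open>c\<close> into \<open>\<tau> c\<close> and \<open>p * c'\<close> gives
  a monomial of level \<open>v\<close> with coefficient in \<open>T\<close>, and a remainder of
  level \<open>v + 1\<close>, where the degree bound is no stronger. The former is twisted: the
  factor \<open>q ^ (v div h)\<close> of \<open>p ^ v\<close> acts trivially on \<open>T\<close>,
  and \<open>p ^ (v mod h)\<close> raises the degree bound to \<open>d * p ^ v\<close>.\<close>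

lemma filt_monomial:
  assumes "dv 0 c" "(\<Sum>l\<in>UNIV. w l) \<le> d * p ^ (h * (v div h))"
  shows "filt d m 0 (\<lambda>X. of_nat p ^ v * (c * (\<Prod>l\<in>UNIV. X l ^ w l)))"
  using assms
proof (induction "m - v" arbitrary: v c)
  case 0
  show ?case
  proof (rule filt.small)
    fix X :: "'b \<Rightarrow> 'a" assume X: "X \<in> Tn"
    have "dv (v + 0) (of_nat p ^ v * (c * (\<Prod>l\<in>UNIV. X l ^ w l)))"
      using X 0(2) by (intro dv_p_power_mult dv_mult_0 dv_prod_0 dv_power_0) (auto simp: Tn_def intro: T_dv)
    then show "dv m (of_nat p ^ v * (c * (\<Prod>l\<in>UNIV. X l ^ w l)))"
      by (rule dv_antimono) (use 0(1) in simp)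
  qed
next
  case (Suc n)
  obtain c' where c': "dv 0 c'" "c = \<tau> c + of_nat p * c'"
  proof -
    have "dv 1 (c - \<tau> c)" using \<tau>_cong[OF Suc.prems(1)] by (rule dv_cong_sym)
    then obtain z where "dv 0 z" "c - \<tau> c = of_nat p ^ 1 * z" unfolding dv_iff_ex[of 1] by blast
    then show ?thesis using that[of z] by (simp add: algebra_simps)
  qed
  have "v div h \<le> Suc v div h" by (simp add: div_le_mono)
  then have "d * p ^ (h * (v div h)) \<le> d * p ^ (h * (Suc v div h))"
    using p_pos by (intro mult_le_mono2 power_increasing) auto
  with Suc.prems(2) have "(\<Sum>l\<in>UNIV. w l) \<le> d * p ^ (h * (Suc v div h))" by (rule order_trans)
  then have "filt d m 0 (\<lambda>X. of_nat p ^ Suc v * (c' * (\<Prod>l\<in>UNIV. X l ^ w l)))"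
    using Suc.hyps(2) c'(1) by (intro Suc.hyps(1)) auto
  moreover have "filt d m 0 (\<lambda>X. of_nat p ^ v * (\<tau> c * (\<Prod>l\<in>UNIV. X l ^ w l)))"
  proof (rule filt.monom)
    define r where "r = p ^ (v mod h)"
    have pv: "p ^ v = q ^ (v div h) * r"
      unfolding r_def q_def power_mult[symmetric] power_add[symmetric] by simp
    show "(\<lambda>X. \<tau> c * (\<Prod>l\<in>UNIV. X l ^ w l)) \<in> twisted_monom d v"
      unfolding twisted_monom_def
    proof (intro CollectI conjI ballI bexI exI)
      fix X :: "'b \<Rightarrow> 'a" assume X: "X \<in> Tn"
      show XT: "\<tau> c * (\<Prod>l\<in>UNIV. X l ^ w l) \<in> T"
        using X by (intro T_mult T_prod T_power) (auto simp: Tn_def)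
      show "(\<tau> c * (\<Prod>l\<in>UNIV. X l ^ w l)) ^ (p ^ v) = \<tau> c ^ r * (\<Prod>l\<in>UNIV. X l ^ (w l * r))"
        unfolding pv power_mult T_power_q_power[OF XT] by (simp add: power_mult_distrib prod_power_distrib)
    next
      show "\<tau> c ^ r \<in> T" by (intro T_power) simp
      have "(\<Sum>l\<in>UNIV. w l * r) \<le> d * p ^ (h * (v div h)) * r"
        unfolding sum_distrib_right[symmetric] using Suc.prems(2) by (intro mult_le_mono1)
      also have "\<dots> = d * p ^ v" unfolding pv q_def power_mult by (simp only: mult.assoc)
      finally show "(\<Sum>l\<in>UNIV. w l * r) \<le> d * p ^ v" .
    qed
  qed simp
  ultimately have "filt d m 0 (\<lambda>X. of_nat p ^ v * (\<tau> c * (\<Prod>l\<in>UNIV. X l ^ w l)) +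
     of_nat p ^ Suc v * (c' * (\<Prod>l\<in>UNIV. X l ^ w l)))" by (intro filt.add)
  moreover have "of_nat p ^ v * (\<tau> c * P) + of_nat p ^ Suc v * (c' * P) = of_nat p ^ v * (c * P)" for P
    by (subst (2) c'(2)) (simp add: algebra_simps)
  ultimately show ?case by simp
qed

lemma filt_mpoly:
  assumes "P \<in> ipolys" "total_degree P \<le> d * p ^ (h * (v div h))"
  shows "filt d m 0 (\<lambda>X. of_nat p ^ v * mpoly_eval P X)"
proof -
  have "filt d m 0 (\<lambda>X. \<Sum>u\<in>Poly_Mapping.keys P. of_nat p ^ v *
      (Poly_Mapping.lookup P u * (\<Prod>l\<in>UNIV. X l ^ Poly_Mapping.lookup u l)))"
  proof (intro filt_sum filt_monomial)
    fix u assume "u \<in> Poly_Mapping.keys P"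
    then show "(\<Sum>l\<in>UNIV. Poly_Mapping.lookup u l) \<le> d * p ^ (h * (v div h))"
      using degree_le_total_degree assms(2) order_trans by blast
  qed (use assms(1) in \<open>simp add: ipolys_def\<close>)
  then show ?thesis by (simp add: mpoly_eval_def sum_distrib_left)
qed

lemma mpoly_eval_teich_expansion:
  fixes f :: "('n::finite, 'a) mpoly"
  assumes "teich_expansion p h av f F" "\<And>l. dv 0 (Y l)"
  shows "dv M (mpoly_eval f Y - (\<Sum>i<M. of_nat p ^ i * mpoly_eval (F i) Y))"
proof -
  have F: "dv 0 (Poly_Mapping.lookup (F i) u)" for i u
    using assms(1) unfolding teich_expansion_def polys_over_def by (auto intro: T_dv)
  have ex: "p_expansion p av (\<lambda>i. Poly_Mapping.lookup (F i) u) (Poly_Mapping.lookup f u)" for u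
    using assms(1) unfolding teich_expansion_def by blast
  define A where "A = Poly_Mapping.keys f \<union> (\<Union>i<M. Poly_Mapping.keys (F i))"
  define Yu where "Yu u = (\<Prod>j\<in>UNIV. Y j ^ Poly_Mapping.lookup u j)" for u
  have A: "finite A" "Poly_Mapping.keys f \<subseteq> A" "\<And>i. i < M \<Longrightarrow> Poly_Mapping.keys (F i) \<subseteq> A"
    by (auto simp: A_def)
  have "mpoly_eval f Y = (\<Sum>u\<in>A. Poly_Mapping.lookup f u * Yu u)"
    unfolding mpoly_eval_eq_ev Yu_def by (rule ev_superset[OF A(1,2)])
  moreover have "(\<Sum>i<M. of_nat p ^ i * mpoly_eval (F i) Y) =
    (\<Sum>i<M. of_nat p ^ i * (\<Sum>u\<in>A. Poly_Mapping.lookup (F i) u * Yu u))"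
    unfolding mpoly_eval_eq_ev Yu_def by (intro sum.cong refl) (simp add: ev_superset[OF A(1,3)])
  moreover have "\<dots> = (\<Sum>u\<in>A. (\<Sum>i<M. of_nat p ^ i * Poly_Mapping.lookup (F i) u) * Yu u)"
    unfolding sum_distrib_left sum_distrib_right mult.assoc by (rule sum.swap)
  ultimately have "mpoly_eval f Y - (\<Sum>i<M. of_nat p ^ i * mpoly_eval (F i) Y) =
    (\<Sum>u\<in>A. (Poly_Mapping.lookup f u - (\<Sum>i<M. of_nat p ^ i * Poly_Mapping.lookup (F i) u)) * Yu u)"
    by (simp add: left_diff_distrib sum_subtractf)
  moreover have "dv M \<dots>"
    unfolding Yu_def using F ex assms(2)
    by (intro dv_sum dv_mult_right p_expansion_dv dv_prod_0 dv_power_0) auto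
  ultimately show ?thesis by simp
qed

text \<open>\<open>I\<close> has one slot for each factor of the monomial, with multiplicity.
  Truncating the coordinates of \<open>Y\<close> after \<open>m\<close> terms changes the product by
  a multiple of \<open>p ^ m\<close>, and multiplying out chooses a term \<open>\<beta> x\<close> in
  each slot.\<close>

lemma mpoly_eval_box_expansion:
  fixes g :: "nat \<Rightarrow> 'n::finite \<Rightarrow> ('n, 'a) mpoly" and u :: "'n \<Rightarrow>\<^sub>0 nat"
  assumes g: "\<And>b l. g b l \<in> ipolys"
    and Y: "\<And>l. p_expansion p av (\<lambda>b. mpoly_eval (g b l) X) (Y l)"
    and X: "\<And>l. dv 0 (X l)"
  defines "I \<equiv> Sigma UNIV (\<lambda>l. {1..Poly_Mapping.lookup u l})"
  shows "dv m ((\<Prod>l\<in>UNIV. Y l ^ Poly_Mapping.lookup u l) -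
    (\<Sum>\<beta>\<in>I \<rightarrow>\<^sub>E {..<m}. of_nat p ^ (\<Sum>x\<in>I. \<beta> x) * mpoly_eval (\<Prod>x\<in>I. g (\<beta> x) (fst x)) X))"
    and "\<And>l. dv 0 (Y l)"
proof -
  have gX: "dv 0 (mpoly_eval (g b l) X)" for b l using g X by (rule dv_mpoly_eval)
  show Y0: "dv 0 (Y l)" for l using p_expansion_dv[OF Y gX, of 0 l] by simp
  have finI: "finite I" unfolding I_def by auto
  define y where "y l = (\<Sum>b<m. of_nat p ^ b * mpoly_eval (g b l) X)" for l
  have y0: "dv 0 (y l)" for l unfolding y_def by (intro dv_sum dv_mult_0 gX dv_power_0 dv_of_nat)
  have "(\<Prod>l\<in>UNIV. Y l ^ Poly_Mapping.lookup u l) = (\<Prod>l\<in>UNIV. \<Prod>t\<in>{1..Poly_Mapping.lookup u l}. Y l)"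
    by simp
  also have "\<dots> = (\<Prod>x\<in>I. Y (fst x))"
    unfolding I_def by (subst prod.Sigma) (auto simp: case_prod_beta)
  finally have prodY: "(\<Prod>l\<in>UNIV. Y l ^ Poly_Mapping.lookup u l) = (\<Prod>x\<in>I. Y (fst x))" .
  have "(\<Prod>x\<in>I. y (fst x)) = (\<Sum>\<beta>\<in>I \<rightarrow>\<^sub>E {..<m}. \<Prod>x\<in>I. of_nat p ^ \<beta> x * mpoly_eval (g (\<beta> x) (fst x)) X)"
    unfolding y_def using finI by (intro prod_sum_PiE) auto
  also have "\<dots> = (\<Sum>\<beta>\<in>I \<rightarrow>\<^sub>E {..<m}. of_nat p ^ (\<Sum>x\<in>I. \<beta> x) * mpoly_eval (\<Prod>x\<in>I. g (\<beta> x) (fst x)) X)"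
    by (simp add: prod.distrib power_sum mpoly_eval_prod)
  finally have "(\<Sum>\<beta>\<in>I \<rightarrow>\<^sub>E {..<m}. of_nat p ^ (\<Sum>x\<in>I. \<beta> x) * mpoly_eval (\<Prod>x\<in>I. g (\<beta> x) (fst x)) X) =
    (\<Prod>x\<in>I. y (fst x))" ..
  moreover have "dv m ((\<Prod>x\<in>I. Y (fst x)) - (\<Prod>x\<in>I. y (fst x)))"
  proof (rule dv_cong_prod)
    show "dv m (Y (fst x) - y (fst x))" for x unfolding y_def using Y gX by (rule p_expansion_dv)
  qed (auto intro: Y0 y0)
  ultimately show "dv m ((\<Prod>l\<in>UNIV. Y l ^ Poly_Mapping.lookup u l) -
    (\<Sum>\<beta>\<in>I \<rightarrow>\<^sub>E {..<m}. of_nat p ^ (\<Sum>x\<in>I. \<beta> x) * mpoly_eval (\<Prod>x\<in>I. g (\<beta> x) (fst x)) X))"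
    by (simp add: prodY)
qed

text \<open>Multiplying out the Teichmueller expansion of \<open>f\<close> and the box expansion of
  \<open>Y X\<close> gives terms \<open>p ^ (i + |\<beta>|)\<close> times a polynomial in
  \<open>X\<close>; \<open>deg\<close> bounds its degree as \<open>filt_mpoly\<close> requires at
  level \<open>i + |\<beta>|\<close>.\<close>

lemma filt_mpoly_box:
  fixes g :: "nat \<Rightarrow> 'n::finite \<Rightarrow> ('n, 'a) mpoly" and u :: "nat \<Rightarrow> ('n \<Rightarrow>\<^sub>0 nat)"
  assumes m: "m \<ge> 1"
    and g: "\<And>b l. g b l \<in> ipolys"
    and Y: "\<And>X l. X \<in> Tn \<Longrightarrow> p_expansion p av (\<lambda>b. mpoly_eval (g b l) X) (Y X l)"
    and f: "teich_expansion p h av f F"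
    and F: "\<And>i. F i = (\<Sum>j = 1..r. monomial_poly (a i j) (u j))"
    and a: "\<And>i j. j \<in> {1..r} \<Longrightarrow> a i j \<in> T"
    and deg: "\<And>i j (\<beta> :: 'n \<Rightarrow> nat \<Rightarrow> nat) \<beta>sum.
           i \<le> m - 1 \<Longrightarrow> j \<in> {1..r} \<Longrightarrow>
           \<beta>sum = (\<Sum>l\<in>UNIV. \<Sum>t = 1..Poly_Mapping.lookup (u j) l. \<beta> l t) \<Longrightarrow>
           i + \<beta>sum \<le> m - 1 \<Longrightarrow>
           total_degree (monomial_poly (a i j) 0 *
             (\<Prod>l\<in>UNIV. \<Prod>t = 1..Poly_Mapping.lookup (u j) l. g (\<beta> l t) l))
           \<le> d * p ^ (h * ((i + \<beta>sum) div h))"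
  shows "filt d m 0 (\<lambda>X. mpoly_eval f (Y X))"
proof -
  define I where "I j = Sigma UNIV (\<lambda>l. {1..Poly_Mapping.lookup (u j) l})" for j
  define E where "E j X = (\<Sum>\<beta>\<in>I j \<rightarrow>\<^sub>E {..<m}. of_nat p ^ (\<Sum>x\<in>I j. \<beta> x) *
    mpoly_eval (\<Prod>x\<in>I j. g (\<beta> x) (fst x)) X)" for j X
  have X0: "dv 0 (X l)" if "X \<in> Tn" for X :: "'n \<Rightarrow> 'a" and l using that by (auto simp: Tn_def intro: T_dv)
  have finI: "finite (I j)" for j unfolding I_def by auto
  have summand: "filt d m 0 (\<lambda>X. of_nat p ^ (i + (\<Sum>x\<in>I j. \<beta> x)) *
      mpoly_eval (monomial_poly (a i j) 0 * (\<Prod>x\<in>I j. g (\<beta> x) (fst x))) X)"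
    if ij: "i < m" "j \<in> {1..r}" for i j \<beta>
  proof -
    define P where "P = monomial_poly (a i j) 0 * (\<Prod>x\<in>I j. g (\<beta> x) (fst x))"
    define b where "b = (\<Sum>x\<in>I j. \<beta> x)"
    have P: "P \<in> ipolys"
      unfolding P_def using a ij g by (intro ipolys_mult ipolys_prod ipolys_monomial T_dv) auto
    show ?thesis
    proof (cases "i + b \<le> m - 1")
      case True
      have "(\<Prod>x\<in>I j. g (\<beta> x) (fst x)) = (\<Prod>l\<in>UNIV. \<Prod>t = 1..Poly_Mapping.lookup (u j) l. g (\<beta> (l, t)) l)"
        unfolding I_def by (subst prod.Sigma) (auto simp: case_prod_beta)
      moreover have "b = (\<Sum>l\<in>UNIV. \<Sum>t = 1..Poly_Mapping.lookup (u j) l. \<beta> (l, t))"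
        unfolding b_def I_def by (subst sum.Sigma) (auto simp: case_prod_beta)
      ultimately have "total_degree P \<le> d * p ^ (h * ((i + b) div h))"
        using deg[of i j b "\<lambda>l t. \<beta> (l, t)"] ij True unfolding P_def by auto
      then show ?thesis unfolding P_def[symmetric] b_def[symmetric] by (rule filt_mpoly[OF P])
    next
      \<comment> \<open>Here \<open>i + b \<ge> m\<close>, because \<open>m \<ge> 1\<close> makes
        \<open>m - 1\<close> a genuine predecessor, so the term falls under
        \<open>small\<close>.\<close>
      case False
      show ?thesis unfolding P_def[symmetric] b_def[symmetric]
      proof (rule filt.small)
        fix X :: "'n \<Rightarrow> 'a" assume "X \<in> Tn"
        then have "dv (i + b + 0) (of_nat p ^ (i + b) * mpoly_eval P X)"
          using X0 by (intro dv_p_power_mult dv_mpoly_eval P) auto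
        then show "dv m (of_nat p ^ (i + b) * mpoly_eval P X)" by (rule dv_antimono) (use False m in simp)
      qed
    qed
  qed
  have "filt d m 0 (\<lambda>X. \<Sum>i<m. \<Sum>j = 1..r. \<Sum>\<beta>\<in>I j \<rightarrow>\<^sub>E {..<m}. of_nat p ^ (i + (\<Sum>x\<in>I j. \<beta> x)) *
      mpoly_eval (monomial_poly (a i j) 0 * (\<Prod>x\<in>I j. g (\<beta> x) (fst x))) X)"
    by (intro filt_sum summand) auto
  then show ?thesis
  proof (rule filt_cong)
    fix X :: "'n \<Rightarrow> 'a" assume X: "X \<in> Tn"
    have YX: "dv 0 (Y X l)" for l by (rule mpoly_eval_box_expansion(2)[OF g Y[OF X] X0[OF X]])
    have e1: "(\<Sum>i<m. \<Sum>j = 1..r. \<Sum>\<beta>\<in>I j \<rightarrow>\<^sub>E {..<m}. of_nat p ^ (i + (\<Sum>x\<in>I j. \<beta> x)) *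
      mpoly_eval (monomial_poly (a i j) 0 * (\<Prod>x\<in>I j. g (\<beta> x) (fst x))) X) =
      (\<Sum>i<m. \<Sum>j = 1..r. of_nat p ^ i * (a i j * E j X))"
      unfolding E_def mpoly_eval_mult mpoly_eval_monomial power_add sum_distrib_left
      by (intro sum.cong refl) (simp add: mult_ac)
    have e2: "(\<Sum>i<m. of_nat p ^ i * mpoly_eval (F i) (Y X)) =
      (\<Sum>i<m. \<Sum>j = 1..r. of_nat p ^ i * (a i j * (\<Prod>l\<in>UNIV. Y X l ^ Poly_Mapping.lookup (u j) l)))"
      unfolding F mpoly_eval_sum mpoly_eval_monomial sum_distrib_left ..
    have d1: "dv m ((\<Sum>i<m. \<Sum>j = 1..r. of_nat p ^ i * (a i j * E j X)) -
      (\<Sum>i<m. \<Sum>j = 1..r. of_nat p ^ i * (a i j * (\<Prod>l\<in>UNIV. Y X l ^ Poly_Mapping.lookup (u j) l))))"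
      unfolding sum_subtractf[symmetric] right_diff_distrib[symmetric]
    proof (intro dv_sum dv_mult_left)
      fix i j assume j: "j \<in> {1..r}"
      show "dv 0 (a i j)" using a[OF j] by (rule T_dv)
      show "dv m (E j X - (\<Prod>l\<in>UNIV. Y X l ^ Poly_Mapping.lookup (u j) l))"
        unfolding E_def I_def by (rule dv_cong_sym, rule mpoly_eval_box_expansion(1)[OF g Y[OF X] X0[OF X]])
    qed (auto intro: dv_power_0)
    have d2: "dv m ((\<Sum>i<m. of_nat p ^ i * mpoly_eval (F i) (Y X)) - mpoly_eval f (Y X))"
      using mpoly_eval_teich_expansion[OF f YX] by (rule dv_cong_sym)
    show "dv m ((\<Sum>i<m. \<Sum>j = 1..r. \<Sum>\<beta>\<in>I j \<rightarrow>\<^sub>E {..<m}. of_nat p ^ (i + (\<Sum>x\<in>I j. \<beta> x)) *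
      mpoly_eval (monomial_poly (a i j) 0 * (\<Prod>x\<in>I j. g (\<beta> x) (fst x))) X) - mpoly_eval f (Y X))"
      unfolding e1 by (rule dv_cong_trans[OF d1 d2[unfolded e2]])
  qed
qed


section \<open>Transfer of the count from the box to Teichmueller points\<close>

lemma filt_conditions:
  fixes F :: "('n::finite \<Rightarrow> 'a) \<Rightarrow> 'a"
  assumes "filt d m 0 F"
  shows "\<exists>(L :: nat \<Rightarrow> nat) a w. (\<forall>v<m. \<forall>e<L v. a v e \<in> T \<and> (\<Sum>l\<in>UNIV. w v e l) \<le> d * p ^ v) \<and>
    (\<forall>X\<in>Tn. dv m (F X) \<longleftrightarrow> (\<forall>v<m. dv 1 (\<Sum>e<L v. a v e * (\<Prod>l\<in>UNIV. X l ^ w v e l))))"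
proof -
  obtain ts where ts: "\<forall>v\<in>{0..<m}. set (ts v) \<subseteq> twisted_monom d v"
    "\<forall>X\<in>Tn. dv m (F X) \<longleftrightarrow> (\<forall>v\<in>{0..<m}. dv 1 (\<Sum>t\<leftarrow>ts v. t X))"
    using filt_reduce[OF assms] by blast
  define P where "P v L a w \<longleftrightarrow> (v < m \<longrightarrow> (\<forall>e<L. a e \<in> T \<and> (\<Sum>l\<in>UNIV. w e l) \<le> d * p ^ v) \<and>
    (\<forall>X\<in>Tn. dv 1 (\<Sum>t\<leftarrow>ts v. t X) \<longleftrightarrow> dv 1 (\<Sum>e<L. a e * (\<Prod>l\<in>UNIV. X l ^ w e l))))"
    for v and L :: nat and a and w :: "nat \<Rightarrow> 'n \<Rightarrow> nat"
  have "\<exists>L a w. P v L a w" for v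
  proof (cases "v < m")
    case True
    then show ?thesis unfolding P_def using twisted_monom_untwist[of "ts v" d v] ts(1) by auto
  qed (simp add: P_def)
  then obtain L a w where Law: "\<And>v. P v (L v) (a v) (w v)" by metis
  have "(\<forall>v\<in>{0..<m}. dv 1 (\<Sum>t\<leftarrow>ts v. t X)) \<longleftrightarrow>
    (\<forall>v<m. dv 1 (\<Sum>e<L v. a v e * (\<Prod>l\<in>UNIV. X l ^ w v e l)))" if "X \<in> Tn" for X
    using Law that unfolding P_def by auto
  then show ?thesis using ts(2) Law unfolding P_def
    by (intro exI[of _ L] exI[of _ a] exI[of _ w]) blast
qed

text \<open>Coordinatewise lifting maps \<open>B\<close> onto \<open>Tn\<close>, because the
  reductions of \<open>B\<close> exhaust all classes. Both sets have \<open>q ^ CARD('n)\<close>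
  elements, and \<open>Y\<close> is the inverse map.\<close>

lemma box_parametrization:
  fixes B :: "('n::finite \<Rightarrow> 'a) set"
  assumes "is_box p h av B"
  obtains Y where "bij_betw Y Tn B" "\<And>X l. X \<in> Tn \<Longrightarrow> teich_lift p h av (Y X l) = X l"
proof -
  define \<rho> where "\<rho> Y = (\<lambda>l. teich_lift p h av (Y l))" for Y :: "'n \<Rightarrow> 'a"
  have B0: "dv 0 (Y l)" if "Y \<in> B" for Y l
    using that assms by (auto simp: is_box_def ring_of_integers_def dv_0_iff)
  have cB: "card B = q ^ CARD('n)" using assms by (simp add: is_box_def q_def)
  have finB: "finite B" using cB q_gt_1 by (intro card_ge_0_finite) simp
  have "\<rho> ` B = Tn"
  proof
    show "\<rho> ` B \<subseteq> Tn" using B0 by (auto simp: Tn_def \<rho>_def teich_lift)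
    show "Tn \<subseteq> \<rho> ` B"
    proof
      fix X :: "'n \<Rightarrow> 'a" assume X: "X \<in> Tn"
      have X0: "dv 0 (X l)" for l using X by (auto simp: Tn_def intro: T_dv)
      have "(\<lambda>l. cong_rel p av 1 `` {X l}) \<in> {y. \<forall>j. y j \<in> ring_of_integers av // cong_rel p av 1}"
        using X0 by (auto intro!: quotientI simp: ring_of_integers_def dv_0_iff)
      then have "(\<lambda>l. cong_rel p av 1 `` {X l}) \<in> (\<lambda>Y l. cong_rel p av 1 `` {Y l}) ` B"
        using assms by (simp add: is_box_def)
      then obtain Y where Y: "Y \<in> B" "(\<lambda>l. cong_rel p av 1 `` {X l}) = (\<lambda>l. cong_rel p av 1 `` {Y l})"
        by blast
      have "teich_lift p h av (Y l) = X l" for l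
      proof -
        have "(X l, X l) \<in> cong_rel p av 1" using X0 by (simp add: cong_rel_iff)
        moreover have "cong_rel p av 1 `` {X l} = cong_rel p av 1 `` {Y l}" using Y(2) by meson
        ultimately have "(Y l, X l) \<in> cong_rel p av 1" by blast
        then have "dv 1 (X l - Y l)" using cong_rel_iff dv_cong_sym by blast
        moreover have "X l \<in> T" using X by (simp add: Tn_def)
        ultimately have "\<tau> (Y l) = X l" using B0[OF Y(1)] by (intro \<tau>_eqI)
        then show ?thesis using B0[OF Y(1)] by (simp add: \<tau>_def)
      qed
      then have "\<rho> Y = X" by (simp add: \<rho>_def)
      then show "X \<in> \<rho> ` B" using Y(1) by blast
    qed
  qed
  moreover have "card (Tn :: ('n \<Rightarrow> 'a) set) = card B"
    unfolding Tn_PiE cB by (simp add: card_PiE card_T)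
  ultimately have bij: "bij_betw \<rho> B Tn" using finB by (auto simp: bij_betw_def intro: eq_card_imp_inj_on)
  show ?thesis
  proof (rule that)
    show "bij_betw (inv_into B \<rho>) Tn B" using bij by (rule bij_betw_inv_into)
    show "teich_lift p h av (inv_into B \<rho> X l) = X l" if "X \<in> Tn" for X l
    proof -
      have "\<rho> (inv_into B \<rho> X) = X" using bij that by (simp add: bij_betw_inv_into_right)
      then show ?thesis unfolding \<rho>_def by metis
    qed
  qed
qed

lemma associated_polys_ipolys:
  assumes "associated_polys p h av B g" shows "g b l \<in> ipolys"
proof (cases "b = 0")
  case True
  then show ?thesis using assms by (auto simp: associated_polys_def var_poly_def intro!: ipolys_monomial)
next
  case False
  then have "g b l \<in> polys_over T" using assms by (simp add: associated_polys_def Suc_le_eq One_nat_def)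
  then show ?thesis by (rule ipolys_teich)
qed

end

lemma ceil_star_le: "t \<le> real b \<Longrightarrow> ceil_star t \<le> b"
  unfolding ceil_star_def by (rule Least_le)

theorem theorem4p6:
  fixes p h s :: nat
    and av :: "'a::field_char_0 \<Rightarrow> real"
    and B :: "('n::finite \<Rightarrow> 'a) set"
    and g :: "nat \<Rightarrow> 'n \<Rightarrow> ('n, 'a) mpoly"
    and f :: "nat \<Rightarrow> ('n, 'a) mpoly"
    and F :: "nat \<Rightarrow> nat \<Rightarrow> ('n, 'a) mpoly"
    and m d r :: "nat \<Rightarrow> nat"
    and a :: "nat \<Rightarrow> nat \<Rightarrow> nat \<Rightarrow> 'a"
    and u :: "nat \<Rightarrow> nat \<Rightarrow> ('n \<Rightarrow>\<^sub>0 nat)"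
    and V :: "('n \<Rightarrow> 'a) set"
  assumes "unramified_extension p h av"
    and "is_box p h av B"
    and "associated_polys p h av B g"
    and "s \<ge> 1"
    and "\<And>k. k \<in> {1..s} \<Longrightarrow> f k \<in> polys_over (ring_of_integers av) \<and> f k \<noteq> 0"
    and "\<And>k. k \<in> {1..s} \<Longrightarrow> m k \<ge> 1"
    and "V = {Y \<in> B. \<forall>k\<in>{1..s}. (mpoly_eval (f k) Y, 0) \<in> cong_rel p av (m k)}"
    and "\<And>k. k \<in> {1..s} \<Longrightarrow> teich_expansion p h av (f k) (F k)"
    and "\<And>k i j. k \<in> {1..s} \<Longrightarrow> j \<in> {1..r k} \<Longrightarrow> a k i j \<in> teich p h av"
    and "\<And>k i. k \<in> {1..s} \<Longrightarrow> F k i = (\<Sum>j = 1..r k. monomial_poly (a k i j) (u k j))"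
    and "\<And>k. k \<in> {1..s} \<Longrightarrow> d k \<ge> 1"
    and "\<And>k i j (\<beta> :: 'n \<Rightarrow> nat \<Rightarrow> nat) \<beta>sum.
           k \<in> {1..s} \<Longrightarrow> i \<le> m k - 1 \<Longrightarrow> j \<in> {1..r k} \<Longrightarrow>
           \<beta>sum = (\<Sum>l\<in>UNIV. \<Sum>t = 1..Poly_Mapping.lookup (u k j) l. \<beta> l t) \<Longrightarrow>
           i + \<beta>sum \<le> m k - 1 \<Longrightarrow>
           total_degree (monomial_poly (a k i j) 0 *
             (\<Prod>l\<in>UNIV. \<Prod>t = 1..Poly_Mapping.lookup (u k j) l. g (\<beta> l t) l))
           \<le> d k * p ^ (h * ((i + \<beta>sum) div h))"
  shows "ord_q p h (card V) \<ge>
           ereal (real (ceil_star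
             ((real CARD('n) - (\<Sum>k = 1..s. (real p ^ m k - 1) / (real p - 1) * real (d k)))
              / (MAX k\<in>{1..s}. real (p ^ (m k - 1) * d k)))))"
proof -
  interpret unram p h av using assms(1) by unfold_locales
  obtain Y where Y: "bij_betw Y Tn B" "\<And>X l. X \<in> Tn \<Longrightarrow> teich_lift p h av (Y X l) = X l"
    using box_parametrization[OF assms(2)] by metis
  have YB: "Y X \<in> B" if "X \<in> Tn" for X using Y(1) that by (auto simp: bij_betw_def)
  have pexp: "p_expansion p av (\<lambda>b. mpoly_eval (g b l) X) (Y X l)" if "X \<in> Tn" for X l
  proof -
    have "p_expansion p av (\<lambda>b. mpoly_eval (g b l) (\<lambda>l. teich_lift p h av (Y X l))) (Y X l)"
      using assms(3) YB[OF that] unfolding associated_polys_def by blast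
    then show ?thesis by (simp add: Y(2)[OF that])
  qed
  have filt: "filt (d k) (m k) 0 (\<lambda>X. mpoly_eval (f k) (Y X))" if k: "k \<in> {1..s}" for k
    by (rule filt_mpoly_box[where g = g and F = "F k" and a = "a k" and u = "u k" and r = "r k",
          OF assms(6)[OF k] associated_polys_ipolys[OF assms(3)] pexp assms(8)[OF k]
             assms(10)[OF k] assms(9)[OF k] assms(12)[OF k]])
  define P where "P k L c w \<longleftrightarrow> (k \<in> {1..s} \<longrightarrow>
     (\<forall>v<m k. \<forall>e<L v. c v e \<in> T \<and> (\<Sum>l\<in>UNIV. w v e l) \<le> d k * p ^ v) \<and>
     (\<forall>X\<in>Tn. dv (m k) (mpoly_eval (f k) (Y X)) \<longleftrightarrow>
        (\<forall>v<m k. dv 1 (\<Sum>e<L v. c v e * (\<Prod>l\<in>UNIV. X l ^ w v e l)))))"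
    for k and L :: "nat \<Rightarrow> nat" and c and w :: "nat \<Rightarrow> nat \<Rightarrow> 'n \<Rightarrow> nat"
  have "\<exists>L c w. P k L c w" for k
    unfolding P_def using filt_conditions[OF filt[of k]] by blast
  then obtain L c w where Lcw: "\<And>k. P k (L k) (c k) (w k)" by metis
  \<comment> \<open>A pair \<open>(k, v)\<close> stands for the condition of level \<open>v\<close>
    obtained from \<open>f k\<close>, of degree at most \<open>D (k, v)\<close>.\<close>
  define K where "K = Sigma {1..s} (\<lambda>k. {..<m k})"
  define D where "D x = d (fst x) * p ^ snd x" for x :: "nat \<times> nat"
  define W where "W = {X \<in> Tn. \<forall>x\<in>K. dv 1 (\<Sum>e<L (fst x) (snd x). c (fst x) (snd x) e *
    (\<Prod>l\<in>UNIV. X l ^ w (fst x) (snd x) e l))}"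
  define M where "M = (MAX k\<in>{1..s}. real (p ^ (m k - 1) * d k))"
  define t where "t = (real CARD('n) - (\<Sum>k = 1..s. (real p ^ m k - 1) / (real p - 1) * real (d k))) / M"
  have "V = Y ` W"
  proof -
    have "(mpoly_eval (f k) (Y X), 0) \<in> cong_rel p av (m k) \<longleftrightarrow>
      (\<forall>v<m k. dv 1 (\<Sum>e<L k v. c k v e * (\<Prod>l\<in>UNIV. X l ^ w k v e l)))"
      if "X \<in> Tn" "k \<in> {1..s}" for X k
    proof -
      have "(mpoly_eval (f k) (Y X), 0) \<in> cong_rel p av (m k) \<longleftrightarrow> dv (m k) (mpoly_eval (f k) (Y X))"
        using dv_antimono[of "m k" "mpoly_eval (f k) (Y X)" 0] by (auto simp: cong_rel_iff)
      then show ?thesis using Lcw[of k] that unfolding P_def by blast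
    qed
    then have "(\<forall>k\<in>{1..s}. (mpoly_eval (f k) (Y X), 0) \<in> cong_rel p av (m k)) \<longleftrightarrow> X \<in> W" if "X \<in> Tn" for X
      using that unfolding W_def K_def by auto
    moreover have "B = Y ` Tn" using Y(1) by (simp add: bij_betw_def)
    moreover have "W \<subseteq> Tn" by (auto simp: W_def)
    ultimately show ?thesis unfolding assms(7) by blast
  qed
  moreover have "inj_on Y W" using Y(1) unfolding bij_betw_def W_def by (auto intro: inj_on_subset)
  ultimately have cV: "card V = card W" by (simp add: card_image)
  have "M \<in> (\<lambda>k. real (p ^ (m k - 1) * d k)) ` {1..s}"
    unfolding M_def using assms(4) by (intro Max_in) auto
  then obtain k0 where k0: "k0 \<in> {1..s}" "M = real (p ^ (m k0 - 1) * d k0)" by blast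
  define Dm where "Dm = p ^ (m k0 - 1) * d k0"
  have Dm1: "Dm \<ge> 1" using p_pos assms(11)[OF k0(1)] by (simp add: Dm_def Suc_le_eq One_nat_def)
  have D_le: "D x \<le> Dm" if "x \<in> K" for x
  proof -
    from that obtain k v where x: "x = (k, v)" "k \<in> {1..s}" "v < m k" by (auto simp: K_def)
    have "real (p ^ (m k - 1) * d k) \<le> M" unfolding M_def using x(2) by (intro Max_ge) auto
    then have "p ^ (m k - 1) * d k \<le> Dm" unfolding k0(2) Dm_def by (simp only: of_nat_le_iff)
    moreover have "p ^ v * d k \<le> p ^ (m k - 1) * d k"
      using x(3) p_pos by (intro mult_le_mono1 power_increasing) auto
    ultimately have "p ^ v * d k \<le> Dm" by linarith
    then show ?thesis unfolding x(1) D_def by (simp add: mult.commute)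
  qed
  have sumD: "(\<Sum>k = 1..s. (real p ^ m k - 1) / (real p - 1) * real (d k)) = real (\<Sum>x\<in>K. D x)"
  proof -
    have "(\<Sum>x\<in>K. D x) = (\<Sum>k = 1..s. \<Sum>v<m k. d k * p ^ v)"
      unfolding K_def D_def by (subst sum.Sigma) (auto simp: case_prod_beta)
    then have "real (\<Sum>x\<in>K. D x) = (\<Sum>k = 1..s. real (d k) * (\<Sum>v<m k. real p ^ v))"
      by (simp add: sum_distrib_left)
    also have "\<dots> = (\<Sum>k = 1..s. real (d k) * ((real p ^ m k - 1) / (real p - 1)))"
      using p_gt_1 by (simp add: geometric_sum)
    finally show ?thesis by (simp add: mult.commute)
  qed
  have "p ^ (h * ceil_star t) dvd card W"
    unfolding W_def
  proof (rule ax_katz)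
    show "finite K" by (simp add: K_def)
    show "c (fst x) (snd x) e \<in> T" "(\<Sum>l\<in>UNIV. w (fst x) (snd x) e l) \<le> D x"
      if "x \<in> K" "e < L (fst x) (snd x)" for x e
      using Lcw[of "fst x"] that unfolding P_def K_def D_def by auto
    show "D x \<le> Dm" if "x \<in> K" for x using that by (rule D_le)
    show "Dm \<ge> 1" by (rule Dm1)
    \<comment> \<open>Solving for \<open>b\<close> gives \<open>t \<le> b\<close>, and
      \<open>ceil_star t\<close> is the least natural number with this property.\<close>
    fix b assume "CARD('n) \<le> (\<Sum>x\<in>K. D x) + Dm * b"
    then have "real CARD('n) \<le> real (\<Sum>x\<in>K. D x) + M * real b"
      unfolding k0(2) Dm_def[symmetric] by (metis of_nat_add of_nat_le_iff of_nat_mult)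
    moreover have "M > 0" using Dm1 unfolding k0(2) Dm_def[symmetric] by simp
    ultimately have "t \<le> real b" unfolding t_def sumD by (simp add: divide_le_eq mult.commute)
    then show "ceil_star t \<le> b" by (rule ceil_star_le)
  qed
  then have dvd: "p ^ (h * ceil_star t) dvd card V" by (simp add: cV)
  have "ereal (real (ceil_star t)) \<le> ord_q p h (card V)"
  proof (cases "card V = 0")
    case False
    then have "h * ceil_star t \<le> multiplicity p (card V)"
      using dvd p_gt_1 by (intro multiplicity_geI) auto
    then have "real h * real (ceil_star t) \<le> real (multiplicity p (card V))"
      by (metis of_nat_le_iff of_nat_mult)
    then show ?thesis using False h_pos by (simp add: ord_q_def pos_le_divide_eq mult.commute)
  qed (simp add: ord_q_def)
  then show ?thesis unfolding t_def M_def .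
qed

end
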